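(* Let $\Bbbk$ be a field and let $R$ be a Koszul $\Bbbk$-algebra. Then $R$ is Hilbert-cyclotomic if and only if $R$ is a complete intersection.
   Context: A graded algebra is a commutative finitely generated $\mathbb{N}$-graded $\Bbbk$-algebra $R=\bigoplus_{i\in\mathbb{N}}R_i$ with $R_0=\Bbbk$, where $\Bbbk$ is a field. It is standard graded if it is generated as a $\Bbbk$-algebra by $R_1$. The Hilbert series of $R$ is $H(R,x)=\sum_{i\ge 0}(\dim_{\Bbbk}R_i)x^i$; it is a rational function, written reduced to lowest terms as $H(R,x)=N_R(x)/D_R(x)$ with $N_R,D_R\in\mathbb{Z}[x]$, normalized so that $N_R(0)=D_R(0)=1$. If $R$ is standard graded of Krull dimension $d$, then $D_R(x)=(1-x)^d$, and $N_R$ is called the $h$-polynomial of $R$. $R$ is Hilbert-cyclotomic (or cyclotomic) if $N_R$ is a Kronecker polynomial, i.e. all of its complex roots lie on the unit circle (vacuously true if $N_R=1$). A standard graded $\Bbbk$-algebra $R$ is Koszul if $\operatorname{Tor}^R_i(\Bbbk,\Bbbk)_j=0$ whenever $i\ne j$, where $\Bbbk=R/\bigoplus_{i>0}R_i$ is the residue field. A graded algebra $R$ is a (graded) complete intersection if it is isomorphic, as a graded algebra, to a quotient of a positively graded polynomial ring $\Bbbk[x_1,\dots,x_n]$ (each $x_i$ homogeneous of positive degree) by an ideal generated by a (possibly empty) homogeneous regular sequence. *)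

theory Defs
  imports
    Complex_Main
    "HOL-Library.Poly_Mapping"
    "HOL-Computational_Algebra.Computational_Algebra"
begin

type_synonym 'k mpoly = "(nat \<Rightarrow>\<^sub>0 nat) \<Rightarrow>\<^sub>0 'k"

text \<open>
  The type \<open>'k mpoly\<close> has countably many variables; \<open>poly_ring n\<close> is the subring
  \<open>k[x\<^sub>0, \<dots>, x\<^sub>n\<^sub>-\<^sub>1]\<close>. Ideals and regular sequences below are those of this subring.
\<close>

definition poly_ring :: "nat \<Rightarrow> 'k::field mpoly set" where
  "poly_ring n = {p. \<forall>m \<in> Poly_Mapping.keys p. Poly_Mapping.keys m \<subseteq> {..<n}}"

definition weighted_degree :: "(nat \<Rightarrow> nat) \<Rightarrow> (nat \<Rightarrow>\<^sub>0 nat) \<Rightarrow> nat" where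
  "weighted_degree w m = (\<Sum>i \<in> Poly_Mapping.keys m. w i * Poly_Mapping.lookup m i)"

definition poly_comp :: "nat \<Rightarrow> (nat \<Rightarrow> nat) \<Rightarrow> nat \<Rightarrow> 'k::field mpoly set" where
  "poly_comp n w j = {p \<in> poly_ring n. \<forall>m \<in> Poly_Mapping.keys p. weighted_degree w m = j}"

definition gen_ideal :: "nat \<Rightarrow> 'k::field mpoly list \<Rightarrow> 'k mpoly set" where
  "gen_ideal n fs = {\<Sum>i<length fs. q i * fs ! i | q. \<forall>i<length fs. q i \<in> poly_ring n}"

definition regular_sequence :: "nat \<Rightarrow> 'k::field mpoly list \<Rightarrow> bool" where
  "regular_sequence n fs \<longleftrightarrow>
     set fs \<subseteq> poly_ring n \<and>
     (\<forall>i<length fs. \<forall>g \<in> poly_ring n.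
        fs ! i * g \<in> gen_ideal n (take i fs) \<longrightarrow> g \<in> gen_ideal n (take i fs)) \<and>
     1 \<notin> gen_ideal n fs"

definition coset :: "'b::ab_group_add set \<Rightarrow> 'b \<Rightarrow> 'b set" where
  "coset I p = (+) p ` I"

text \<open>
  The free module of rank \<open>n\<close> is the set of functions \<open>nat \<Rightarrow> 'a\<close> vanishing outside \<open>{..<n}\<close>.
\<close>

definition free_module :: "nat \<Rightarrow> (nat \<Rightarrow> 'a::comm_ring_1) set" where
  "free_module n = {v. \<forall>b\<ge>n. v b = 0}"

text \<open>
  \<open>free_comp A n e j\<close> is the component of degree \<open>j\<close> of \<open>\<Oplus>b<n. R(- e b)\<close>, where \<open>R\<close> is
  graded by \<open>A\<close>.
\<close>

definition free_comp ::
    "(nat \<Rightarrow> 'a::comm_ring_1 set) \<Rightarrow> nat \<Rightarrow> (nat \<Rightarrow> nat) \<Rightarrow> nat \<Rightarrow> (nat \<Rightarrow> 'a) set" where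
  "free_comp A n e j =
     {v \<in> free_module n. \<forall>b<n. if e b \<le> j then v b \<in> A (j - e b) else v b = 0}"

definition graded_linear_map ::
    "(nat \<Rightarrow> 'a::comm_ring_1 set) \<Rightarrow> nat \<Rightarrow> (nat \<Rightarrow> nat) \<Rightarrow> nat \<Rightarrow> (nat \<Rightarrow> nat) \<Rightarrow>
     ((nat \<Rightarrow> 'a) \<Rightarrow> (nat \<Rightarrow> 'a)) \<Rightarrow> bool" where
  "graded_linear_map A n e n' e' f \<longleftrightarrow>
     f ` free_module n \<subseteq> free_module n' \<and>
     (\<forall>u \<in> free_module n. \<forall>v \<in> free_module n. f (\<lambda>b. u b + v b) = (\<lambda>b. f u b + f v b)) \<and>
     (\<forall>x. \<forall>v \<in> free_module n. f (\<lambda>b. x * v b) = (\<lambda>b. x * f v b)) \<and>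
     (\<forall>j. f ` free_comp A n e j \<subseteq> free_comp A n' e' j)"

definition kronecker_poly :: "int poly \<Rightarrow> bool" where
  "kronecker_poly p \<longleftrightarrow> (\<forall>z::complex. poly (map_poly of_int p) z = 0 \<longrightarrow> norm z = 1)"

locale vector_space_algebra = vector_space scale
  for scale :: "'k::field \<Rightarrow> 'a::comm_ring_1 \<Rightarrow> 'a" +
  assumes scale_mult_left: "scale c (x * y) = scale c x * y"
begin

definition subalgebra :: "'a set \<Rightarrow> bool" where
  "subalgebra B \<longleftrightarrow> subspace B \<and> 1 \<in> B \<and> (\<forall>x \<in> B. \<forall>y \<in> B. x * y \<in> B)"

end

locale graded_algebra = vector_space_algebra scale
  for scale :: "'k::field \<Rightarrow> 'a::comm_ring_1 \<Rightarrow> 'a" +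
  fixes A :: "nat \<Rightarrow> 'a set"
  assumes subspace_comp: "subspace (A i)"
    and mult_comp: "x \<in> A i \<Longrightarrow> y \<in> A j \<Longrightarrow> x * y \<in> A (i + j)"
    and direct_sum:
      "\<exists>!c. (\<forall>i. c i \<in> A i) \<and> finite {i. c i \<noteq> 0} \<and> x = (\<Sum>i | c i \<noteq> 0. c i)"
    and comp_zero: "A 0 = range (\<lambda>c. scale c 1)"
    and finitely_generated: "\<exists>S. finite S \<and> subalgebra hull S = UNIV"
begin

definition standard_graded :: bool where
  "standard_graded \<longleftrightarrow> subalgebra hull (A 1) = UNIV"

definition hilbert_series :: "int fps" where
  "hilbert_series = Abs_fps (\<lambda>i. int (dim (A i)))"

definition hilbert_fraction :: "int poly \<Rightarrow> int poly \<Rightarrow> bool" where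
  "hilbert_fraction N D \<longleftrightarrow>
     coprime N D \<and> poly N 0 = 1 \<and> poly D 0 = 1 \<and>
     hilbert_series * fps_of_poly D = fps_of_poly N"

definition hilbert_numerator :: "int poly" where
  "hilbert_numerator = (THE N. \<exists>D. hilbert_fraction N D)"

definition hilbert_cyclotomic :: bool where
  "hilbert_cyclotomic \<longleftrightarrow> kronecker_poly hilbert_numerator"

definition irrelevant :: "'a set" where
  "irrelevant = span (\<Union>i\<in>{0<..}. A i)"

definition residue :: "'a \<Rightarrow> 'k" where
  "residue x = (THE c. x - scale c 1 \<in> irrelevant)"

text \<open>
  A graded free resolution
  \<open>\<dots> \<rightarrow> F\<^sub>2 \<rightarrow> F\<^sub>1 \<rightarrow> F\<^sub>0 \<rightarrow> k \<rightarrow> 0\<close>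
  of the residue field, which is an \<open>R\<close>-module via \<open>residue\<close> and is concentrated in degree 0.
  The module \<open>F\<^sub>i\<close> has rank \<open>r i\<close> and basis degrees \<open>e i\<close>; the map \<open>d i\<close> goes from
  \<open>F\<^sub>i\<^sub>+\<^sub>1\<close> to \<open>F\<^sub>i\<close>, and \<open>\<epsilon>\<close> is the augmentation. As \<open>R\<close> is Noetherian and \<open>\<nat>\<close>-graded,
  resolutions by modules of finite rank with basis degrees in \<open>\<nat>\<close> exist.
\<close>

definition free_resolution ::
    "(nat \<Rightarrow> nat) \<Rightarrow> (nat \<Rightarrow> nat \<Rightarrow> nat) \<Rightarrow> (nat \<Rightarrow> (nat \<Rightarrow> 'a) \<Rightarrow> (nat \<Rightarrow> 'a)) \<Rightarrow>
     ((nat \<Rightarrow> 'a) \<Rightarrow> 'k) \<Rightarrow> bool" where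
  "free_resolution r e d \<epsilon> \<longleftrightarrow>
     (\<forall>i. graded_linear_map A (r (Suc i)) (e (Suc i)) (r i) (e i) (d i)) \<and>
     (\<forall>u \<in> free_module (r 0). \<forall>v \<in> free_module (r 0). \<epsilon> (\<lambda>b. u b + v b) = \<epsilon> u + \<epsilon> v) \<and>
     (\<forall>x. \<forall>v \<in> free_module (r 0). \<epsilon> (\<lambda>b. x * v b) = residue x * \<epsilon> v) \<and>
     (\<forall>j>0. \<forall>v \<in> free_comp A (r 0) (e 0) j. \<epsilon> v = 0) \<and>
     \<epsilon> ` free_module (r 0) = UNIV \<and>
     d 0 ` free_module (r 1) = {v \<in> free_module (r 0). \<epsilon> v = 0} \<and>
     (\<forall>i. d (Suc i) ` free_module (r (Suc (Suc i))) =
            {v \<in> free_module (r (Suc i)). d i v = (\<lambda>b. 0)})"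

text \<open>
  \<open>Tor\<^sub>i(k, k)\<close> is the homology of \<open>F \<otimes> k = F / \<mm>F\<close>, where \<open>\<mm>\<close> is the irrelevant ideal.
  Cycles and boundaries are represented by their preimages in the degree \<open>j\<close> part of \<open>F\<^sub>i\<close>, and
  \<open>\<mm>F\<^sub>i\<close> consists of the elements of \<open>F\<^sub>i\<close> whose coordinates all lie in \<open>\<mm>\<close>.
\<close>

definition irrelevant_free :: "nat \<Rightarrow> (nat \<Rightarrow> 'a) set" where
  "irrelevant_free n = {v \<in> free_module n. \<forall>b<n. v b \<in> irrelevant}"

definition tor_cycles ::
    "(nat \<Rightarrow> nat) \<Rightarrow> (nat \<Rightarrow> nat \<Rightarrow> nat) \<Rightarrow> (nat \<Rightarrow> (nat \<Rightarrow> 'a) \<Rightarrow> (nat \<Rightarrow> 'a)) \<Rightarrow>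
     nat \<Rightarrow> nat \<Rightarrow> (nat \<Rightarrow> 'a) set" where
  "tor_cycles r e d i j =
     {v \<in> free_comp A (r i) (e i) j.
        case i of 0 \<Rightarrow> True | Suc i' \<Rightarrow> d i' v \<in> irrelevant_free (r i')}"

definition tor_boundaries ::
    "(nat \<Rightarrow> nat) \<Rightarrow> (nat \<Rightarrow> nat \<Rightarrow> nat) \<Rightarrow> (nat \<Rightarrow> (nat \<Rightarrow> 'a) \<Rightarrow> (nat \<Rightarrow> 'a)) \<Rightarrow>
     nat \<Rightarrow> nat \<Rightarrow> (nat \<Rightarrow> 'a) set" where
  "tor_boundaries r e d i j =
     {v \<in> free_comp A (r i) (e i) j.
        \<exists>u \<in> free_comp A (r (Suc i)) (e (Suc i)) j.
          (\<lambda>b. v b - d i u b) \<in> irrelevant_free (r i)}"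

text \<open>
  \<open>Tor\<close> does not depend on the resolution, so it is computed from some graded free resolution.
\<close>

definition koszul :: bool where
  "koszul \<longleftrightarrow>
     standard_graded \<and>
     (\<exists>r e d \<epsilon>. free_resolution r e d \<epsilon> \<and>
        (\<forall>i j. i \<noteq> j \<longrightarrow> tor_cycles r e d i j = tor_boundaries r e d i j))"

text \<open>
  An isomorphism of graded algebras from \<open>k[x\<^sub>0, \<dots>, x\<^sub>n\<^sub>-\<^sub>1] / I\<close> to \<open>R\<close>, where \<open>x\<^sub>i\<close> has degree
  \<open>w i\<close>. The elements of the quotient are the cosets of \<open>I\<close>, its component of degree \<open>j\<close> is the
  image of that of the polynomial ring, and \<open>Poly_Mapping.single 0 c\<close> is the constant
  polynomial \<open>c\<close>.
\<close>

definition quotient_iso ::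
    "nat \<Rightarrow> (nat \<Rightarrow> nat) \<Rightarrow> 'k mpoly set \<Rightarrow> ('k mpoly set \<Rightarrow> 'a) \<Rightarrow> bool" where
  "quotient_iso n w I \<psi> \<longleftrightarrow>
     bij_betw \<psi> (coset I ` poly_ring n) UNIV \<and>
     \<psi> (coset I 1) = 1 \<and>
     (\<forall>p \<in> poly_ring n. \<forall>q \<in> poly_ring n.
        \<psi> (coset I (p + q)) = \<psi> (coset I p) + \<psi> (coset I q) \<and>
        \<psi> (coset I (p * q)) = \<psi> (coset I p) * \<psi> (coset I q)) \<and>
     (\<forall>c. \<forall>p \<in> poly_ring n.
        \<psi> (coset I (Poly_Mapping.single 0 c * p)) = scale c (\<psi> (coset I p))) \<and>
     (\<forall>j. \<psi> ` coset I ` poly_comp n w j = A j)"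

definition complete_intersection :: bool where
  "complete_intersection \<longleftrightarrow>
     (\<exists>n w fs \<psi>.
        (\<forall>i<n. 0 < w i) \<and>
        (\<forall>f \<in> set fs. \<exists>j. f \<in> poly_comp n w j) \<and>
        regular_sequence n fs \<and>
        quotient_iso n w (gen_ideal n fs) \<psi>)"

end

end

theory Submission
  imports
    Defs
    "HOL-Library.Function_Algebras"
    "HOL-Complex_Analysis.Cauchy_Integral_Formula"
begin

text \<open>
  Let \<open>f\<^sub>1, \<dots>, f\<^sub>\<mu>\<close> be a basis of the quadrics in the kernel \<open>I\<close> of \<open>k[x\<^sub>1, \<dots>, x\<^sub>n] \<rightarrow> R\<close>, where
  \<open>x\<^sub>1, \<dots>, x\<^sub>n\<close> map to a basis of \<open>R\<^sub>1\<close>, and write \<open>H\<^sub>R = N / (1 - x)\<^sup>d\<close> in lowest terms. As \<open>R\<close> is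
  Koszul, \<open>k\<close> has a linear resolution. Hence \<open>I\<close> is generated by the \<open>f\<^sub>l\<close>, and the Betti numbers
  \<open>b\<^sub>i\<close> of \<open>k\<close> satisfy \<open>H\<^sub>R(x) \<Sum>b\<^sub>i(-x)\<^sup>i = 1\<close>. The dual of the Clifford algebra of the quadratic form
  \<open>\<Sum>z\<^sub>l f\<^sub>l\<close> with values in \<open>k[z\<^sub>1, \<dots>, z\<^sub>\<mu>]\<close> embeds into the linear resolution, so the number \<open>b\<^sub>2\<^sub>r\<close>
  is at least the coefficient of \<open>x\<^sup>r\<close> in \<open>1 / (1 - x)\<^sup>\<mu>\<close>.

  If \<open>N\<close> is a Kronecker polynomial then \<open>\<Sum>b\<^sub>i x\<^sup>i = (1 + x)\<^sup>d / N(-x)\<close> converges in the unit disc.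
  Comparing it with \<open>1 / (1 - x\<^sup>2)\<^sup>\<mu>\<close> as \<open>x \<rightarrow> 1\<close> shows that \<open>(1 + x)\<^sup>\<mu>\<close> divides \<open>N\<close> in \<open>\<int>[x]\<close>, so
  \<open>N(1) \<ge> 2\<^sup>\<mu>\<close>. On the other hand, over an infinite extension field \<open>I\<close> contains a regular sequence of
  \<open>c = n - d\<close> quadrics, so \<open>H\<^sub>R \<le> (1 - x\<^sup>2)\<^sup>c / (1 - x)\<^sup>n\<close> and \<open>N(1) \<le> 2\<^sup>c\<close>; thus \<open>\<mu> \<le> c\<close>. Adding one
  quadric multiplies a Hilbert series at a point \<open>x\<close> of \<open>(0, 1)\<close> by at least \<open>1 - x\<^sup>2\<close>, with equality
  only for nonzerodivisors, so \<open>H\<^sub>R(x) \<ge> (1 - x\<^sup>2)\<^sup>\<mu> / (1 - x)\<^sup>n\<close>. Both estimates together force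
  equality, that is, \<open>f\<^sub>1, \<dots>, f\<^sub>\<mu>\<close> is a regular sequence.

  Conversely, for a complete intersection of degrees \<open>\<delta>\<^sub>i\<close> and weights \<open>w\<^sub>i\<close> the product
  \<open>H\<^sub>R \<Prod>(1 - x^w\<^sub>i)\<close> equals \<open>\<Prod>(1 - x^\<delta>\<^sub>i)\<close>, and \<open>N\<close> divides the latter.
\<close>

section \<open>Finite-dimensional linear algebra\<close>

text \<open>The argument covers every field, including characteristic 2. Quadrics are therefore kept
  as unsymmetrised coefficient arrays \<open>\<beta> l j k\<close>, squares of Clifford generators
  are treated apart from anticommutators, and nothing is divided by 2. The bound on Betti numbers is
  dual to a generation statement: as the quadrics are linearly independent, every z_l is a
  combination of products y_j y_k, so the y_j generate the Clifford algebra. Even Betti numbers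
  suffice since they already produce the full pole at 1. Krull dimension and depth enter through
  elementary substitutes: the order of the pole of a Hilbert series at 1, and the length of a
  sequence of linear nonzerodivisors. The estimate for one added quadric cannot be iterated
  coefficientwise because 1 - x^2 has a negative coefficient; at a real point of (0, 1) it can.
  Koszulness says that Tor is linear, while the resolution computing it may be far from minimal. A
  linear resolution is rebuilt from iterated syzygy modules, and elements of tensor products with
  them are written as matrices.\<close>

text \<open>
  A fresh copy of \<open>vector_space\<close>: declarations made inside the original would be shadowed by
  their instances for the type class of real vector spaces.
\<close>

locale vspace = vector_space
begin

text \<open>Records at once that \<open>V\<close> is a subspace, that it is finite-dimensional, and
  its dimension; an equation for \<open>dim\<close> alone would carry no finiteness.\<close>

definition has_dim :: "'b set \<Rightarrow> nat \<Rightarrow> bool" where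
  "has_dim V d \<longleftrightarrow> (\<exists>B. finite B \<and> independent B \<and> card B = d \<and> span B = V)"

lemma has_dim_imp_dim: "has_dim V d \<Longrightarrow> dim V = d"
  unfolding has_dim_def using dim_span_eq_card_independent by blast

lemma has_dim_subspace: "has_dim V d \<Longrightarrow> subspace V"
  unfolding has_dim_def using subspace_span by blast

lemma has_dim_zero: "has_dim {0} 0"
  unfolding has_dim_def by (rule exI[of _ "{}"]) (simp add: independent_empty)

lemma has_dim_insert:
  assumes "has_dim V d" "x \<notin> V"
  shows "has_dim (span (insert x V)) (Suc d)"
proof -
  obtain B where B: "finite B" "independent B" "card B = d" "span B = V"
    using assms(1) has_dim_def by auto
  have "x \<notin> B" using assms(2) B(4) span_base by blast
  moreover have "independent (insert x B)" using assms(2) B independent_insertI by blast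
  moreover have "span (insert x B) = span (insert x V)"
    using B(4) by (metis span_insert span_span)
  ultimately show ?thesis unfolding has_dim_def using B by (intro exI[of _ "insert x B"]) auto
qed

lemma has_dim_dim:
  assumes "subspace V" "finite B" "V \<subseteq> span B"
  shows "has_dim V (dim V)"
proof -
  obtain C where C: "C \<subseteq> V" "independent C" "V \<subseteq> span C" "card C = dim V"
    using basis_exists by blast
  have "finite C" using independent_span_bound[OF assms(2) C(2)] C(1) assms(3) by auto
  moreover have "span C = V" using C assms(1) span_minimal by blast
  ultimately show ?thesis unfolding has_dim_def using C by blast
qed

lemma has_dim_subset:
  assumes "has_dim V d" "subspace U" "U \<subseteq> V"
  shows "has_dim U (dim U)" "dim U \<le> d" "dim U = d \<Longrightarrow> U = V"
proof -
  obtain B where B: "finite B" "independent B" "card B = d" "span B = V"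
    using assms(1) has_dim_def by auto
  show U: "has_dim U (dim U)" using has_dim_dim assms B by blast
  then obtain C where C: "finite C" "independent C" "card C = dim U" "span C = U"
    using has_dim_def by auto
  have CB: "C \<subseteq> span B" using C(4) B(4) assms(3) span_superset by blast
  then show "dim U \<le> d" using independent_span_bound[OF B(1) C(2)] B(3) C(3) by simp
  show "U = V" if e: "dim U = d"
  proof (rule ccontr)
    assume "U \<noteq> V"
    then obtain x where x: "x \<in> V" "x \<notin> U" using assms(3) by blast
    then have "independent (insert x C)" using C independent_insertI by blast
    moreover have "insert x C \<subseteq> span B" using CB x B(4) by blast
    ultimately have "card (insert x C) \<le> card B" using independent_span_bound[OF B(1)] by blast
    moreover have "x \<notin> C" using x C(4) span_base by blast
    ultimately show False using C(1,3) B(3) e by simp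
  qed
qed

text \<open>Divided differences reduce the degree of the curve \<open>\<Sum>j. u ^ j w j\<close>.\<close>

lemma subspace_curve_coeffs:
  assumes "subspace V" "infinite U"
    and "\<And>u. u \<in> U \<Longrightarrow> (\<Sum>j<s. scale (u ^ j) (w j)) \<in> V" and "j < s"
  shows "w j \<in> V"
  using assms
proof (induction s arbitrary: w j U)
  case (Suc s)
  obtain v where v: "v \<in> U" using infinite_imp_nonempty[OF Suc.prems(2)] by blast
  define w' where "w' a = (\<Sum>j=Suc a..<Suc s. scale (v ^ (j - Suc a)) (w j))" for a
  have key: "(\<Sum>j<Suc s. scale (u ^ j) (w j)) - (\<Sum>j<Suc s. scale (v ^ j) (w j))
      = scale (u - v) (\<Sum>a<s. scale (u ^ a) (w' a))" for u
  proof -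
    have "(\<Sum>a<s. scale (u ^ a) (w' a)) =
        (\<Sum>a<s. \<Sum>j\<in>{Suc a..<Suc s}. scale (u ^ a * v ^ (j - Suc a)) (w j))"
      unfolding w'_def by (simp only: scale_sum_right scale_scale)
    also have "\<dots> = (\<Sum>j<Suc s. \<Sum>a<j. scale (u ^ a * v ^ (j - Suc a)) (w j))"
      unfolding sum.Sigma[OF finite_lessThan ballI[OF finite_atLeastLessThan]]
        sum.Sigma[OF finite_lessThan ballI[OF finite_lessThan]]
      by (rule sum.reindex_bij_witness[of _ "\<lambda>(j,a). (a,j)" "\<lambda>(a,j). (j,a)"]) auto
    also have "\<dots> = (\<Sum>j<Suc s. scale (\<Sum>a<j. u ^ a * v ^ (j - Suc a)) (w j))"
      by (simp add: scale_sum_left)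
    finally have "scale (u - v) (\<Sum>a<s. scale (u ^ a) (w' a)) =
        (\<Sum>j<Suc s. scale ((u - v) * (\<Sum>a<j. u ^ a * v ^ (j - Suc a))) (w j))"
      by (simp only: scale_sum_right scale_scale)
    also have "\<dots> = (\<Sum>j<Suc s. scale (u ^ j - v ^ j) (w j))"
      by (rule sum.cong[OF refl]) (simp add: power_diff_sumr2 mult.commute)
    also have "\<dots> = (\<Sum>j<Suc s. scale (u ^ j) (w j)) - (\<Sum>j<Suc s. scale (v ^ j) (w j))"
      unfolding sum_subtractf[symmetric] by (simp only: scale_left_diff_distrib)
    finally show ?thesis by simp
  qed
  have "(\<Sum>a<s. scale (u ^ a) (w' a)) \<in> V" if "u \<in> U - {v}" for u
  proof -
    have "scale (u - v) (\<Sum>a<s. scale (u ^ a) (w' a)) \<in> V"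
      unfolding key[symmetric] using that v Suc.prems(1,3) subspace_diff by blast
    then have "scale (inverse (u - v)) (scale (u - v) (\<Sum>a<s. scale (u ^ a) (w' a))) \<in> V"
      using Suc.prems(1) subspace_scale by blast
    then show ?thesis using that by simp
  qed
  then have w': "w' a \<in> V" if "a < s" for a
    using Suc.IH[OF Suc.prems(1), of "U - {v}" w' a] Suc.prems(2) that by auto
  have "w (Suc a) \<in> V" if "a < s" for a
  proof -
    \<comment> \<open>Horner's rule: this recursion can be solved for \<open>w (Suc a)\<close>, so
      membership passes from the divided differences \<open>w'\<close> back to
      \<open>w\<close>.\<close>
    have "w' a = w (Suc a) + scale v (if Suc a < s then w' (Suc a) else 0)"
    proof -
      have "w' a = w (Suc a) + (\<Sum>j=Suc (Suc a)..<Suc s. scale (v ^ (j - Suc a)) (w j))"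
        unfolding w'_def using that by (subst sum.atLeast_Suc_lessThan) auto
      also have "(\<Sum>j=Suc (Suc a)..<Suc s. scale (v ^ (j - Suc a)) (w j)) =
          scale v (\<Sum>j=Suc (Suc a)..<Suc s. scale (v ^ (j - Suc (Suc a))) (w j))"
        unfolding scale_sum_right
        by (rule sum.cong[OF refl]) (simp add: Suc_diff_Suc flip: power_Suc)
      also have "(\<Sum>j=Suc (Suc a)..<Suc s. scale (v ^ (j - Suc (Suc a))) (w j)) =
         (if Suc a < s then w' (Suc a) else 0)"
        unfolding w'_def using that by auto
      finally show ?thesis .
    qed
    then have "w (Suc a) = w' a - scale v (if Suc a < s then w' (Suc a) else 0)" by simp
    then show ?thesis
      using w' that Suc.prems(1) by (simp add: subspace_diff subspace_scale subspace_0)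
  qed
  then have pos: "w j \<in> V" if "0 < j" "j < Suc s" for j
    using that by (cases j) auto
  \<comment> \<open>The recursion misses the constant coefficient, which is recovered from the value
    of the curve at \<open>v\<close>.\<close>
  have "w 0 = (\<Sum>j<Suc s. scale (v ^ j) (w j)) - (\<Sum>j<s. scale (v ^ Suc j) (w (Suc j)))"
    by (simp add: sum.lessThan_Suc_shift del: sum.lessThan_Suc)
  then have "w 0 \<in> V"
    using Suc.prems(1,3) v pos by (auto intro!: subspace_diff subspace_sum subspace_scale)
  then show ?case using pos Suc.prems(4) by (cases "j = 0") auto
qed simp

end

locale vspace_pair = vs1: vspace s1 + vs2: vspace s2
  for s1 :: "'k::field \<Rightarrow> 'b::ab_group_add \<Rightarrow> 'b" and s2 :: "'k \<Rightarrow> 'c::ab_group_add \<Rightarrow> 'c"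
begin

sublocale vector_space_pair s1 s2 ..

text \<open>Rank and nullity for the map that \<open>f\<close> induces from \<open>V\<close> to the
  target modulo \<open>U\<close>, phrased without quotient spaces. Along a basis of
  \<open>V\<close>, a new vector \<open>b\<close> enlarges exactly one of the two spaces: the
  preimage if \<open>f b\<close> already lies in the sum, the sum otherwise. It serves with
  \<open>U = {0}\<close> for kernels and images, and with a component of an ideal as
  \<open>U\<close> for multiplication by a polynomial.\<close>

lemma dim_pullback:
  assumes f: "Vector_Spaces.linear s1 s2 f" and V: "vs1.has_dim V dV" and U: "vs2.has_dim U dU"
  shows "\<exists>d e. vs1.has_dim {v \<in> V. f v \<in> U} d \<and> vs2.has_dim {f v + u |v u. v \<in> V \<and> u \<in> U} e
      \<and> dV + dU = d + e"
proof -
  obtain B where B: "finite B" "vs1.independent B" "card B = dV" "vs1.span B = V"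
    using V vs1.has_dim_def by auto
  have sU: "vs2.subspace U" using U vs2.has_dim_subspace by blast
  have "\<exists>d e. vs1.has_dim {v \<in> vs1.span B. f v \<in> U} d
      \<and> vs2.has_dim {f v + u |v u. v \<in> vs1.span B \<and> u \<in> U} e \<and> card B + dU = d + e"
    using B(1,2)
  proof (induction B rule: finite_induct)
    case empty
    have "{v \<in> vs1.span {}. f v \<in> U} = {0}"
      using sU linear_0[OF f] vs2.subspace_0 by auto
    moreover have "{f v + u |v u. v \<in> vs1.span {} \<and> u \<in> U} = U"
      using linear_0[OF f] by auto
    ultimately show ?case using vs1.has_dim_zero U by auto
  next
    case (insert b B)
    let ?V = "vs1.span B" let ?V' = "vs1.span (insert b B)"
    let ?W = "{f v + u |v u. v \<in> ?V \<and> u \<in> U}"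
    have indB: "vs1.independent B" and b: "b \<notin> ?V"
      using insert.prems insert.hyps vs1.independent_insert by auto
    obtain d e where de: "vs1.has_dim {v \<in> ?V. f v \<in> U} d" "vs2.has_dim ?W e" "card B + dU = d + e"
      using insert.IH[OF indB] by blast
    have V': "v \<in> ?V' \<longleftrightarrow> (\<exists>k. v - s1 k b \<in> ?V)" for v
      by (simp add: vs1.span_insert)
    have sW: "vs2.subspace ?W" using de(2) vs2.has_dim_subspace by blast
    have UW: "U \<subseteq> ?W" using linear_0[OF f] vs1.span_zero by force
    show ?case
    proof (cases "f b \<in> ?W")
      case True
      \<comment> \<open>Corrected by \<open>v0\<close>, the basis vector maps into \<open>U\<close>,
        so \<open>b - v0\<close> spans the new direction of the preimage.\<close>
      then obtain v0 u0 where vu: "f b = f v0 + u0" "v0 \<in> ?V" "u0 \<in> U" by blast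
      have fx: "f (b - v0) \<in> U" using vu linear_diff[OF f] by simp
      have x: "b - v0 \<notin> ?V" using b vu(2) vs1.span_add by fastforce
      have sV0: "vs1.subspace {v \<in> ?V. f v \<in> U}" using de(1) vs1.has_dim_subspace by blast
      have "vs1.span (insert (b - v0) {v \<in> ?V. f v \<in> U}) = {v \<in> ?V'. f v \<in> U}"
      proof (intro set_eqI)
        fix v
        have "v \<in> vs1.span (insert (b - v0) {v \<in> ?V. f v \<in> U})
            \<longleftrightarrow> (\<exists>k. v - s1 k (b - v0) \<in> {v \<in> ?V. f v \<in> U})"
          by (simp add: vs1.span_insert vs1.span_eq_iff[THEN iffD2, OF sV0])
        also have "\<dots> \<longleftrightarrow> (\<exists>k. v - s1 k b \<in> ?V \<and> f v \<in> U)"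
        proof (intro arg_cong[where f = Ex] ext)
          fix k
          have e1: "v - s1 k (b - v0) = (v - s1 k b) + s1 k v0"
            by (simp add: vs1.scale_right_diff_distrib)
          have "(v - s1 k b) + s1 k v0 \<in> ?V \<longleftrightarrow> v - s1 k b \<in> ?V"
            using vs1.span_add_eq2[OF vs1.span_scale[OF vu(2)]] by blast
          moreover have "f (v - s1 k (b - v0)) \<in> U \<longleftrightarrow> f v \<in> U"
          proof -
            have "f (v - s1 k (b - v0)) = f v - s2 k (f (b - v0))"
              using linear_diff[OF f] linear_scale[OF f] by simp
            moreover have "s2 k (f (b - v0)) \<in> U" using fx sU vs2.subspace_scale by blast
            ultimately show ?thesis
              using vs2.subspace_add[OF sU, of "f v - s2 k (f (b - v0))" "s2 k (f (b - v0))"]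
                vs2.subspace_diff[OF sU, of "f v" "s2 k (f (b - v0))"] by auto
          qed
          ultimately show "(v - s1 k (b - v0) \<in> {v \<in> ?V. f v \<in> U}) = (v - s1 k b \<in> ?V \<and> f v \<in> U)"
            unfolding mem_Collect_eq by (simp only: e1)
        qed
        finally show "v \<in> vs1.span (insert (b - v0) {v \<in> ?V. f v \<in> U}) \<longleftrightarrow> v \<in> {v \<in> ?V'. f v \<in> U}"
          using V' by auto
      qed
      then have 1: "vs1.has_dim {v \<in> ?V'. f v \<in> U} (Suc d)"
        using vs1.has_dim_insert[OF de(1), of "b - v0"] x by auto
      have "{f v + u |v u. v \<in> ?V' \<and> u \<in> U} = ?W"
      proof (intro subset_antisym subsetI)
        fix y assume "y \<in> {f v + u |v u. v \<in> ?V' \<and> u \<in> U}"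
        then obtain v u where y: "y = f v + u" "v \<in> ?V'" "u \<in> U" by blast
        then obtain k where k: "v - s1 k b \<in> ?V" using V' by blast
        have "y = (f (v - s1 k b) + u) + s2 k (f b)"
          using y linear_diff[OF f] linear_scale[OF f] by simp
        moreover have "f (v - s1 k b) + u \<in> ?W" using k y(3) by blast
        ultimately show "y \<in> ?W"
          using vs2.subspace_add[OF sW _ vs2.subspace_scale[OF sW True]] by simp
      next
        fix y assume "y \<in> ?W"
        then show "y \<in> {f v + u |v u. v \<in> ?V' \<and> u \<in> U}"
          using vs1.span_mono[of B "insert b B"] by blast
      qed
      then show ?thesis using 1 de insert.hyps by (intro exI[of _ "Suc d"] exI[of _ e]) simp
    next
      case False
      have "{v \<in> ?V'. f v \<in> U} = {v \<in> ?V. f v \<in> U}"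
      proof (intro subset_antisym subsetI)
        fix v assume v: "v \<in> {v \<in> ?V'. f v \<in> U}"
        then obtain k where k: "v - s1 k b \<in> ?V" using V' by blast
        have "k = 0"
        proof (rule ccontr)
          assume "k \<noteq> 0"
          have "f (v - s1 k b) + (- f v) \<in> ?W" using k v sU vs2.subspace_neg by blast
          then have "s2 (- inverse k) (f (v - s1 k b) + (- f v)) \<in> ?W" using sW vs2.subspace_scale by blast
          then show False
            using False \<open>k \<noteq> 0\<close> linear_diff[OF f] linear_scale[OF f] by simp
        qed
        then show "v \<in> {v \<in> ?V. f v \<in> U}" using k v by simp
      next
        fix v assume "v \<in> {v \<in> ?V. f v \<in> U}"
        then show "v \<in> {v \<in> ?V'. f v \<in> U}" using vs1.span_mono[of B "insert b B"] by blast
      qed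
      moreover have "{f v + u |v u. v \<in> ?V' \<and> u \<in> U} = vs2.span (insert (f b) ?W)"
      proof (intro set_eqI)
        fix y
        have "y \<in> vs2.span (insert (f b) ?W) \<longleftrightarrow> (\<exists>k. y - s2 k (f b) \<in> ?W)"
          by (simp only: vs2.span_insert vs2.span_eq_iff[THEN iffD2, OF sW] mem_Collect_eq)
        also have "\<dots> \<longleftrightarrow> (\<exists>k v u. y - s2 k (f b) = f v + u \<and> v \<in> ?V \<and> u \<in> U)" by auto
        also have "\<dots> \<longleftrightarrow> (\<exists>v u. y = f v + u \<and> v \<in> ?V' \<and> u \<in> U)"
        proof
          assume "\<exists>k v u. y - s2 k (f b) = f v + u \<and> v \<in> ?V \<and> u \<in> U"
          then obtain k v u where "y - s2 k (f b) = f v + u" "v \<in> ?V" "u \<in> U" by blast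
          then have "y = f (v + s1 k b) + u"
            by (simp add: linear_add[OF f] linear_scale[OF f] algebra_simps)
          moreover have "v + s1 k b \<in> ?V'"
            unfolding V' using \<open>v \<in> ?V\<close> by (intro exI[of _ k]) simp
          ultimately show "\<exists>v u. y = f v + u \<and> v \<in> ?V' \<and> u \<in> U" using \<open>u \<in> U\<close> by blast
        next
          assume "\<exists>v u. y = f v + u \<and> v \<in> ?V' \<and> u \<in> U"
          then obtain v u where y: "y = f v + u" "v \<in> ?V'" "u \<in> U" by blast
          then obtain k where k: "v - s1 k b \<in> ?V" using V' by blast
          then have "y - s2 k (f b) = f (v - s1 k b) + u"
            using y linear_diff[OF f] linear_scale[OF f] by simp
          then show "\<exists>k v u. y - s2 k (f b) = f v + u \<and> v \<in> ?V \<and> u \<in> U" using k y by blast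
        qed
        finally show "y \<in> {f v + u |v u. v \<in> ?V' \<and> u \<in> U} \<longleftrightarrow> y \<in> vs2.span (insert (f b) ?W)"
          by auto
      qed
      ultimately show ?thesis
        using vs2.has_dim_insert[OF de(2) False] de insert.hyps
        by (intro exI[of _ d] exI[of _ "Suc e"]) simp
    qed
  qed
  then show ?thesis using B by simp
qed

lemma dim_kernel_image:
  assumes f: "Vector_Spaces.linear s1 s2 f" and V: "vs1.has_dim V d"
  shows "vs1.dim {v \<in> V. f v = 0} + vs2.dim (f ` V) = d" "vs2.has_dim (f ` V) (vs2.dim (f ` V))"
proof -
  have e: "{f v + u |v u. v \<in> V \<and> u \<in> {0}} = f ` V" by auto
  show "vs1.dim {v \<in> V. f v = 0} + vs2.dim (f ` V) = d" "vs2.has_dim (f ` V) (vs2.dim (f ` V))"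
    using dim_pullback[OF f V vs2.has_dim_zero] vs1.has_dim_imp_dim vs2.has_dim_imp_dim
    unfolding e by auto
qed

end

section \<open>Weighted polynomial rings and Hilbert functions\<close>

abbreviation "cf \<equiv> Poly_Mapping.lookup"
abbreviation "supp \<equiv> Poly_Mapping.keys"
abbreviation "mterm \<equiv> Poly_Mapping.single"

definition smul :: "'k::field \<Rightarrow> 'k mpoly \<Rightarrow> 'k mpoly" where
  "smul c p = mterm 0 c * p"

text \<open>Restricting the support is a linear projection. It yields homogeneous components, and
  later extends a map given only on \<open>poly_ring n\<close> to a linear map on the whole
  type.\<close>

definition restr :: "'i set \<Rightarrow> ('i \<Rightarrow>\<^sub>0 'k::zero) \<Rightarrow> ('i \<Rightarrow>\<^sub>0 'k)" where
  "restr S p = Abs_poly_mapping (\<lambda>m. if m \<in> S then cf p m else 0)"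

definition var :: "nat \<Rightarrow> 'k::field mpoly" where
  "var i = mterm (mterm i 1) 1"

lemma cf_restr [simp]: "cf (restr S p) m = (if m \<in> S then cf p m else 0)"
proof -
  have "m \<in> supp p" if "(if m \<in> S then cf p m else 0) \<noteq> 0" for m
    using that by (cases "m \<in> S") (simp_all add: in_keys_iff)
  then have "finite {m. (if m \<in> S then cf p m else 0) \<noteq> 0}"
    by (intro finite_subset[OF _ finite_keys[of p]]) blast
  then show ?thesis unfolding restr_def by simp
qed

lemma supp_restr [simp]: "supp (restr S p) = supp p \<inter> S"
  by (auto simp: in_keys_iff split: if_splits)

lemma restr_add: "restr S (p + q) = restr S p + restr S (q :: 'i \<Rightarrow>\<^sub>0 'k::monoid_add)"
  by (rule poly_mapping_eqI) (simp add: lookup_add)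

lemma restr_zero [simp]: "restr S 0 = 0"
  by (rule poly_mapping_eqI) simp

lemma restr_sum: "restr S (\<Sum>i\<in>I. f i) = (\<Sum>i\<in>I. restr S (f i :: 'i \<Rightarrow>\<^sub>0 'k::comm_monoid_add))"
  by (induction I rule: infinite_finite_induct) (auto simp: restr_add)

lemma restr_id: "supp p \<subseteq> S \<Longrightarrow> restr S p = p"
  by (rule poly_mapping_eqI) (auto simp: in_keys_iff)

lemma restr_eq_0: "supp p \<inter> S = {} \<Longrightarrow> restr S p = 0"
  by (rule poly_mapping_eqI) (auto simp: in_keys_iff)

lemma mpoly_sum_terms: "p = (\<Sum>m\<in>supp p. mterm m (cf p m))"
  by (rule poly_mapping_eqI) (auto simp: lookup_sum lookup_single when_def in_keys_iff)

lemma mterm_mult_sum: "mterm a c * p = (\<Sum>m\<in>supp p. mterm (a + m) (c * cf p m))"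
  by (subst mpoly_sum_terms[of p]) (simp add: sum_distrib_left mult_single)

lemma cf_mterm_mult: "cf (mterm a c * p) (a + m) = c * cf (p :: ('i::cancel_comm_monoid_add) \<Rightarrow>\<^sub>0 'k::comm_semiring_0) m"
  unfolding mterm_mult_sum by (auto simp: lookup_sum lookup_single when_def in_keys_iff)

lemma cf_mterm_mult_eq_0: "(\<And>m. k \<noteq> a + m) \<Longrightarrow> cf (mterm a c * p) k = 0"
  unfolding mterm_mult_sum lookup_sum lookup_single when_def by (rule sum.neutral) auto

lemma supp_mterm_mult:
  "c \<noteq> 0 \<Longrightarrow> supp (mterm a c * p) = (+) a ` supp (p :: ('i::cancel_comm_monoid_add) \<Rightarrow>\<^sub>0 'k::idom)"
proof (intro set_eqI iffI)
  fix k assume k: "k \<in> supp (mterm a c * p)"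
  then obtain m where "k = a + m" using cf_mterm_mult_eq_0[of k a c p] by (auto simp: in_keys_iff)
  then show "k \<in> (+) a ` supp p" using k cf_mterm_mult[of a c p m] by (auto simp: in_keys_iff)
next
  fix k assume "c \<noteq> 0" "k \<in> (+) a ` supp p"
  then show "k \<in> supp (mterm a c * p)" by (auto simp: in_keys_iff cf_mterm_mult)
qed

lemma cf_smul [simp]: "cf (smul c p) m = c * cf p m"
  unfolding smul_def using cf_mterm_mult[of 0 c p m] by simp

lemma smul_mult_left: "smul c p * q = smul c (p * q)"
  by (simp add: smul_def mult.assoc)

lemma smul_mult_right: "p * smul c q = smul c (p * q)"
  by (simp add: smul_def mult_ac)

lemma restr_smul: "restr S (smul c p) = smul c (restr S p)"
  by (rule poly_mapping_eqI) simp

global_interpretation mp: vspace "smul :: 'k::field \<Rightarrow> 'k mpoly \<Rightarrow> 'k mpoly"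
proof unfold_locales
  fix a b :: 'k and x y :: "'k mpoly"
  show "smul a (x + y) = smul a x + smul a y" by (simp add: smul_def algebra_simps)
  show "smul (a + b) x = smul a x + smul b x" by (simp add: smul_def single_add algebra_simps)
  show "smul a (smul b x) = smul (a * b) x"
    by (rule poly_mapping_eqI) (simp add: mult.assoc)
  show "smul 1 x = x" by (simp add: smul_def)
qed

lemma weighted_degree_superset:
  "finite T \<Longrightarrow> supp m \<subseteq> T \<Longrightarrow> weighted_degree w m = (\<Sum>i\<in>T. w i * cf m i)"
  unfolding weighted_degree_def by (rule sum.mono_neutral_left) (auto simp: in_keys_iff)

lemma weighted_degree_add: "weighted_degree w (a + b) = weighted_degree w a + weighted_degree w b"
proof -
  let ?T = "supp a \<union> supp b"
  have "weighted_degree w (a + b) = (\<Sum>i\<in>?T. w i * cf (a + b) i)"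
    using keys_add[of a b] by (intro weighted_degree_superset) auto
  also have "\<dots> = (\<Sum>i\<in>?T. w i * cf a i) + (\<Sum>i\<in>?T. w i * cf b i)"
    by (simp add: lookup_add distrib_left sum.distrib)
  finally show ?thesis by (simp add: weighted_degree_superset[of ?T])
qed

lemma weighted_degree_zero [simp]: "weighted_degree w 0 = 0"
  by (simp add: weighted_degree_def)

lemma weighted_degree_single [simp]: "weighted_degree w (mterm i a) = w i * a"
  by (simp add: weighted_degree_def)

lemma poly_ring_zero [simp]: "0 \<in> poly_ring n"
  by (simp add: poly_ring_def)

lemma poly_ring_one [simp]: "1 \<in> poly_ring n"
  by (simp add: poly_ring_def)

lemma poly_ring_mterm: "supp m \<subseteq> {..<n} \<Longrightarrow> mterm m c \<in> poly_ring n"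
  by (simp add: poly_ring_def)

lemma poly_ring_const [simp]: "mterm 0 c \<in> poly_ring n"
  by (simp add: poly_ring_def)

lemma poly_ring_add [intro]: "p \<in> poly_ring n \<Longrightarrow> q \<in> poly_ring n \<Longrightarrow> p + q \<in> poly_ring n"
  unfolding poly_ring_def using keys_add[of p q] by blast

lemma poly_ring_mult [intro]: "p \<in> poly_ring n \<Longrightarrow> q \<in> poly_ring n \<Longrightarrow> p * q \<in> poly_ring n"
proof -
  assume pq: "p \<in> poly_ring n" "q \<in> poly_ring n"
  have "supp m \<subseteq> {..<n}" if m: "m \<in> supp (p * q)" for m
  proof -
    obtain a b where "m = a + b" "a \<in> supp p" "b \<in> supp q" using keys_mult[of p q] m by blast
    then show ?thesis using pq keys_add[of a b] unfolding poly_ring_def by blast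
  qed
  then show ?thesis by (simp add: poly_ring_def)
qed

lemma poly_ring_smul [intro]: "p \<in> poly_ring n \<Longrightarrow> smul c p \<in> poly_ring n"
  unfolding smul_def by (simp add: poly_ring_mult)

lemma poly_ring_uminus [intro]: "p \<in> poly_ring n \<Longrightarrow> - p \<in> poly_ring n"
  by (simp add: poly_ring_def)

lemma poly_ring_diff [intro]: "p \<in> poly_ring n \<Longrightarrow> q \<in> poly_ring n \<Longrightarrow> p - q \<in> poly_ring n"
  using poly_ring_add[OF _ poly_ring_uminus] by fastforce

lemma poly_ring_sum [intro]: "(\<And>i. i \<in> I \<Longrightarrow> f i \<in> poly_ring n) \<Longrightarrow> sum f I \<in> poly_ring n"
  by (induction I rule: infinite_finite_induct) auto

lemma poly_ring_restr [intro]: "p \<in> poly_ring n \<Longrightarrow> restr S p \<in> poly_ring n"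
  by (simp add: poly_ring_def)

lemma poly_ring_var [simp]: "i < n \<Longrightarrow> var i \<in> poly_ring n"
  by (simp add: var_def poly_ring_def)

section \<open>Homogeneous ideals of a weighted polynomial ring and their Hilbert functions\<close>

locale wpoly =
  fixes n :: nat and w :: "nat \<Rightarrow> nat"
  assumes w_pos: "i < n \<Longrightarrow> 0 < w i"
begin

abbreviation P :: "'k::field mpoly set" where "P \<equiv> poly_ring n"
abbreviation C :: "nat \<Rightarrow> 'k::field mpoly set" where "C j \<equiv> poly_comp n w j"

definition hc :: "nat \<Rightarrow> 'k::field mpoly \<Rightarrow> 'k mpoly" where
  "hc j p = restr {m. weighted_degree w m = j} p"

definition hideal :: "'k::field mpoly set \<Rightarrow> bool" where
  "hideal J \<longleftrightarrow> J \<subseteq> P \<and> 0 \<in> J \<and> (\<forall>p\<in>J. \<forall>q\<in>J. p + q \<in> J) \<and> (\<forall>p\<in>P. \<forall>q\<in>J. p * q \<in> J)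
     \<and> (\<forall>p\<in>J. \<forall>j. hc j p \<in> J)"

definition colon :: "'k::field mpoly set \<Rightarrow> 'k mpoly \<Rightarrow> 'k mpoly set" where
  "colon J a = {p \<in> P. p * a \<in> J}"

definition adj :: "'k::field mpoly set \<Rightarrow> 'k mpoly \<Rightarrow> 'k mpoly set" where
  "adj J q = {a + q * b | a b. a \<in> J \<and> b \<in> P}"

definition nzd :: "'k::field mpoly set \<Rightarrow> 'k mpoly \<Rightarrow> bool" where
  "nzd J q \<longleftrightarrow> (\<forall>p\<in>P. q * p \<in> J \<longrightarrow> p \<in> J)"

text \<open>The Hilbert function of \<open>P / J\<close> as a codimension; for homogeneous ideals
  the truncated subtraction loses nothing, by \<open>hideal_dim\<close>.\<close>

definition hf :: "'k::field mpoly set \<Rightarrow> nat \<Rightarrow> nat" where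
  "hf J j = mp.dim (C j :: 'k mpoly set) - mp.dim (J \<inter> C j)"

text \<open>The coefficient ring is left open: integers serve for reduced fractions, reals for
  comparison and evaluation at points.\<close>

definition hs :: "'k::field mpoly set \<Rightarrow> 'r::comm_ring_1 fps" where
  "hs J = Abs_fps (\<lambda>j. of_nat (hf J j))"

lemma C_P: "p \<in> C j \<Longrightarrow> p \<in> P" by (simp add: poly_comp_def)

lemma C_subspace: "mp.subspace (C j :: 'k::field mpoly set)"
  unfolding mp.subspace_def poly_comp_def
proof (intro conjI ballI allI; clarsimp)
  fix p q :: "'k mpoly"
  assume "p \<in> P" "q \<in> P" "\<forall>m\<in>supp p. weighted_degree w m = j" "\<forall>m\<in>supp q. weighted_degree w m = j"
  then show "p + q \<in> P \<and> (\<forall>m\<in>supp (p + q). weighted_degree w m = j)"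
    using keys_add[of p q] by blast
next
  fix c and p :: "'k mpoly"
  assume "p \<in> P" "\<forall>m\<in>supp p. weighted_degree w m = j"
  then show "smul c p \<in> P \<and> (\<forall>m\<in>supp (smul c p). weighted_degree w m = j)"
    by (auto simp: in_keys_iff)
qed

lemma C_mult: "p \<in> C i \<Longrightarrow> q \<in> C j \<Longrightarrow> (p :: 'k::field mpoly) * q \<in> C (i + j)"
proof -
  assume pq: "p \<in> C i" "q \<in> C j"
  have "weighted_degree w m = i + j" if m: "m \<in> supp (p * q)" for m
  proof -
    obtain a b where "m = a + b" "a \<in> supp p" "b \<in> supp q" using keys_mult[of p q] m by blast
    then show ?thesis using pq by (simp add: poly_comp_def weighted_degree_add)
  qed
  then show ?thesis using pq by (auto simp: poly_comp_def)
qed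

lemma finite_monomials: "finite {m. supp m \<subseteq> {..<n} \<and> weighted_degree w m = j}"
proof -
  let ?F = "{f. \<forall>i. (i \<in> {..<n} \<longrightarrow> f i \<in> {..j}) \<and> (i \<notin> {..<n} \<longrightarrow> f i = (0::nat))}"
  have "finite ?F" by (rule finite_set_of_finite_funs) auto
  then have "finite (cf -` ?F)"
    by (rule finite_vimageI) (simp add: inj_on_def lookup_inject)
  moreover have "{m. supp m \<subseteq> {..<n} \<and> weighted_degree w m = j} \<subseteq> cf -` ?F"
  proof
    fix m assume "m \<in> {m. supp m \<subseteq> {..<n} \<and> weighted_degree w m = j}"
    then have m: "supp m \<subseteq> {..<n}" and j: "(\<Sum>i<n. w i * cf m i) = j"
      using weighted_degree_superset[of "{..<n}" m w] by auto
    have "cf m i \<le> j" if "i < n" for i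
    proof -
      have "w i * cf m i \<le> (\<Sum>i<n. w i * cf m i)" using that by (intro member_le_sum) auto
      moreover have "1 * cf m i \<le> w i * cf m i" using w_pos[OF that] by (intro mult_right_mono) auto
      ultimately show ?thesis using j by linarith
    qed
    moreover have "cf m i = 0" if "\<not> i < n" for i using m that by (auto simp: in_keys_iff)
    ultimately show "m \<in> cf -` ?F" by simp
  qed
  ultimately show ?thesis by (rule finite_subset[rotated])
qed

lemma C_span: "(C j :: 'k::field mpoly set) = mp.span ((\<lambda>m. mterm m 1) ` {m. supp m \<subseteq> {..<n} \<and> weighted_degree w m = j})"
proof (rule mp.span_unique[symmetric])
  show "(\<lambda>m. mterm m 1) ` {m. supp m \<subseteq> {..<n} \<and> weighted_degree w m = j} \<subseteq> C j"
    by (auto simp: poly_comp_def poly_ring_def)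
  show "mp.subspace (C j)" by (rule C_subspace)
  fix T :: "'k mpoly set"
  assume T: "(\<lambda>m. mterm m 1) ` {m. supp m \<subseteq> {..<n} \<and> weighted_degree w m = j} \<subseteq> T" "mp.subspace T"
  show "C j \<subseteq> T"
  proof
    fix p :: "'k mpoly" assume p: "p \<in> C j"
    have "(\<Sum>m\<in>supp p. smul (cf p m) (mterm m 1)) \<in> T"
      using p T by (intro mp.subspace_sum mp.subspace_scale)
        (auto simp: poly_comp_def poly_ring_def image_subset_iff)
    moreover have "(\<Sum>m\<in>supp p. smul (cf p m) (mterm m 1)) = p"
      by (subst (4) mpoly_sum_terms) (simp add: smul_def mult_single)
    ultimately show "p \<in> T" by simp
  qed
qed

lemma C_dim: "mp.has_dim (C j :: 'k::field mpoly set) (mp.dim (C j :: 'k mpoly set))"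
  using mp.has_dim_dim[OF C_subspace finite_imageI[OF finite_monomials[of j]] eq_refl[OF C_span]] .

lemma hc_C: "p \<in> P \<Longrightarrow> hc j p \<in> C j"
  by (auto simp: poly_comp_def hc_def)

lemma hc_id: "p \<in> C j \<Longrightarrow> hc i p = (if i = j then p else 0)"
  unfolding hc_def poly_comp_def by (auto intro!: restr_id restr_eq_0)

lemma hc_add: "hc j (p + q) = hc j p + hc j q"
  by (simp add: hc_def restr_add)

lemma hc_sum: "hc j (sum f I) = (\<Sum>i\<in>I. hc j (f i))"
  by (simp add: hc_def restr_sum)

lemma hc_zero [simp]: "hc j 0 = 0" by (simp add: hc_def)

lemma sum_hc: "p = (\<Sum>j\<in>weighted_degree w ` supp p. hc j p)"
  by (rule poly_mapping_eqI) (auto simp: lookup_sum hc_def in_keys_iff)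

lemma hc_mult:
  assumes "q \<in> C d" "p \<in> P"
  shows "hc j (q * p) = (if d \<le> j then q * hc (j - d) p else 0)"
proof -
  let ?I = "weighted_degree w ` supp p"
  have "hc j (q * p) = (\<Sum>i\<in>?I. hc j (q * hc i p))"
    by (subst (1) sum_hc[of p]) (simp add: sum_distrib_left hc_sum)
  also have "\<dots> = (\<Sum>i\<in>?I. if j = d + i then q * hc i p else 0)"
    by (intro sum.cong refl) (simp add: hc_id[OF C_mult[OF assms(1) hc_C[OF assms(2)]]])
  also have "\<dots> = (if d \<le> j then q * hc (j - d) p else 0)"
  proof (cases "d \<le> j")
    case True
    have "(\<Sum>i\<in>?I. if j = d + i then q * hc i p else 0) = (\<Sum>i\<in>?I. if i = j - d then q * hc i p else 0)"
      using True by (intro sum.cong) auto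
    also have "\<dots> = q * hc (j - d) p"
    proof (cases "j - d \<in> ?I")
      case False
      then have "hc (j - d) p = 0" unfolding hc_def by (intro restr_eq_0) force
      then show ?thesis using False by (simp add: sum.delta')
    qed (simp add: sum.delta')
    finally show ?thesis using True by simp
  qed auto
  finally show ?thesis .
qed

lemma hidealD:
  assumes "hideal J"
  shows "J \<subseteq> P" "0 \<in> J" "\<And>p q. p \<in> J \<Longrightarrow> q \<in> J \<Longrightarrow> p + q \<in> J"
    "\<And>p q. p \<in> P \<Longrightarrow> q \<in> J \<Longrightarrow> p * q \<in> J" "\<And>p q. p \<in> P \<Longrightarrow> q \<in> J \<Longrightarrow> q * p \<in> J"
    "\<And>p j. p \<in> J \<Longrightarrow> hc j p \<in> J"
    "\<And>p c. p \<in> J \<Longrightarrow> smul c p \<in> J" "\<And>p. p \<in> J \<Longrightarrow> - p \<in> J"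
    "\<And>p q. p \<in> J \<Longrightarrow> q \<in> J \<Longrightarrow> p - q \<in> J"
proof -
  show g: "J \<subseteq> P" "0 \<in> J" "\<And>p q. p \<in> J \<Longrightarrow> q \<in> J \<Longrightarrow> p + q \<in> J"
    "\<And>p q. p \<in> P \<Longrightarrow> q \<in> J \<Longrightarrow> p * q \<in> J" "\<And>p q. p \<in> P \<Longrightarrow> q \<in> J \<Longrightarrow> q * p \<in> J"
    "\<And>p j. p \<in> J \<Longrightarrow> hc j p \<in> J"
    using assms by (auto simp: hideal_def mult.commute)
  show "smul c p \<in> J" if "p \<in> J" for p c using g(4) that by (simp add: smul_def)
  show n: "- p \<in> J" if "p \<in> J" for p using g(4)[of "- 1" p] that by (simp add: poly_ring_uminus)
  show "p - q \<in> J" if "p \<in> J" "q \<in> J" for p q using g(3)[OF that(1) n[OF that(2)]] by simp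
qed

lemma hideal_subspace: "hideal J \<Longrightarrow> mp.subspace J"
  by (simp add: mp.subspace_def hidealD)

lemma hideal_sum: "hideal J \<Longrightarrow> (\<And>i. i \<in> I \<Longrightarrow> f i \<in> J) \<Longrightarrow> sum f I \<in> J"
  using mp.subspace_sum[OF hideal_subspace] by metis

lemma hideal_hcI: "hideal J \<Longrightarrow> (\<And>j. hc j p \<in> J) \<Longrightarrow> p \<in> J"
  by (subst sum_hc) (simp add: hideal_sum)

lemma hideal_eqI:
  fixes J J' :: "'k::field mpoly set"
  assumes "hideal J" "hideal J'" "\<And>j p. p \<in> C j \<Longrightarrow> p \<in> J \<longleftrightarrow> p \<in> J'"
  shows "J = J'"
proof -
  have "I \<subseteq> I'" if "hideal I" "hideal I'" "\<And>j p. p \<in> C j \<Longrightarrow> p \<in> I \<Longrightarrow> p \<in> I'"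
    for I I' :: "'k mpoly set"
  proof
    fix p assume p: "p \<in> I"
    show "p \<in> I'"
    proof (rule hideal_hcI[OF that(2)])
      fix j
      have "p \<in> P" using hidealD(1)[OF that(1)] p by blast
      then show "hc j p \<in> I'" using that(3)[OF hc_C] hidealD(6)[OF that(1) p] by blast
    qed
  qed
  then show ?thesis using assms by blast
qed

lemma hideal_zero: "hideal {0}"
  by (simp add: hideal_def)

lemma hideal_adj:
  fixes J :: "'k::field mpoly set"
  assumes J: "hideal J" and q: "q \<in> C d"
  shows "hideal (adj J q)" "J \<subseteq> adj J q" "q \<in> adj J q"
proof -
  note D = hidealD[OF J]
  show "J \<subseteq> adj J q"
  proof
    fix a assume "a \<in> J"
    then show "a \<in> adj J q" unfolding adj_def by (intro CollectI exI[of _ a] exI[of _ 0]) auto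
  qed
  show "q \<in> adj J q" unfolding adj_def using D(2) by (intro CollectI exI[of _ 0] exI[of _ 1]) auto
  show "hideal (adj J q)" unfolding hideal_def
  proof (intro conjI ballI allI)
    show "adj J q \<subseteq> P" using D(1) C_P[OF q] unfolding adj_def by blast
    show "0 \<in> adj J q" using \<open>J \<subseteq> adj J q\<close> D(2) by blast
    fix x assume "x \<in> adj J q"
    then obtain a b where x: "x = a + q * b" "a \<in> J" "b \<in> P" unfolding adj_def by blast
    { fix y assume "y \<in> adj J q"
      then obtain c e where "y = c + q * e" "c \<in> J" "e \<in> P" unfolding adj_def by blast
      then have "x + y = (a + c) + q * (b + e)" "a + c \<in> J" "b + e \<in> P"
        using x D(3) by (auto simp: algebra_simps)
      then show "x + y \<in> adj J q" unfolding adj_def by blast }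
    { fix p :: "'k mpoly" assume "p \<in> P"
      then have "p * a \<in> J" "p * b \<in> P" using x D(4) by auto
      moreover have "p * x = p * a + q * (p * b)" using x by (simp add: algebra_simps)
      ultimately show "p * x \<in> adj J q" unfolding adj_def by blast }
    fix j
    have "hc j x = hc j a + q * (if d \<le> j then hc (j - d) b else 0)"
      using x hc_mult[OF q] by (simp add: hc_add)
    moreover have "hc j a \<in> J" "(if d \<le> j then hc (j - d) b else 0) \<in> P"
      using D(6) x C_P[OF hc_C] by auto
    ultimately show "hc j x \<in> adj J q" unfolding adj_def by blast
  qed
qed

lemma adj_subset: "hideal I \<Longrightarrow> J \<subseteq> I \<Longrightarrow> q \<in> I \<Longrightarrow> adj J q \<subseteq> I"
  unfolding adj_def using hidealD(3,5) by blast

lemma adj_comm: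
  fixes J :: "'k::field mpoly set"
  shows "adj (adj J p) q = adj (adj J q) p"
proof -
  have "adj (adj J p) q \<subseteq> adj (adj J q) p" for p q :: "'k mpoly"
  proof
    fix x assume "x \<in> adj (adj J p) q"
    then obtain a b c where "x = (a + p * b) + q * c" "a \<in> J" "b \<in> P" "c \<in> P"
      unfolding adj_def by blast
    then have "x = (a + q * c) + p * b" "a \<in> J" "b \<in> P" "c \<in> P" by (simp_all add: add_ac)
    then show "x \<in> adj (adj J q) p" unfolding adj_def by blast
  qed
  then show ?thesis by blast
qed

lemma hideal_colon:
  assumes J: "hideal J" and a: "a \<in> C d"
  shows "hideal (colon J a)" "J \<subseteq> colon J a"
proof -
  note D = hidealD[OF J]
  show "J \<subseteq> colon J a" unfolding colon_def using D(1,5) C_P[OF a] by blast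
  show "hideal (colon J a)" unfolding hideal_def
  proof (intro conjI ballI allI)
    show "colon J a \<subseteq> P" "0 \<in> colon J a" using D(2) by (auto simp: colon_def)
    fix p assume p: "p \<in> colon J a"
    show "p + q \<in> colon J a" if "q \<in> colon J a" for q
      using p that D(3) by (auto simp: colon_def distrib_right)
    show "q * p \<in> colon J a" if "q \<in> P" for q
      using p that D(4) by (auto simp: colon_def mult.assoc)
    fix j
    have "hc (j + d) (a * p) = a * hc j p" using hc_mult[OF a] p by (simp add: colon_def)
    moreover have "hc (j + d) (a * p) \<in> J" using D(6) p by (auto simp: colon_def mult.commute)
    ultimately show "hc j p \<in> colon J a"
      using p C_P[OF hc_C] by (auto simp: colon_def mult.commute)
  qed
qed

lemma colon_nzd:
  assumes "hideal J" "nzd J q" "q \<in> P"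
  shows "colon J q = J"
proof
  show "colon J q \<subseteq> J" using assms(2) by (auto simp: colon_def nzd_def mult.commute)
  show "J \<subseteq> colon J q" using hidealD(1,5)[OF assms(1)] assms(3) by (auto simp: colon_def)
qed

lemma nzd_homogI:
  assumes J: "hideal J" and q: "q \<in> C d" and h: "\<And>j p. p \<in> C j \<Longrightarrow> q * p \<in> J \<Longrightarrow> p \<in> J"
  shows "nzd J q"
  unfolding nzd_def
proof (intro ballI impI)
  fix p assume p: "p \<in> P" "q * p \<in> J"
  have "hc j p \<in> J" for j
  proof (rule h[OF hc_C[OF p(1)]])
    show "q * hc j p \<in> J" using hc_mult[OF q p(1), of "j + d"] hidealD(6)[OF J p(2), of "j + d"] by simp
  qed
  then show "p \<in> J" using hideal_hcI[OF J] by blast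
qed

lemma hideal_dim: "hideal J \<Longrightarrow> mp.has_dim (J \<inter> C j) (mp.dim (J \<inter> C j))"
  "hideal J \<Longrightarrow> mp.dim ((J :: 'k::field mpoly set) \<inter> C j) \<le> mp.dim (C j :: 'k mpoly set)"
  using mp.has_dim_subset[OF C_dim mp.subspace_inter[OF hideal_subspace C_subspace], of J j j]
  by (simp_all only: Int_lower2 simp_thms)

lemma hf_mono: "hideal J \<Longrightarrow> hideal J' \<Longrightarrow> J \<subseteq> J' \<Longrightarrow> hf J' j \<le> hf J j"
  unfolding hf_def
  using mp.has_dim_subset(2)[OF hideal_dim(1)[of J' j] mp.has_dim_subspace[OF hideal_dim(1)[of J j]]]
  by (intro diff_le_mono2) auto

lemma hf_eq_imp_eq:
  assumes "hideal J" "hideal J'" "J \<subseteq> J'" "\<And>j. hf J' j = hf J j"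
  shows "J = J'"
proof (rule hideal_eqI[OF assms(1,2)])
  fix j and p :: "'a mpoly" assume p: "p \<in> C j"
  have "mp.dim (J \<inter> C j) = mp.dim (J' \<inter> C j)"
    using assms(4)[of j] hideal_dim(2)[OF assms(1), of j] hideal_dim(2)[OF assms(2), of j]
    unfolding hf_def by linarith
  then have "J \<inter> C j = J' \<inter> C j"
    using mp.has_dim_subset(3)[OF hideal_dim(1)[OF assms(2)] mp.has_dim_subspace[OF hideal_dim(1)[OF assms(1)]]]
      assms(3) by blast
  then show "p \<in> J \<longleftrightarrow> p \<in> J'" using p by blast
qed

lemma linear_mult: "Vector_Spaces.linear smul smul ((*) (f :: 'k::field mpoly))"
  by unfold_locales (simp_all add: distrib_left smul_mult_right)

text \<open>Dimension count in 0 -> P/(J : f) shifted by \<open>d\<close> -> P/J -> P/(J + fP) -> 0.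
  In degree \<open>j\<close> it is \<open>dim_pullback\<close> for multiplication by
  \<open>f\<close> from degree \<open>j - d\<close>, relative to the part of \<open>J\<close> in
  degree \<open>j\<close>.\<close>

lemma hf_adj:
  assumes J: "hideal J" and f: "f \<in> C d"
  shows "hf (adj J f) j + (if d \<le> j then hf (colon J f) (j - d) else 0) = hf J j"
proof (cases "d \<le> j")
  case True
  define i where "i = j - d"
  have j: "j = i + d" using True i_def by simp
  interpret vp: vspace_pair smul smul ..
  note A = hideal_adj[OF J f] and B = hideal_colon[OF J f]
  obtain d1 d2 where dd: "mp.has_dim {v \<in> C i. f * v \<in> J \<inter> C j} d1"
      "mp.has_dim {f * v + u |v u. v \<in> C i \<and> u \<in> J \<inter> C j} d2"
      "mp.dim (C i :: 'a mpoly set) + mp.dim (J \<inter> C j) = d1 + d2"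
    using vp.dim_pullback[OF linear_mult C_dim hideal_dim(1)[OF J]] by blast
  have "{v \<in> C i. f * v \<in> J \<inter> C j} = colon J f \<inter> C i"
    using C_mult[OF f, of _ i] C_P by (auto simp: colon_def j mult.commute add.commute)
  then have d1: "d1 = mp.dim (colon J f \<inter> C i)" using mp.has_dim_imp_dim[OF dd(1)] by simp
  have "{f * v + u |v u. v \<in> C i \<and> u \<in> J \<inter> C j} = adj J f \<inter> C j"
  proof (intro subset_antisym subsetI)
    fix x assume "x \<in> {f * v + u |v u. v \<in> C i \<and> u \<in> J \<inter> C j}"
    then obtain v u where x: "x = f * v + u" "v \<in> C i" "u \<in> J" "u \<in> C j" by blast
    have "f * v \<in> C j" using C_mult[OF f x(2)] by (simp add: j add.commute)
    then have "x \<in> C j" using x(1,4) mp.subspace_add[OF C_subspace] by blast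
    then show "x \<in> adj J f \<inter> C j" unfolding adj_def using x C_P[OF x(2)] by (auto simp: add.commute)
  next
    fix x assume "x \<in> adj J f \<inter> C j"
    then obtain a b where x: "x = a + f * b" "a \<in> J" "b \<in> P" "x \<in> C j" unfolding adj_def by blast
    have "x = hc j x" using x(4) by (simp add: hc_id)
    also have "\<dots> = f * hc i b + hc j a" using x hc_mult[OF f x(3)] True by (simp add: hc_add i_def)
    finally show "x \<in> {f * v + u |v u. v \<in> C i \<and> u \<in> J \<inter> C j}"
      using hc_C[OF x(3)] hc_C hidealD(1,6)[OF J] x(2) by blast
  qed
  then have "d2 = mp.dim (adj J f \<inter> C j)" using mp.has_dim_imp_dim[OF dd(2)] by simp
  then show ?thesis
    using dd(3) d1 hideal_dim(2)[OF A(1), of j] hideal_dim(2)[OF B(1), of i] hideal_dim(2)[OF J, of j] True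
    unfolding hf_def i_def[symmetric] by (simp add: diff_diff_eq)
next
  case False
  have "adj J f \<inter> C j = J \<inter> C j"
  proof (intro subset_antisym subsetI)
    fix x assume "x \<in> adj J f \<inter> C j"
    then obtain a b where x: "x = a + f * b" "a \<in> J" "b \<in> P" "x \<in> C j" unfolding adj_def by blast
    have "x = hc j x" using x(4) by (simp add: hc_id)
    also have "\<dots> = hc j a" using x hc_mult[OF f x(3)] False by (simp add: hc_add)
    finally show "x \<in> J \<inter> C j" using x(4) hidealD(6)[OF J x(2), of j] by simp
  qed (use hideal_adj(2)[OF J f] in auto)
  then show ?thesis using False by (simp add: hf_def)
qed

lemma hs_adj:
  assumes J: "hideal J" and f: "f \<in> C d"
  shows "(hs (adj J f) :: 'r::comm_ring_1 fps) = hs J - fps_X ^ d * hs (colon J f)"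
proof (rule fps_ext)
  fix j
  have "(of_nat (hf J j) :: 'r) =
      of_nat (hf (adj J f) j) + (if d \<le> j then of_nat (hf (colon J f) (j - d)) else 0)"
    unfolding hf_adj[OF J f, of j, symmetric] by simp
  then show "(hs (adj J f) :: 'r fps) $ j = (hs J - fps_X ^ d * hs (colon J f)) $ j"
    by (auto simp: hs_def fps_X_power_mult_nth)
qed

lemma hs_adj_nzd:
  assumes "hideal J" "f \<in> C d" "nzd J f"
  shows "hs (adj J f) = (1 - fps_X ^ d) * hs J"
  using hs_adj[OF assms(1,2)] colon_nzd[OF assms(1,3) C_P[OF assms(2)]] by (simp add: algebra_simps)

text \<open>The ideal generated by the variables x_t with t < i, described by its monomials; in this
  form the next variable is visibly a nonzerodivisor modulo it.\<close>

definition var_ideal :: "nat \<Rightarrow> 'k::field mpoly set" where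
  "var_ideal i = {p \<in> P. \<forall>m\<in>supp p. \<exists>t<i. cf m t \<noteq> 0}"

lemma var_C: "i < n \<Longrightarrow> var i \<in> C (w i)"
  by (auto simp: poly_comp_def var_def poly_ring_def)

lemma hideal_var_ideal: "hideal (var_ideal i :: 'k::field mpoly set)"
  unfolding hideal_def
proof (intro conjI ballI allI)
  show "var_ideal i \<subseteq> P" "0 \<in> var_ideal i" by (auto simp: var_ideal_def)
  fix p :: "'k mpoly" assume p: "p \<in> var_ideal i"
  show "p + q \<in> var_ideal i" if "q \<in> var_ideal i" for q
    using p that keys_add[of p q] unfolding var_ideal_def by blast
  show "q * p \<in> var_ideal i" if q: "q \<in> P" for q
  proof -
    have "\<exists>t<i. cf m t \<noteq> 0" if m: "m \<in> supp (q * p)" for m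
    proof -
      obtain a b where "m = a + b" "b \<in> supp p" using keys_mult[of q p] m by blast
      then show ?thesis using p by (force simp: var_ideal_def lookup_add)
    qed
    then show ?thesis using p q by (auto simp: var_ideal_def)
  qed
  show "hc j p \<in> var_ideal i" for j using p by (auto simp: var_ideal_def hc_def)
qed

lemma supp_var_mult: "supp (var i * p) = (+) (mterm i 1) ` supp p"
  unfolding var_def by (rule supp_mterm_mult) simp

lemma nzd_var: "nzd (var_ideal i) (var i)"
  unfolding nzd_def var_ideal_def
  by (auto simp: supp_var_mult lookup_add lookup_single when_def image_iff split: if_splits)

lemma adj_var:
  assumes "i < n"
  shows "adj (var_ideal i) (var i) = (var_ideal (Suc i) :: 'k::field mpoly set)"
proof
  have "var i \<in> (var_ideal (Suc i) :: 'k mpoly set)"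
    using poly_ring_var[OF assms] by (auto simp: var_ideal_def var_def lookup_single)
  moreover have "var_ideal i \<subseteq> (var_ideal (Suc i) :: 'k mpoly set)"
    unfolding var_ideal_def using less_Suc_eq by auto
  ultimately show "adj (var_ideal i) (var i) \<subseteq> (var_ideal (Suc i) :: 'k mpoly set)"
    by (intro adj_subset hideal_var_ideal)
  show "var_ideal (Suc i) \<subseteq> (adj (var_ideal i) (var i) :: 'k mpoly set)"
  proof
    fix p :: "'k mpoly" assume p: "p \<in> var_ideal (Suc i)"
    have "mterm m (cf p m) \<in> adj (var_ideal i) (var i)" if m: "m \<in> supp p" for m
    proof (cases "\<exists>t<i. cf m t \<noteq> 0")
      case True
      then have "mterm m (cf p m) \<in> var_ideal i" using p m by (auto simp: var_ideal_def poly_ring_def)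
      then show ?thesis using hideal_adj(2)[OF hideal_var_ideal var_C[OF assms]] by blast
    next
      case False
      then have mi: "cf m i \<noteq> 0" using p m by (auto simp: var_ideal_def less_Suc_eq)
      define m' where "m' = m - mterm i 1"
      have m': "m = mterm i 1 + m'"
        unfolding m'_def using mi by (intro poly_mapping_eqI) (auto simp: lookup_add lookup_minus lookup_single when_def)
      have "supp m' \<subseteq> supp m" unfolding m'_def by (auto simp: in_keys_iff lookup_minus)
      then have "mterm m' (cf p m) \<in> P" using p m by (auto simp: var_ideal_def poly_ring_def)
      moreover have "mterm m (cf p m) = 0 + var i * mterm m' (cf p m)"
        unfolding var_def mult_single m'[symmetric] by simp
      ultimately show ?thesis
        unfolding adj_def using hidealD(2)[OF hideal_var_ideal] by blast
    qed
    then show "p \<in> adj (var_ideal i) (var i)"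
      by (subst mpoly_sum_terms) (rule hideal_sum[OF hideal_adj(1)[OF hideal_var_ideal var_C[OF assms]]])
  qed
qed

lemma var_ideal_0: "var_ideal 0 = {0}"
  by (auto simp: var_ideal_def) 

lemma hf_0:
  assumes "hideal J" "1 \<notin> J"
  shows "hf J 0 = 1"
proof -
  have C0: "C 0 = mp.span {1 :: 'a mpoly}"
  proof -
    have "{m. supp m \<subseteq> {..<n} \<and> weighted_degree w m = 0} = {0}"
    proof safe
      fix m assume m: "supp m \<subseteq> {..<n}" "weighted_degree w m = 0"
      have "cf m i = 0" for i
      proof (cases "i < n")
        case True
        have "(\<Sum>i<n. w i * cf m i) = 0" using m weighted_degree_superset[of "{..<n}" m w] by simp
        then have "w i * cf m i = 0" using True by (subst (asm) sum_eq_0_iff) auto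
        then show ?thesis using w_pos[OF True] by simp
      qed (use m(1) in \<open>auto simp: in_keys_iff\<close>)
      then show "m = 0" by (intro poly_mapping_eqI) simp
    qed auto
    then show ?thesis unfolding C_span by simp
  qed
  have "mp.dim (C 0 :: 'a mpoly set) = 1"
    unfolding C0 by (subst mp.dim_span_eq_card_independent) (simp_all add: mp.dependent_single)
  moreover have "J \<inter> C 0 = {0}"
  proof -
    have "p = 0" if p: "p \<in> J" "p \<in> C 0" for p
    proof -
      obtain c where c: "p = smul c 1" using p(2) unfolding C0 mp.span_singleton by auto
      show ?thesis
      proof (rule ccontr)
        assume "p \<noteq> 0"
        then have "c \<noteq> 0" using c by auto
        then have "1 = smul (inverse c) p" using c by simp
        then show False using assms hidealD(7)[OF assms(1) p(1)] by metis
      qed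
    qed
    then show ?thesis using hidealD(2)[OF assms(1)] mp.subspace_0[OF C_subspace] by blast
  qed
  moreover have "mp.dim {0 :: 'a mpoly} = 0" using mp.has_dim_imp_dim[OF mp.has_dim_zero] .
  ultimately show ?thesis by (simp add: hf_def)
qed

lemma C_var_ideal:
  assumes "0 < j" shows "C j \<subseteq> (var_ideal n :: 'k::field mpoly set)"
proof
  fix p :: "'k mpoly" assume p: "p \<in> C j"
  have "\<exists>t<n. cf m t \<noteq> 0" if m: "m \<in> supp p" for m
  proof (rule ccontr)
    assume "\<not> (\<exists>t<n. cf m t \<noteq> 0)"
    moreover have "supp m \<subseteq> {..<n}" using p m by (auto simp: poly_comp_def poly_ring_def)
    ultimately have "weighted_degree w m = 0"
      by (subst weighted_degree_superset[of "{..<n}"]) auto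
    then show False using p m assms by (simp add: poly_comp_def)
  qed
  then show "p \<in> var_ideal n" using C_P[OF p] by (simp add: var_ideal_def)
qed

text \<open>The variables form a regular sequence whose quotient is the field: each factor comes
  from the passage from \<open>var_ideal i\<close> to \<open>var_ideal (Suc i)\<close>, and the last
  ideal contains all positive degrees.\<close>

lemma hs_zero_ideal:
  "hs ({0} :: 'k::field mpoly set) * (\<Prod>i<n. 1 - fps_X ^ w i) = (1 :: 'r::comm_ring_1 fps)"
proof -
  have "(hs (var_ideal i :: 'k mpoly set) :: 'r fps) = (\<Prod>t<i. 1 - fps_X ^ w t) * hs ({0} :: 'k mpoly set)"
    if "i \<le> n" for i
    using that
  proof (induction i)
    case 0
    show ?case by (simp add: var_ideal_0)
  next
    case (Suc i)
    have "(hs (adj (var_ideal i) (var i) :: 'k mpoly set) :: 'r fps) = (1 - fps_X ^ w i) * hs (var_ideal i :: 'k mpoly set)"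
      using Suc.prems by (intro hs_adj_nzd hideal_var_ideal var_C nzd_var) simp
    then show ?case
      using Suc adj_var[of i, where ?'k = 'k] by (simp add: mult_ac)
  qed
  moreover have "hs (var_ideal n :: 'k mpoly set) = (1 :: 'r fps)"
  proof (rule fps_ext)
    fix j
    show "hs (var_ideal n :: 'k mpoly set) $ j = (1 :: 'r fps) $ j"
    proof (cases "j = 0")
      case True
      have "1 \<notin> (var_ideal n :: 'k mpoly set)" by (simp add: var_ideal_def)
      then show ?thesis using True hf_0[OF hideal_var_ideal[where ?'k = 'k]] by (simp add: hs_def)
    next
      case False
      then have "var_ideal n \<inter> C j = (C j :: 'k mpoly set)" using C_var_ideal[of j] by blast
      then show ?thesis using False by (simp add: hs_def hf_def)
    qed
  qed
  ultimately show ?thesis by (simp add: mult.commute)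
qed

end

section \<open>The ascending chain condition and rationality of Hilbert series\<close>

text \<open>A monotone subsequence exists in any case; a decreasing one of natural numbers becomes
  constant, and its tail is nondecreasing.\<close>

lemma nondecreasing_subsequence:
  fixes s :: "nat \<Rightarrow> nat"
  shows "\<exists>g :: nat \<Rightarrow> nat. strict_mono g \<and> (\<forall>i j. i \<le> j \<longrightarrow> s (g i) \<le> s (g j))"
proof -
  obtain g where g: "strict_mono g" "monoseq (\<lambda>i. s (g i))" using seq_monosub by blast
  show ?thesis
  proof (cases "incseq (\<lambda>i. s (g i))")
    case True
    then show ?thesis using g incseqD by blast
  next
    case False
    then have dec: "decseq (\<lambda>i. s (g i))" using g(2) monoseq_iff by blast
    obtain N where N: "\<And>i. s (g N) \<le> s (g i)"
      using ex_has_least_nat[of "\<lambda>_. True" 0 "\<lambda>i. s (g i)"] by auto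
    have "s (g (N + i)) = s (g N)" for i using N[of "N + i"] decseqD[OF dec, of N "N + i"] by simp
    then show ?thesis using g(1)
      by (intro exI[of _ "\<lambda>i. g (N + i)"]) (auto simp: strict_mono_def)
  qed
qed

text \<open>The coordinates are treated one at a time, passing to a further subsequence along which
  the next exponent is nondecreasing; after \<open>n\<close> rounds any two terms are
  comparable.\<close>

lemma dickson:
  fixes f :: "nat \<Rightarrow> (nat \<Rightarrow>\<^sub>0 nat)"
  assumes "\<And>i. supp (f i) \<subseteq> {..<n}"
  shows "\<exists>i j. i < j \<and> (\<forall>t. cf (f i) t \<le> cf (f j) t)"
proof -
  have "\<exists>g :: nat \<Rightarrow> nat. strict_mono g \<and> (\<forall>t<k. \<forall>i j. i \<le> j \<longrightarrow> cf (f (g i)) t \<le> cf (f (g j)) t)" for k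
  proof (induction k)
    case 0
    show ?case by (intro exI[of _ "\<lambda>i. i"]) (simp add: strict_mono_def)
  next
    case (Suc k)
    then obtain g :: "nat \<Rightarrow> nat" where g: "strict_mono g"
        "\<And>t i j. t < k \<Longrightarrow> i \<le> j \<Longrightarrow> cf (f (g i)) t \<le> cf (f (g j)) t" by blast
    obtain h :: "nat \<Rightarrow> nat" where h: "strict_mono h"
        "\<And>i j. i \<le> j \<Longrightarrow> cf (f (g (h i))) k \<le> cf (f (g (h j))) k"
      using nondecreasing_subsequence[of "\<lambda>i. cf (f (g i)) k"] by blast
    have "cf (f (g (h i))) t \<le> cf (f (g (h j))) t" if "t < k" "i \<le> j" for t i j
      using g(2)[OF that(1)] strict_mono_less_eq[OF h(1)] that(2) by simp
    moreover have "strict_mono (\<lambda>i. g (h i))" using g(1) h(1) by (simp add: strict_mono_def)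
    ultimately show ?case using h(2) less_Suc_eq by (intro exI[of _ "\<lambda>i. g (h i)"]) auto
  qed
  from this[of n] obtain g :: "nat \<Rightarrow> nat" where g: "strict_mono g"
      "\<And>t i j. t < n \<Longrightarrow> i \<le> j \<Longrightarrow> cf (f (g i)) t \<le> cf (f (g j)) t" by blast
  have "cf (f (g 0)) t \<le> cf (f (g 1)) t" for t
  proof (cases "t < n")
    case True
    then show ?thesis using g(2)[of t 0 1] by simp
  next
    case False
    then have "t \<notin> supp (f (g 0))" using assms by auto
    then show ?thesis by (simp add: in_keys_iff)
  qed
  moreover have "g 0 < g 1" using g(1) by (simp add: strict_mono_def)
  ultimately show ?thesis by blast
qed

definition lead :: "'k::field mpoly \<Rightarrow> (nat \<Rightarrow>\<^sub>0 nat)" where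
  "lead p = Max (supp p)"

lemma lead_in: "p \<noteq> 0 \<Longrightarrow> lead p \<in> supp p"
  unfolding lead_def by (intro Max_in) auto

lemma lead_ge: "m \<in> supp p \<Longrightarrow> m \<le> lead p"
  unfolding lead_def by (intro Max_ge) auto

lemma lead_mterm_mult: "p \<noteq> 0 \<Longrightarrow> lead (mterm a 1 * p) = a + lead p"
  unfolding lead_def supp_mterm_mult[OF one_neq_zero]
  by (intro mono_Max_commute[symmetric]) (auto simp: mono_def add_left_mono)

context wpoly
begin

text \<open>Among the elements of \<open>J' - J\<close> in one fixed degree, where only finitely
  many monomials occur, take \<open>p\<close> with the least leading monomial. An element of
  \<open>J\<close> with the same leading monomial could be used to lower it further. So a strict
  inclusion of ideals always shows in the leading monomials.\<close>

lemma exists_new_lead: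
  assumes J: "hideal J" and J': "hideal J'" and sub: "J \<subset> J'"
  shows "\<exists>p\<in>J'. p \<noteq> 0 \<and> (\<forall>g\<in>J. g \<noteq> 0 \<longrightarrow> lead g \<noteq> lead p)"
proof -
  obtain j p0 where p0: "p0 \<in> J'" "p0 \<in> C j" "p0 \<notin> J"
    using sub hideal_eqI[OF J J'] by blast
  define S where "S = (J' \<inter> C j) - J"
  have S0: "p \<noteq> 0" if "p \<in> S" for p using that hidealD(2)[OF J] by (auto simp: S_def)
  have "lead ` S \<subseteq> {m. supp m \<subseteq> {..<n} \<and> weighted_degree w m = j}"
    using lead_in[OF S0] by (auto simp: S_def poly_comp_def poly_ring_def)
  then have fin: "finite (lead ` S)" using finite_monomials finite_subset by blast
  have "lead ` S \<noteq> {}" using p0 by (auto simp: S_def)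
  then have "Min (lead ` S) \<in> lead ` S" using fin by (rule Min_in[rotated])
  then obtain p where p: "p \<in> S" "lead p = Min (lead ` S)" by auto
  have min: "lead p \<le> lead q" if "q \<in> S" for q using p(2) fin that by simp
  have "lead g \<noteq> lead p" if g: "g \<in> J" "g \<noteq> 0" for g
  proof
    assume e: "lead g = lead p"
    let ?m = "lead p"
    have pC: "p \<in> C j" and pJ: "p \<in> J'" "p \<notin> J" using p by (auto simp: S_def)
    have m: "?m \<in> supp p" "weighted_degree w ?m = j" "?m \<in> supp g"
      using lead_in[OF S0[OF p(1)]] pC lead_in[OF g(2)] e by (auto simp: poly_comp_def)
    \<comment> \<open>\<open>g\<close> may be inhomogeneous; its component of degree
      \<open>j\<close> still contains the leading monomial, and subtracting only this component
      keeps \<open>q\<close> in degree \<open>j\<close>.\<close>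
    define q where "q = p - smul (cf p ?m / cf g ?m) (hc j g)"
    have hg: "hc j g \<in> J" "hc j g \<in> C j" using hidealD(1,6)[OF J] g hc_C by blast+
    then have hg': "hc j g \<in> J'" using sub by blast
    have "q \<in> C j" unfolding q_def
      using mp.subspace_diff[OF C_subspace pC mp.subspace_scale[OF C_subspace hg(2)]] .
    moreover have "q \<in> J'" unfolding q_def using hidealD(7,9)[OF J'] hg' pJ by blast
    moreover have "q \<notin> J"
    proof
      assume "q \<in> J"
      then have "q + smul (cf p ?m / cf g ?m) (hc j g) \<in> J" using hidealD(3,7)[OF J] hg by blast
      then show False using pJ by (simp add: q_def)
    qed
    ultimately have "q \<in> S" by (simp add: S_def)
    moreover have "lead q < ?m"
    proof -
      have l: "lead q \<in> supp q" using lead_in S0 \<open>q \<in> S\<close> by blast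
      have "supp q \<subseteq> supp p \<union> supp g"
        unfolding q_def by (auto simp: in_keys_iff lookup_minus hc_def split: if_splits)
      then have "lead q \<le> ?m" using l lead_ge[of _ p] lead_ge[of _ g] e by auto
      moreover have "cf q ?m = 0" using m by (simp add: q_def lookup_minus hc_def in_keys_iff)
      ultimately show ?thesis using l by (metis in_keys_iff order_le_less)
    qed
    ultimately show False using min leD by blast
  qed
  then show ?thesis using p(1) S0[OF p(1)] unfolding S_def by blast
qed

text \<open>Larger ideals come below smaller ones, so that well-foundedness is the ascending chain
  condition and induction runs from large ideals to small ones.\<close>

definition larger_ideal :: "('k::field mpoly set \<times> 'k mpoly set) set" where
  "larger_ideal = {(J', J). hideal J \<and> hideal J' \<and> J \<subset> J'}"

text \<open>Each step of an ascending chain contributes a new leading monomial. By Dickson's lemma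
  one of them divides a later one; the corresponding multiple of the earlier polynomial already lies
  in \<open>f j\<close> and has the leading monomial that was supposed to be new there.\<close>

lemma wf_larger_ideal: "wf (larger_ideal :: ('k::field mpoly set \<times> 'k mpoly set) set)"
  unfolding wf_iff_no_infinite_down_chain
proof
  assume "\<exists>f :: nat \<Rightarrow> 'k mpoly set. \<forall>i. (f (Suc i), f i) \<in> larger_ideal"
  then obtain f :: "nat \<Rightarrow> 'k mpoly set" where f0: "\<And>i. (f (Suc i), f i) \<in> larger_ideal" by blast
  have f: "hideal (f i)" "f i \<subset> f (Suc i)" for i using f0[of i] by (simp_all add: larger_ideal_def)
  have mono: "i \<le> j \<Longrightarrow> f i \<subseteq> f j" for i j
    by (rule lift_Suc_mono_le[of f]) (use f(2) in \<open>auto simp only: psubset_imp_subset\<close>)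
  have "\<exists>p. p \<in> f (Suc i) \<and> p \<noteq> 0 \<and> (\<forall>g\<in>f i. g \<noteq> 0 \<longrightarrow> lead g \<noteq> lead p)" for i
    using exists_new_lead[OF f(1)[of i] f(1)[of "Suc i"] f(2)[of i]] by blast
  from choice[OF allI[OF this]] obtain p where
    "\<forall>i. p i \<in> f (Suc i) \<and> p i \<noteq> 0 \<and> (\<forall>g\<in>f i. g \<noteq> 0 \<longrightarrow> lead g \<noteq> lead (p i))" ..
  then have p: "\<And>i. p i \<in> f (Suc i)" "\<And>i. p i \<noteq> 0"
      "\<And>i g. g \<in> f i \<Longrightarrow> g \<noteq> 0 \<Longrightarrow> lead g \<noteq> lead (p i)" by auto
  have lP: "supp (lead (p i)) \<subseteq> {..<n}" for i
    using lead_in[OF p(2)] hidealD(1)[OF f(1)] p(1) unfolding poly_ring_def by blast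
  obtain i j where ij: "i < j" "\<And>t. cf (lead (p i)) t \<le> cf (lead (p j)) t"
    using dickson[OF lP] by blast
  define a where "a = lead (p j) - lead (p i)"
  have a: "a + lead (p i) = lead (p j)"
    unfolding a_def using ij(2) by (intro poly_mapping_eqI) (simp add: lookup_add lookup_minus)
  have "supp a \<subseteq> supp (lead (p j))" unfolding a_def by (auto simp: in_keys_iff lookup_minus)
  then have "supp a \<subseteq> {..<n}" using lP[of j] by blast
  then have "mterm a 1 * p i \<in> f (Suc i)" using hidealD(4)[OF f(1)] poly_ring_mterm p(1) by blast
  then have "mterm a 1 * p i \<in> f j" using mono[of "Suc i" j] ij(1) by auto
  moreover have "lead (mterm a 1 * p i) = lead (p j)" using lead_mterm_mult[OF p(2)] a by simp
  moreover have "mterm a 1 * p i \<noteq> 0"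
    using supp_mterm_mult[OF one_neq_zero, of a "p i"] p(2)[of i] by (metis image_is_empty keys_eq_empty keys_zero)
  ultimately show False using p(3) by blast
qed

lemma maximal_hideal:
  assumes "Q \<in> S" "\<And>J. J \<in> S \<Longrightarrow> hideal J"
  shows "\<exists>M\<in>S. Q \<subseteq> M \<and> (\<forall>J\<in>S. M \<subseteq> J \<longrightarrow> J = M)"
proof -
  have "Q \<in> {J \<in> S. Q \<subseteq> J}" using assms by simp
  from wfE_min[OF wf_larger_ideal this] obtain M where M: "M \<in> {J \<in> S. Q \<subseteq> J}"
      "\<And>J. (J, M) \<in> larger_ideal \<Longrightarrow> J \<notin> {J \<in> S. Q \<subseteq> J}" by blast
  have "J = M" if "J \<in> S" "M \<subseteq> J" for J
  proof (rule ccontr)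
    assume "J \<noteq> M"
    then have "(J, M) \<in> larger_ideal" using that M(1) assms(2) by (auto simp: larger_ideal_def)
    then show False using M that by blast
  qed
  then show ?thesis using M(1) by blast
qed

lemma one_minus_X_poly: "\<exists>p :: 'r::comm_ring_1 poly. (1 - fps_X ^ d :: 'r fps) = fps_of_poly p"
  by (rule exI[of _ "1 - monom 1 d"]) (simp add: fps_of_poly_diff fps_of_poly_monom')

lemma prod_one_minus_X_poly:
  "\<exists>p :: 'r::comm_ring_1 poly. (\<Prod>i\<in>I. 1 - fps_X ^ v i :: 'r fps) = fps_of_poly p"
proof (induction I rule: infinite_finite_induct)
  case (insert i I)
  then show ?case using one_minus_X_poly[of "v i", where ?'r = 'r]
    by (auto simp: fps_of_poly_mult[symmetric])
qed (auto intro: exI[of _ 1] simp: fps_of_poly_1)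

text \<open>Noetherian induction along multiplication with the variables; those in \<open>J\<close> contribute no factor.\<close>

lemma hilbert_serre_strong:
  fixes J :: "'k::field mpoly set"
  assumes "hideal J"
  shows "\<exists>K :: 'r::comm_ring_1 poly.
    hs J * (\<Prod>i\<in>{i. i < n \<and> var i \<notin> J}. 1 - fps_X ^ w i) = fps_of_poly K"
  using assms
proof (induction J rule: wf_induct_rule[OF wf_larger_ideal])
  case (1 J)
  define V where "V I = {i. i < n \<and> var i \<notin> I}" for I :: "'k mpoly set"
  define D where "D I = (\<Prod>i\<in>I. 1 - fps_X ^ w i :: 'r fps)" for I
  have finV: "finite (V I)" for I by (simp add: V_def)
  have IH: "\<exists>K. hs I * D (V J) = fps_of_poly K" if "hideal I" "J \<subset> I" for I
  proof -
    have "\<exists>K. hs I * D (V I) = fps_of_poly K"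
      using "1.IH"[of I] "1.prems" that by (auto simp: larger_ideal_def V_def D_def)
    moreover have "D (V J) = D (V I) * D (V J - V I)"
      unfolding D_def using that finV by (subst prod.subset_diff[of "V I" "V J"]) (auto simp: V_def mult.commute)
    moreover obtain K' where "D (V J - V I) = fps_of_poly K'"
      using prod_one_minus_X_poly[of w "V J - V I", where ?'r = 'r] by (auto simp: D_def)
    ultimately show ?thesis by (auto simp: fps_of_poly_mult[symmetric] mult.assoc[symmetric])
  qed
  show ?case
  proof (cases "V J = {}")
    case True
    \<comment> \<open>All variables lie in \<open>J\<close>, so the quotient lives in degree 0 and
      its series is a constant.\<close>
    have "var_ideal i \<subseteq> J" if "i \<le> n" for i
      using that
    proof (induction i)
      case 0
      show ?case by (simp add: var_ideal_0 hidealD(2)[OF "1.prems"])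
    next
      case (Suc i)
      then have "adj (var_ideal i) (var i) \<subseteq> J" using True by (intro adj_subset[OF "1.prems"]) (auto simp: V_def)
      then show ?case using adj_var[of i, where ?'k = 'k] Suc.prems by simp
    qed
    then have CJ: "J \<inter> C j = C j" if "0 < j" for j using C_var_ideal[OF that] by blast
    have "hs J = (fps_of_poly [:of_nat (hf J 0):] :: 'r fps)"
    proof (rule fps_ext)
      fix j
      show "hs J $ j = (fps_of_poly [:of_nat (hf J 0):] :: 'r fps) $ j"
        using CJ[of j] by (cases "j = 0") (auto simp: hs_def hf_def coeff_pCons split: nat.splits)
    qed
    then show ?thesis using True by (auto simp: V_def[symmetric])
  next
    case False
    then obtain i where i: "i < n" "var i \<notin> J" by (auto simp: V_def)
    note A = hideal_adj[OF "1.prems" var_C[OF i(1)]]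
    note B = hideal_colon[OF "1.prems" var_C[OF i(1)]]
    have JA: "J \<subset> adj J (var i)" using A i by blast
    show ?thesis
    proof (cases "nzd J (var i)")
      case True
      \<comment> \<open>\<open>var i\<close> belongs to the enlarged ideal, so the induction
        hypothesis comes without its factor; that factor is exactly what relates the two series when
        \<open>var i\<close> is a nonzerodivisor.\<close>
      have "\<exists>K. hs (adj J (var i)) * D (V (adj J (var i))) = fps_of_poly K"
        using "1.IH"[of "adj J (var i)"] "1.prems" A JA by (auto simp: larger_ideal_def V_def D_def)
      then obtain K where K: "hs (adj J (var i)) * D (V (adj J (var i))) = fps_of_poly K" by blast
      let ?R = "V J - {i} - V (adj J (var i))"
      have sub: "V (adj J (var i)) \<subseteq> V J - {i}" using A by (auto simp: V_def)
      have "D (V J) = (1 - fps_X ^ w i) * D (V J - {i})"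
        unfolding D_def using i finV by (subst prod.remove[of _ i]) (auto simp: V_def)
      also have "D (V J - {i}) = D (V (adj J (var i))) * D ?R"
        unfolding D_def using sub finV by (subst prod.subset_diff[OF sub]) (auto simp: mult.commute)
      finally have "hs J * D (V J) = hs (adj J (var i)) * D (V (adj J (var i))) * D ?R"
        unfolding hs_adj_nzd[OF "1.prems" var_C[OF i(1)] True] by (simp add: mult_ac)
      moreover obtain K' where "D ?R = fps_of_poly K'"
        using prod_one_minus_X_poly[of w ?R, where ?'r = 'r] by (auto simp: D_def)
      ultimately have "hs J * D (V J) = fps_of_poly (K * K')" using K by (simp add: fps_of_poly_mult)
      then show ?thesis unfolding D_def V_def by blast
    next
      case False
      \<comment> \<open>A zero divisor makes the colon ideal strictly larger too, so the induction
        hypothesis applies to both outer terms of the exact sequence.\<close>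
      then obtain p where "p \<in> P" "var i * p \<in> J" "p \<notin> J" by (auto simp: nzd_def)
      then have "J \<subset> colon J (var i)" using B by (auto simp: colon_def mult.commute)
      then obtain K1 K2 where K: "hs (adj J (var i)) * D (V J) = fps_of_poly K1"
          "hs (colon J (var i)) * D (V J) = fps_of_poly K2"
        using IH[OF A(1) JA] IH[OF B(1)] by blast
      have "hs J * D (V J) = hs (adj J (var i)) * D (V J) + fps_X ^ w i * (hs (colon J (var i)) * D (V J))"
        unfolding hs_adj[OF "1.prems" var_C[OF i(1)]] by (simp add: algebra_simps)
      also have "\<dots> = fps_of_poly (K1 + monom 1 (w i) * K2)"
        unfolding K by (simp add: fps_of_poly_add fps_of_poly_mult fps_of_poly_monom')
      finally show ?thesis unfolding D_def V_def by blast
    qed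
  qed
qed

lemma hilbert_serre:
  assumes "hideal J"
  shows "\<exists>K :: 'r::comm_ring_1 poly. hs J * (\<Prod>i<n. 1 - fps_X ^ w i) = fps_of_poly K"
proof -
  let ?V = "{i. i < n \<and> var i \<notin> J}"
  obtain K :: "'r poly" where "hs J * (\<Prod>i\<in>?V. 1 - fps_X ^ w i) = fps_of_poly K"
    using hilbert_serre_strong[OF assms] by blast
  moreover obtain K' :: "'r poly" where "(\<Prod>i\<in>{..<n}-?V. 1 - fps_X ^ w i) = fps_of_poly K'"
    using prod_one_minus_X_poly by blast
  moreover have "(\<Prod>i<n. 1 - fps_X ^ w i :: 'r fps) =
      (\<Prod>i\<in>?V. 1 - fps_X ^ w i) * (\<Prod>i\<in>{..<n}-?V. 1 - fps_X ^ w i)"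
    by (subst prod.subset_diff[of ?V "{..<n}"]) (auto simp: mult.commute)
  ultimately have "hs J * (\<Prod>i<n. 1 - fps_X ^ w i) = fps_of_poly (K * K')"
    by (simp add: fps_of_poly_mult mult.assoc[symmetric])
  then show ?thesis by blast
qed

section \<open>Ideals given by generators, and regular sequences\<close>

lemma gen_ideal_Nil: "gen_ideal n [] = {0}"
  by (auto simp: gen_ideal_def)

lemma gen_ideal_snoc: "gen_ideal n (fs @ [f]) = adj (gen_ideal n fs) f"
proof (intro subset_antisym subsetI)
  fix x assume "x \<in> gen_ideal n (fs @ [f])"
  then obtain q where q: "x = (\<Sum>i<length (fs @ [f]). q i * (fs @ [f]) ! i)"
      "\<forall>i<length (fs @ [f]). q i \<in> P" by (auto simp: gen_ideal_def)
  then have "x = (\<Sum>i<length fs. q i * fs ! i) + f * q (length fs)"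
    by (simp add: nth_append mult.commute)
  then show "x \<in> adj (gen_ideal n fs) f" using q(2) unfolding adj_def gen_ideal_def by force
next
  fix x assume "x \<in> adj (gen_ideal n fs) f"
  then obtain q b where q: "x = (\<Sum>i<length fs. q i * fs ! i) + f * b"
      "\<forall>i<length fs. q i \<in> P" "b \<in> P" by (auto simp: gen_ideal_def adj_def)
  then have "x = (\<Sum>i<length (fs @ [f]). (q(length fs := b)) i * (fs @ [f]) ! i)"
    by (simp add: nth_append mult.commute)
  moreover have "\<forall>i<length (fs @ [f]). (q(length fs := b)) i \<in> P" using q by (simp add: less_Suc_eq)
  ultimately show "x \<in> gen_ideal n (fs @ [f])" unfolding gen_ideal_def by blast
qed

lemma hideal_gen_ideal:
  "(\<And>f. f \<in> set fs \<Longrightarrow> \<exists>d. f \<in> C d) \<Longrightarrow> hideal (gen_ideal n fs)"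
proof (induction fs rule: rev_induct)
  case Nil
  show ?case by (simp add: gen_ideal_Nil hideal_zero)
next
  case (snoc f fs)
  then show ?case using hideal_adj(1) by (auto simp: gen_ideal_snoc)
qed

lemma gen_ideal_subset:
  "hideal I \<Longrightarrow> set fs \<subseteq> I \<Longrightarrow> gen_ideal n fs \<subseteq> I"
proof (induction fs rule: rev_induct)
  case Nil
  then show ?case by (simp add: gen_ideal_Nil hidealD)
next
  case (snoc f fs)
  then show ?case using adj_subset[of I "gen_ideal n fs" f] by (simp add: gen_ideal_snoc)
qed

lemma gen_ideal_superset:
  assumes "set fs \<subseteq> P" shows "set fs \<subseteq> gen_ideal n fs"
proof
  fix f assume "f \<in> set fs"
  then obtain i where i: "i < length fs" "fs ! i = f" by (auto simp: in_set_conv_nth)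
  have "f = (\<Sum>t<length fs. (if t = i then 1 else 0) * fs ! t)"
  proof -
    have "(\<Sum>t<length fs. (if t = i then 1 else 0) * fs ! t) = (\<Sum>t<length fs. if t = i then fs ! t else 0)"
      by (intro sum.cong) auto
    then show ?thesis using i by (simp add: sum.delta')
  qed
  then show "f \<in> gen_ideal n fs" unfolding gen_ideal_def
    by (intro CollectI exI[of _ "\<lambda>t. if t = i then 1 else 0"]) auto
qed

lemma gen_ideal_take_Suc:
  "i < length fs \<Longrightarrow> gen_ideal n (take (Suc i) fs) = adj (gen_ideal n (take i fs)) (fs ! i)"
  by (simp add: take_Suc_conv_app_nth gen_ideal_snoc)

lemma regular_sequence_iff:
  assumes "set fs \<subseteq> P"
  shows "regular_sequence n fs \<longleftrightarrow>
    (\<forall>i<length fs. nzd (gen_ideal n (take i fs)) (fs ! i)) \<and> 1 \<notin> gen_ideal n fs"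
  using assms unfolding regular_sequence_def nzd_def by blast

lemma hs_regular_sequence:
  fixes fs :: "'k::field mpoly list"
  assumes reg: "regular_sequence n fs" and deg: "\<And>i. i < length fs \<Longrightarrow> fs ! i \<in> C (d i)"
  shows "(hs (gen_ideal n fs) :: 'r::comm_ring_1 fps) = (\<Prod>i<length fs. 1 - fps_X ^ d i) * hs ({0} :: 'k mpoly set)"
proof -
  have hom: "hideal (gen_ideal n (take i fs))" for i
    by (intro hideal_gen_ideal) (use deg in \<open>fastforce simp: in_set_conv_nth\<close>)
  have "set fs \<subseteq> P" using C_P[OF deg] by (auto simp: in_set_conv_nth)
  then have nzd: "nzd (gen_ideal n (take i fs)) (fs ! i)" if "i < length fs" for i
    using reg regular_sequence_iff that by blast
  have "(hs (gen_ideal n (take i fs)) :: 'r fps) = (\<Prod>t<i. 1 - fps_X ^ d t) * hs ({0} :: 'k mpoly set)"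
    if "i \<le> length fs" for i
    using that
  proof (induction i)
    case 0
    show ?case by (simp add: gen_ideal_Nil)
  next
    case (Suc i)
    have "(hs (adj (gen_ideal n (take i fs)) (fs ! i)) :: 'r fps) = (1 - fps_X ^ d i) * hs (gen_ideal n (take i fs))"
      using Suc.prems by (intro hs_adj_nzd hom deg nzd) auto
    then show ?case using Suc gen_ideal_take_Suc[of i fs] by (simp add: mult_ac)
  qed
  from this[of "length fs"] show ?thesis by simp
qed

text \<open>
  The maximal annihilators of homogeneous elements are prime and, by the ascending chain
  condition, finite in number; so a line in general position avoids them.
\<close>

lemma nzd_generic:
  fixes J :: "'k::field mpoly set"
  assumes J: "hideal J" and W: "\<And>i. i < s \<Longrightarrow> W i \<in> C d"
    and soc: "\<And>j a. a \<in> C j \<Longrightarrow> (\<And>i. i < s \<Longrightarrow> W i * a \<in> J) \<Longrightarrow> a \<in> J"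
  shows "finite {u. \<not> nzd J (\<Sum>i<s. smul (u ^ i) (W i))}"
proof -
  define Y where "Y u = (\<Sum>i<s. smul (u ^ i) (W i))" for u
  have YC: "Y u \<in> C d" for u
    unfolding Y_def using W by (intro mp.subspace_sum[OF C_subspace] mp.subspace_scale[OF C_subspace]) auto
  define S where "S = {colon J a | a j. a \<in> C j \<and> a \<notin> J}"
  define M where "M = {m \<in> S. \<forall>q\<in>S. m \<subseteq> q \<longrightarrow> q = m}"
  have S_h: "hideal Q" if "Q \<in> S" for Q using that hideal_colon(1)[OF J] by (auto simp: S_def)
  have cover: "\<exists>m\<in>M. Y u \<in> m" if "\<not> nzd J (Y u)" for u
  proof -
    have "\<exists>j p. p \<in> C j \<and> Y u * p \<in> J \<and> p \<notin> J"
      using nzd_homogI[OF J YC[of u]] that by blast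
    then obtain j p where p: "p \<in> C j" "Y u * p \<in> J" "p \<notin> J" by blast
    then have "colon J p \<in> S" "Y u \<in> colon J p" using C_P[OF YC] by (auto simp: S_def colon_def)
    then show ?thesis using maximal_hideal[OF _ S_h] unfolding M_def by blast
  qed
  \<comment> \<open>By \<open>subspace_curve_coeffs\<close>, infinitely many points of the curve in
    \<open>m\<close> would put every \<open>W i\<close> into \<open>m\<close>. Then all
    \<open>W i\<close> would kill the element \<open>a\<close> defining \<open>m\<close>, against
    \<open>soc\<close>.\<close>
  have fin_each: "finite {u. Y u \<in> m}" if m: "m \<in> M" for m
  proof (rule ccontr)
    assume inf: "infinite {u. Y u \<in> m}"
    obtain a j where a: "m = colon J a" "a \<in> C j" "a \<notin> J" using m by (auto simp: M_def S_def)
    have sub: "mp.subspace m" using hideal_subspace S_h m by (auto simp: M_def)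
    have "W i \<in> m" if "i < s" for i
      using mp.subspace_curve_coeffs[OF sub inf _ that, of W] by (simp add: Y_def)
    then have "W i * a \<in> J" if "i < s" for i using that a by (simp add: colon_def)
    then show False using soc a by blast
  qed
  \<comment> \<open>Of infinitely many maximal annihilators \<open>m i\<close> of elements
    \<open>a i\<close>, the chain condition makes some \<open>a k\<close> a combination of earlier
    \<open>a i\<close> modulo \<open>J\<close>. The product of elements \<open>h i\<close> of
    \<open>m i\<close> outside \<open>m k\<close>, for \<open>i < k\<close>, then kills
    \<open>a k\<close>, although primality keeps it outside \<open>m k\<close>.\<close>
  have "finite M"
  proof (rule ccontr)
    assume "infinite M"
    then obtain m :: "nat \<Rightarrow> 'k mpoly set" where m: "inj m" "range m \<subseteq> M"
      using infinite_countable_subset by blast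
    have "\<exists>a. \<exists>e. m i = colon J a \<and> a \<in> C e \<and> a \<notin> J" for i
    proof -
      have "m i \<in> S" using m(2) by (auto simp: M_def)
      then show ?thesis by (auto simp: S_def)
    qed
    then obtain a e where a: "\<And>i. m i = colon J (a i)" "\<And>i. a i \<in> C (e i)" "\<And>i. a i \<notin> J" by metis
    define L where "L = rec_nat J (\<lambda>i I. adj I (a i))"
    have L0: "L 0 = J" and LS: "L (Suc i) = adj (L i) (a i)" for i by (simp_all add: L_def)
    have Lh: "hideal (L i)" for i
      by (induction i) (auto simp: L0 LS J intro: hideal_adj(1)[OF _ a(2)])
    have "\<exists>k. a k \<in> L k"
    proof (rule ccontr)
      assume "\<nexists>k. a k \<in> L k"
      then have "(L (Suc i), L i) \<in> larger_ideal" for i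
        using hideal_adj[OF Lh a(2), of i i] Lh by (auto simp: larger_ideal_def LS)
      then show False using wf_larger_ideal unfolding wf_iff_no_infinite_down_chain by blast
    qed
    then obtain k where k: "a k \<in> L k" by blast
    have Lrep: "\<exists>b. (\<forall>i. b i \<in> P) \<and> x - (\<Sum>i<t. a i * b i) \<in> J" if "x \<in> L t" for x t
      using that
    proof (induction t arbitrary: x)
      case 0
      then show ?case by (intro exI[of _ "\<lambda>_. 0"]) (simp add: L0)
    next
      case (Suc t)
      then obtain y c where x: "x = y + a t * c" "y \<in> L t" "c \<in> P" by (auto simp: LS adj_def)
      obtain b where b: "\<forall>i. b i \<in> P" "y - (\<Sum>i<t. a i * b i) \<in> J" using Suc.IH[OF x(2)] by blast
      show ?case
        using b x by (intro exI[of _ "b(t := c)"]) simp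
    qed
    obtain b where b: "\<And>i. b i \<in> P" "a k - (\<Sum>i<k. a i * b i) \<in> J" using Lrep[OF k] by blast
    have mM: "m i \<in> M" for i using m(2) by blast
    have mh: "hideal (m i)" for i using mM S_h by (auto simp: M_def)
    \<comment> \<open>The annihilator of \<open>y * a k\<close> contains \<open>m k\<close> and
      again belongs to an element outside \<open>J\<close>, hence equals \<open>m k\<close> by
      maximality.\<close>
    have prime: "x * y \<notin> m k" if "x \<in> C d1" "y \<in> C d2" "x \<notin> m k" "y \<notin> m k" for x y d1 d2
    proof
      assume xy: "x * y \<in> m k"
      have ya: "y * a k \<in> C (d2 + e k)" using C_mult[OF that(2) a(2)] .
      have "y * a k \<notin> J" using that(2,4) a(1) C_P by (auto simp: colon_def)
      then have "colon J (y * a k) \<in> S" using ya by (auto simp: S_def)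
      moreover have "m k \<subseteq> colon J (y * a k)"
      proof
        fix x assume x: "x \<in> m k"
        then have "y * (x * a k) \<in> J" using a(1) hidealD(4)[OF J C_P[OF that(2)]] by (simp add: colon_def)
        then show "x \<in> colon J (y * a k)" using x a(1) by (simp add: colon_def mult.left_commute[of x y])
      qed
      ultimately have "colon J (y * a k) = m k" using mM[of k] by (auto simp: M_def)
      then show False using xy that C_P a(1) by (auto simp: colon_def mult_ac)
    qed
    have "\<exists>h d'. h \<in> C d' \<and> h \<in> m i \<and> h \<notin> m k" if "i < k" for i
    proof -
      have "\<not> m i \<subseteq> m k"
      proof
        assume "m i \<subseteq> m k"
        then have "m k = m i" using mM[of i] mM[of k] by (auto simp: M_def)
        then show False using m(1) that by (auto dest: injD)
      qed
      then obtain x where x: "x \<in> m i" "x \<notin> m k" by blast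
      then obtain j where "hc j x \<notin> m k" using hideal_hcI[OF mh] by blast
      moreover have "hc j x \<in> m i" "hc j x \<in> C j"
        using hidealD(1,6)[OF mh[of i]] x hc_C by blast+
      ultimately show ?thesis by blast
    qed
    then obtain h where h: "\<And>i. i < k \<Longrightarrow> (\<exists>d'. h i \<in> C d') \<and> h i \<in> m i \<and> h i \<notin> m k" by metis
    have H: "(\<exists>d'. (\<Prod>i<t. h i) \<in> C d') \<and> (\<Prod>i<t. h i) \<notin> m k" if "t \<le> k" for t
      using that
    proof (induction t)
      case 0
      have "(1 :: 'k mpoly) \<in> C 0" by (simp add: poly_comp_def)
      moreover have "1 \<notin> m k" using a by (simp add: colon_def)
      ultimately show ?case by auto
    next
      case (Suc t)
      then obtain d1 d2 where "(\<Prod>i<t. h i) \<in> C d1" "h t \<in> C d2" using h[of t] by auto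
      moreover from this have "(\<Prod>i<t. h i) * h t \<in> C (d1 + d2)" by (rule C_mult)
      ultimately show ?case using prime[of "\<Prod>i<t. h i" d1 "h t" d2] Suc h[of t] by auto
    qed
    let ?H = "\<Prod>i<k. h i"
    have HP: "?H \<in> P" using H[of k] C_P by auto
    have "?H * (a i * b i) \<in> J" if "i < k" for i
    proof -
      have "?H = h i * (\<Prod>t\<in>{..<k} - {i}. h t)" using that by (subst prod.remove[of _ i]) auto
      then have e1: "?H * (a i * b i) = ((\<Prod>t\<in>{..<k} - {i}. h t) * b i) * (h i * a i)"
        by (simp add: mult_ac)
      have hP: "h t \<in> P" if "t < k" for t using h[OF that] C_P by blast
      have "(\<Prod>t\<in>T. h t) \<in> P" if "T \<subseteq> {..<k}" for T
        using finite_subset[OF that finite_lessThan] that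
      proof (induction T rule: finite_induct)
        case (insert t T)
        then have "h t \<in> P" "prod h T \<in> P" using hP by auto
        then show ?case using insert.hyps by (simp add: poly_ring_mult)
      qed simp
      from poly_ring_mult[OF this[of "{..<k} - {i}"] b(1)[of i]]
      have "(\<Prod>t\<in>{..<k} - {i}. h t) * b i \<in> P" by auto
      moreover have "h i * a i \<in> J" using h[OF that] a(1) by (auto simp: colon_def)
      ultimately show ?thesis unfolding e1 using hidealD(4)[OF J] by blast
    qed
    then have "?H * (\<Sum>i<k. a i * b i) \<in> J" unfolding sum_distrib_left by (intro hideal_sum[OF J]) auto
    moreover have "?H * (a k - (\<Sum>i<k. a i * b i)) \<in> J" using hidealD(4)[OF J HP b(2)] .
    ultimately have "?H * (a k - (\<Sum>i<k. a i * b i)) + ?H * (\<Sum>i<k. a i * b i) \<in> J"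
      using hidealD(3)[OF J] by blast
    then have "?H * a k \<in> J" by (simp add: algebra_simps)
    then have "?H \<in> m k" using a(1) HP by (simp add: colon_def)
    then show False using H[of k] by simp
  qed
  then have "finite (\<Union>m\<in>M. {u. Y u \<in> m})" using fin_each by blast
  moreover have "{u. \<not> nzd J (Y u)} \<subseteq> (\<Union>m\<in>M. {u. Y u \<in> m})" using cover by blast
  ultimately show ?thesis unfolding Y_def by (rule finite_subset[rotated])
qed

end

section \<open>Depth over an infinite field\<close>

text \<open>The series of 1 / (1 - x)^e, hence the Hilbert series of a standard graded polynomial
  ring in \<open>e\<close> variables; it is real because it is going to be evaluated.\<close>

definition geo :: "nat \<Rightarrow> real fps" where
  "geo e = Abs_fps (\<lambda>_. 1) ^ e"

lemma geo_base: "(1 - fps_X) * Abs_fps (\<lambda>_. 1 :: real) = 1"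
  by (rule fps_ext) (simp add: algebra_simps fps_X_mult_nth)

lemma geo_mult: "(1 - fps_X) ^ e * geo e = 1"
  unfolding geo_def power_mult_distrib[symmetric] geo_base by simp

lemma geo_Suc: "geo (Suc e) = Abs_fps (\<lambda>_. 1) * geo e"
  by (simp add: geo_def)

lemma fps_mult_mono:
  fixes f g h :: "real fps"
  shows "(\<And>m. f $ m \<le> g $ m) \<Longrightarrow> (\<And>m. 0 \<le> h $ m) \<Longrightarrow> (h * f) $ m \<le> (h * g) $ m"
  by (simp add: fps_mult_nth sum_mono mult_left_mono)

lemma eq_mult_geo: "f * (1 - fps_X) ^ d = g \<Longrightarrow> f = g * geo d"
  using geo_mult[of d] by (metis mult.assoc mult.right_neutral)

lemma conv_radius_geo: "1 \<le> fps_conv_radius (geo e)"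
proof -
  have "1 \<le> fps_conv_radius (Abs_fps (\<lambda>_. 1 :: real))"
    unfolding fps_conv_radius_def
  proof (rule conv_radius_geI_ex)
    fix r :: real assume "0 < r" "ereal r < 1"
    then show "\<exists>z. norm z = r \<and> summable (\<lambda>m. Abs_fps (\<lambda>_. 1 :: real) $ m * z ^ m)"
      by (intro exI[of _ r]) (simp add: summable_geometric)
  qed
  then show ?thesis
    unfolding geo_def using fps_conv_radius_power[of "Abs_fps (\<lambda>_. 1 :: real)" e] by (rule order_trans)
qed

lemma conv_radius_poly_geo: "1 \<le> fps_conv_radius (fps_of_poly p * geo e)"
  using fps_conv_radius_mult[of "fps_of_poly p" "geo e"] conv_radius_geo[of e]
  by (simp add: min_def split: if_splits)

lemma eval_geo:
  assumes "0 < x" "x < 1" shows "eval_fps (geo e) x = 1 / (1 - x) ^ e"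
proof -
  have x: "ereal (norm x) < fps_conv_radius (geo e)"
    using conv_radius_geo[of e] assms by (simp add: less_le_trans[of _ 1])
  have "eval_fps ((1 - fps_X) ^ e * geo e) x = eval_fps ((1 - fps_X) ^ e) x * eval_fps (geo e) x"
  proof (rule eval_fps_mult[OF _ x])
    have "(1 - fps_X) ^ e = fps_of_poly ((1 - monom 1 1) ^ e :: real poly)"
      by (simp add: fps_of_poly_power fps_of_poly_diff fps_of_poly_monom')
    then show "ereal (norm x) < fps_conv_radius ((1 - fps_X) ^ e :: real fps)"
      by (simp only: fps_conv_radius_fps_of_poly) simp
  qed
  moreover have "eval_fps ((1 - fps_X) ^ e) x = (1 - x) ^ e"
  proof -
    have "(1 - fps_X) ^ e = fps_of_poly ((1 - monom 1 1) ^ e :: real poly)"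
      by (simp add: fps_of_poly_power fps_of_poly_diff fps_of_poly_monom')
    then show ?thesis by (simp only: eval_fps_of_poly) (simp add: poly_monom)
  qed
  ultimately have "(1 - x) ^ e * eval_fps (geo e) x = 1" by (simp only: geo_mult eval_fps_1)
  then show ?thesis using assms by (simp add: field_simps)
qed

lemma eval_poly_geo:
  assumes "0 < x" "x < 1" shows "eval_fps (fps_of_poly p * geo e) x = poly p x / (1 - x) ^ e"
proof -
  have "ereal (norm x) < fps_conv_radius (geo e)"
    using conv_radius_geo[of e] assms by (simp add: less_le_trans[of _ 1])
  then show ?thesis using eval_fps_mult[of x "fps_of_poly p" "geo e"] eval_geo[OF assms] by simp
qed

lemma eval_fps_le:
  fixes f g :: "real fps"
  assumes "\<And>m. f $ m \<le> g $ m" "1 \<le> fps_conv_radius f" "1 \<le> fps_conv_radius g" "0 < x" "x < 1"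
  shows "eval_fps f x \<le> eval_fps g x"
  unfolding eval_fps_def
proof (rule suminf_le)
  have x: "ereal (norm x) < 1" using assms by simp
  show "summable (\<lambda>m. f $ m * x ^ m)" "summable (\<lambda>m. g $ m * x ^ m)"
    using less_le_trans[OF x] assms by (auto intro!: summable_fps)
  show "f $ m * x ^ m \<le> g $ m * x ^ m" for m using assms by (simp add: mult_right_mono)
qed

text \<open>Takes the place of the monotonicity of Krull dimension. A coefficientwise inequality
  survives evaluation in (0, 1). If \<open>d < e\<close>, then after multiplication by
  \<open>(1 - x) ^ e\<close> the right-hand side tends to 0 at 1, while the left-hand side tends to
  \<open>poly p 1 > 0\<close>.\<close>

lemma pole_order_mono:
  fixes p q :: "real poly"
  assumes le: "\<And>m. (fps_of_poly p * geo e) $ m \<le> (fps_of_poly q * geo d) $ m"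
    and p: "poly p 1 > 0"
  shows "e \<le> d"
proof (rule ccontr)
  assume "\<not> e \<le> d"
  then have ed: "e = d + (e - d)" "0 < e - d" by simp_all
  have "poly p x \<le> poly q x * (1 - x) ^ (e - d)" if x: "0 < x" "x < 1" for x
  proof -
    have "poly p x / (1 - x) ^ e \<le> poly q x / (1 - x) ^ d"
      using eval_fps_le[OF le conv_radius_poly_geo conv_radius_poly_geo x] eval_poly_geo[OF x] by simp
    moreover have "(1 - x) ^ e = (1 - x) ^ d * (1 - x) ^ (e - d)" using ed(1) by (metis power_add)
    ultimately show ?thesis using x by (simp add: field_simps)
  qed
  then have ev: "eventually (\<lambda>x. poly p x \<le> poly q x * (1 - x) ^ (e - d)) (at_left 1)"
    unfolding eventually_at_left_field by (intro exI[of _ 0]) auto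
  have "((\<lambda>x. poly p x) \<longlongrightarrow> poly p 1) (at_left 1)"
    "((\<lambda>x. poly q x * (1 - x) ^ (e - d)) \<longlongrightarrow> poly q 1 * (1 - 1) ^ (e - d)) (at_left 1)"
    by (intro tendsto_intros | simp)+
  from tendsto_le[OF _ this(2,1) ev] have "poly p 1 \<le> 0" using ed(2) by (simp add: zero_power)
  then show False using p by simp
qed

section \<open>The standard grading and sequences of linear nonzerodivisors\<close>

definition unit_weight :: "nat \<Rightarrow> nat" where
  "unit_weight i = 1"

locale spoly = fixes n :: nat
begin

sublocale wpoly n unit_weight by unfold_locales (simp add: unit_weight_def)

lemma hs_zero_std: "(hs ({0} :: 'k::field mpoly set) :: real fps) = geo n"
proof -
  have "(hs ({0} :: 'k mpoly set) :: real fps) * (1 - fps_X) ^ n = 1"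
    using hs_zero_ideal[where ?'k = 'k and ?'r = real] by (simp add: unit_weight_def)
  then show ?thesis using eq_mult_geo by (metis mult_1)
qed

lemma C1_linear_combination:
  assumes "y \<in> C 1"
  shows "\<exists>c. y = (\<Sum>i<n. smul (c i) (var i))"
proof -
  have "{m. supp m \<subseteq> {..<n} \<and> weighted_degree unit_weight m = 1} \<subseteq> (\<lambda>i. mterm i 1) ` {..<n}"
  proof
    fix m assume "m \<in> {m. supp m \<subseteq> {..<n} \<and> weighted_degree unit_weight m = 1}"
    then have m: "supp m \<subseteq> {..<n}" "(\<Sum>i\<in>supp m. cf m i) = 1" by (auto simp: weighted_degree_def unit_weight_def)
    then obtain i where i: "cf m i = 1" "i \<in> supp m" "\<forall>t\<in>supp m. i \<noteq> t \<longrightarrow> cf m t = 0"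
      using sum_eq_1_iff[of "supp m" "cf m"] by auto
    then have "m = mterm i 1"
      by (intro poly_mapping_eqI) (auto simp: lookup_single when_def in_keys_iff)
    then show "m \<in> (\<lambda>i. mterm i 1) ` {..<n}" using i(2) m(1) by blast
  qed
  then have "(\<lambda>m. mterm m 1) ` {m. supp m \<subseteq> {..<n} \<and> weighted_degree unit_weight m = 1}
      \<subseteq> (var ` {..<n} :: 'a mpoly set)"
    unfolding var_def by blast
  then have "y \<in> mp.span (var ` {..<n})"
    using assms mp.span_mono unfolding C_span by blast
  then show ?thesis
  proof (induction rule: mp.span_induct_alt)
    case base
    show ?case by (intro exI[of _ "\<lambda>_. 0"]) simp
  next
    case (step c x y)
    then obtain i b where i: "i < n" "x = var i" and b: "y = (\<Sum>i<n. smul (b i) (var i))" by blast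
    have "(\<Sum>t<n. smul ((if t = i then c else 0) + b t) (var t))
        = (\<Sum>t<n. (if t = i then smul c (var i) else 0) + smul (b t) (var t) :: 'a mpoly)"
      by (intro sum.cong refl) (simp add: mp.scale_left_distrib)
    also have "\<dots> = smul c x + y" using i b by (simp add: sum.distrib)
    finally show ?case by metis
  qed
qed

text \<open>Depth at least \<open>e\<close>, witnessed by successive linear nonzerodivisors. That
  the choice of these forms does not matter over an infinite field is the content of
  \<open>dep_adj\<close>.\<close>

primrec dep :: "nat \<Rightarrow> 'k::field mpoly set \<Rightarrow> bool" where
  "dep 0 J = True"
| "dep (Suc e) J = (\<exists>y\<in>C 1. nzd J y \<and> dep e (adj J y))"

text \<open>Positive depth, in a form that involves no choice of a linear form.\<close>

definition socle_free :: "'k::field mpoly set \<Rightarrow> bool" where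
  "socle_free J \<longleftrightarrow> (\<forall>a\<in>P. (\<forall>i<n. var i * a \<in> J) \<longrightarrow> a \<in> J)"

text \<open>Points on a moment curve: a single parameter suffices for general position, and several
  finite exceptional sets can be avoided at once.\<close>

definition general_form :: "'k::field \<Rightarrow> 'k mpoly" where
  "general_form u = (\<Sum>i<n. smul (u ^ i) (var i))"

lemma var_C1: "i < n \<Longrightarrow> var i \<in> C 1"
  using var_C by (simp add: unit_weight_def)

lemma var_expansion:
  assumes g: "(g :: 'k::field mpoly) \<in> C j" and j: "0 < j"
  shows "\<exists>h. (\<forall>i. h i \<in> C (j - 1)) \<and> g = (\<Sum>i<n. var i * h i)"
proof -
  have "\<exists>f. (\<forall>i. f i \<in> P) \<and> x = (\<Sum>i<m. var i * f i)" if "x \<in> var_ideal m" "m \<le> n"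
    for x :: "'k mpoly" and m
    using that
  proof (induction m arbitrary: x)
    case 0
    then show ?case by (intro exI[of _ "\<lambda>_. 0"]) (simp add: var_ideal_0)
  next
    case (Suc m)
    then have "x \<in> adj (var_ideal m) (var m)" using adj_var[of m, where ?'k = 'k] by simp
    then obtain y h where y: "x = y + var m * h" "y \<in> var_ideal m" "h \<in> P" by (auto simp: adj_def)
    obtain f where "\<forall>i. f i \<in> P" "y = (\<Sum>i<m. var i * f i)" using Suc.IH[OF y(2)] Suc.prems by auto
    then show ?case using y by (intro exI[of _ "f(m := h)"]) simp
  qed
  moreover have "g \<in> var_ideal n" using C_var_ideal[OF j] g by blast
  ultimately obtain f where f: "\<And>i. f i \<in> P" "g = (\<Sum>i<n. var i * f i)" by blast
  define h where "h i = hc (j - 1) (f i)" for i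
  have "g = hc j g" using g hc_id[of g j j] by simp
  also have "\<dots> = (\<Sum>i<n. hc j (var i * f i))" unfolding f(2) hc_sum ..
  also have "\<dots> = (\<Sum>i<n. var i * h i)"
    using hc_mult[OF var_C1 f(1), of _ j] j by (intro sum.cong) (auto simp: h_def)
  finally have "g = (\<Sum>i<n. var i * h i)" .
  moreover have "\<forall>i. h i \<in> C (j - 1)" unfolding h_def using hc_C[OF f(1)] by blast
  ultimately show ?thesis by blast
qed

lemma general_form_C: "general_form u \<in> C 1"
  unfolding general_form_def
  by (intro mp.subspace_sum[OF C_subspace] mp.subspace_scale[OF C_subspace] var_C1) auto

lemma nzd_imp_socle_free:
  assumes J: "hideal J" and y: "y \<in> C 1" "nzd J y"
  shows "socle_free J"
  unfolding socle_free_def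
proof (intro ballI impI)
  fix a assume a: "a \<in> P" "\<forall>i<n. var i * a \<in> J"
  obtain c where c: "y = (\<Sum>i<n. smul (c i) (var i))" using C1_linear_combination[OF y(1)] by blast
  have "y * a = (\<Sum>i<n. smul (c i) (var i * a))" unfolding c by (simp add: sum_distrib_right smul_mult_left)
  also have "\<dots> \<in> J" using a hidealD(7)[OF J] by (intro hideal_sum[OF J]) auto
  finally show "a \<in> J" using y(2) a(1) by (simp add: nzd_def)
qed

lemma socle_free_generic:
  assumes "hideal J" "socle_free J"
  shows "finite {u. \<not> nzd J (general_form u)}"
  unfolding general_form_def
  by (rule nzd_generic[OF assms(1) var_C1]) (use assms(2) C_P socle_free_def in blast)+

text \<open>One half of the permutability of regular sequences: a relation
  \<open>q * p = j + y * b\<close> puts \<open>b\<close> into J + qP, and cancelling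
  \<open>q\<close> then gives \<open>p\<close> in J + yP.\<close>

lemma nzd_swap:
  assumes J: "hideal J" "nzd J q" "nzd (adj J q) y" and y: "y \<in> P"
  shows "nzd (adj J y) q"
  unfolding nzd_def
proof (intro ballI impI)
  fix p assume p: "p \<in> P" "q * p \<in> adj J y"
  then obtain j b where jb: "q * p = j + y * b" "j \<in> J" "b \<in> P" unfolding adj_def by blast
  then have "y * b = - j + q * p" by simp
  then have "y * b \<in> adj J q" using hidealD(8)[OF J(1) jb(2)] p(1) unfolding adj_def by blast
  then have "b \<in> adj J q" using J(3) jb(3) by (simp add: nzd_def)
  then obtain j' b' where b: "b = j' + q * b'" "j' \<in> J" "b' \<in> P" unfolding adj_def by blast
  have "q * (p - y * b') = j + y * j'" using jb(1) b(1) by (simp add: algebra_simps)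
  also have "\<dots> \<in> J" using hidealD(3,4)[OF J(1)] jb(2) b(2) y by blast
  finally have "p - y * b' \<in> J" using J(2) p(1) b(3) y by (simp add: nzd_def poly_ring_diff poly_ring_mult)
  then have "p = (p - y * b') + y * b' \<and> p - y * b' \<in> J" by simp
  then show "p \<in> adj J y" unfolding adj_def using b(3) by blast
qed

text \<open>
  If \<open>x\<^sub>i a \<equiv> q b\<^sub>i\<close> and \<open>y = \<Sum>c\<^sub>i x\<^sub>i\<close> then \<open>y a \<equiv> q b\<close> with \<open>b = \<Sum>c\<^sub>i b\<^sub>i\<close>, and cancelling \<open>q\<close>
  in \<open>q y b\<^sub>i \<equiv> q x\<^sub>i b\<close> shows that \<open>b\<close> is in the socle modulo \<open>y\<close>.
\<close>

lemma socle_free_adj: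
  assumes J: "hideal J" and y: "y \<in> C 1" "nzd J y" and sf: "socle_free (adj J y)"
    and q: "q \<in> C d" "nzd J q"
  shows "socle_free (adj J q)"
  unfolding socle_free_def
proof (intro ballI impI)
  fix a assume a: "a \<in> P" "\<forall>i<n. var i * a \<in> adj J q"
  obtain c where c: "y = (\<Sum>i<n. smul (c i) (var i))" using C1_linear_combination[OF y(1)] by blast
  have "\<forall>i. \<exists>b. i < n \<longrightarrow> b \<in> P \<and> var i * a - q * b \<in> J"
    using a(2) unfolding adj_def by fastforce
  then obtain b where b: "\<And>i. i < n \<Longrightarrow> b i \<in> P" "\<And>i. i < n \<Longrightarrow> var i * a - q * b i \<in> J" by metis
  define B where "B = (\<Sum>i<n. smul (c i) (b i))"
  have BP: "B \<in> P" unfolding B_def using b(1) by (intro poly_ring_sum poly_ring_smul) auto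
  have yP: "y \<in> P" and qP: "q \<in> P" using y(1) q(1) C_P by auto
  have ya: "y * a - q * B \<in> J"
  proof -
    have "y * a - q * B = (\<Sum>i<n. smul (c i) (var i * a - q * b i))"
      unfolding c B_def
      by (simp add: sum_distrib_left sum_distrib_right smul_mult_left smul_mult_right
          mp.scale_right_diff_distrib sum_subtractf)
    also have "\<dots> \<in> J" using b(2) hidealD(7)[OF J] by (intro hideal_sum[OF J]) auto
    finally show ?thesis .
  qed
  have "var i * B \<in> adj J y" if i: "i < n" for i
  proof -
    have "q * (var i * B - y * b i) = y * (var i * a - q * b i) - var i * (y * a - q * B)"
      by (simp add: algebra_simps)
    also have "\<dots> \<in> J"
      using hidealD(9)[OF J hidealD(4)[OF J yP b(2)[OF i]] hidealD(4)[OF J poly_ring_var[OF i] ya]] .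
    finally have "var i * B - y * b i \<in> J"
      using q(2) BP b(1)[OF i] yP i by (simp add: nzd_def poly_ring_diff poly_ring_mult)
    moreover have "var i * B = (var i * B - y * b i) + y * b i" by simp
    ultimately show ?thesis unfolding adj_def using b(1)[OF i] by blast
  qed
  then have "B \<in> adj J y" using sf BP by (simp add: socle_free_def)
  then obtain j b' where b': "B = j + y * b'" "j \<in> J" "b' \<in> P" unfolding adj_def by blast
  have "y * (a - q * b') = (y * a - q * B) + q * j" using b'(1) by (simp add: algebra_simps)
  also have "\<dots> \<in> J" using hidealD(3)[OF J ya hidealD(4)[OF J qP b'(2)]] .
  finally have "a - q * b' \<in> J" using y(2) a(1) b'(3) qP by (simp add: nzd_def poly_ring_diff poly_ring_mult)
  moreover have "a = (a - q * b') + q * b'" by simp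
  ultimately show "a \<in> adj J q" unfolding adj_def using b'(3) by blast
qed

lemma dep_imp_socle_free: "hideal J \<Longrightarrow> dep (Suc e) J \<Longrightarrow> socle_free J"
  using nzd_imp_socle_free by auto

text \<open>The witness \<open>z\<close> for the depth of \<open>J\<close> may be unrelated to
  \<open>q\<close>. A general linear form \<open>y\<close> is regular modulo \<open>J\<close>, J +
  zP and J + qP alike. The induction hypothesis first moves the depth from \<open>z\<close> to
  \<open>y\<close>, then divides by \<open>q\<close> modulo \<open>y\<close>;
  \<open>nzd_swap\<close> justifies both exchanges.\<close>

lemma dep_adj:
  fixes J :: "'k::field mpoly set"
  assumes inf: "infinite (UNIV :: 'k set)"
  shows "hideal J \<Longrightarrow> dep (Suc e) J \<Longrightarrow> q \<in> C d \<Longrightarrow> nzd J q \<Longrightarrow> dep e (adj J q)"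
proof (induction e arbitrary: J q d)
  case (Suc e)
  note J = Suc.prems(1) and q = Suc.prems(3,4)
  obtain z where z: "z \<in> C 1" "nzd J z" "dep (Suc e) (adj J z)" using Suc.prems(2) by auto
  note Jz = hideal_adj(1)[OF J z(1)] and Jq = hideal_adj(1)[OF J q(1)]
  have sz: "socle_free (adj J z)" using dep_imp_socle_free[OF Jz z(3)] .
  have sq: "socle_free (adj J q)" using socle_free_adj[OF J z(1,2) sz q] .
  have sJ: "socle_free J" using nzd_imp_socle_free[OF J z(1,2)] .
  have "finite ({u. \<not> nzd J (general_form u)} \<union> {u. \<not> nzd (adj J z) (general_form u)}
      \<union> {u. \<not> nzd (adj J q) (general_form u)})"
    using socle_free_generic[OF J sJ] socle_free_generic[OF Jz sz] socle_free_generic[OF Jq sq] by simp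
  from ex_new_if_finite[OF inf this] obtain u where u: "nzd J (general_form u)"
      "nzd (adj J z) (general_form u)" "nzd (adj J q) (general_form u)" by blast
  define y where "y = general_form u"
  note y = general_form_C[of u, folded y_def] and ny = u[folded y_def]
  note Jy = hideal_adj(1)[OF J y]
  have yP: "y \<in> P" using C_P[OF y] .
  have "dep e (adj (adj J y) z)" using Suc.IH[OF Jz z(3) y ny(2)] by (simp add: adj_comm)
  then have "dep (Suc e) (adj J y)"
    using z(1) nzd_swap[OF J z(2) ny(2) yP] by auto
  then have "dep e (adj (adj J q) y)"
    using Suc.IH[OF Jy _ q(1) nzd_swap[OF J q(2) ny(3) yP]] by (simp add: adj_comm)
  then show ?case using y ny(3) by auto
qed simp

lemma dep_zero_ideal: "dep n ({0} :: 'k::field mpoly set)"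
proof -
  have "dep i (var_ideal (n - i) :: 'k mpoly set)" if "i \<le> n" for i
    using that
  proof (induction i)
    case (Suc i)
    then have i: "n - Suc i < n" "Suc (n - Suc i) = n - i" by simp_all
    have "dep i (adj (var_ideal (n - Suc i)) (var (n - Suc i)) :: 'k mpoly set)"
      unfolding adj_var[OF i(1)] i(2) using Suc by simp
    then show ?case using var_C1[OF i(1)] nzd_var by auto
  qed simp
  from this[of n] show ?thesis by (simp add: var_ideal_0)
qed

text \<open>Dividing by \<open>y\<close> as long as possible lowers the degree each time and
  therefore stops; since \<open>y\<close> is a nonzerodivisor, the annihilator modulo
  \<open>J\<close> does not change.\<close>

lemma divide_out:
  assumes J: "hideal J" and y: "y \<in> C 1" "nzd J y"
  shows "a \<in> C j \<Longrightarrow> a \<notin> J \<Longrightarrow> \<exists>j' a'. a' \<in> C j' \<and> a' \<notin> adj J y \<and> colon J a' = colon J a"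
proof (induction j arbitrary: a)
  case (0 a)
  have "a \<notin> adj J y"
  proof
    assume "a \<in> adj J y"
    then obtain x b where x: "a = x + y * b" "x \<in> J" "b \<in> P" unfolding adj_def by blast
    have "hc 0 a = hc 0 x" unfolding x(1) using hc_mult[OF y(1) x(3), of 0] by (simp add: hc_add)
    then show False using 0 hidealD(6)[OF J x(2), of 0] by (simp add: hc_id)
  qed
  then show ?case using 0 by blast
next
  case (Suc j a)
  show ?case
  proof (cases "a \<in> adj J y")
    case True
    then obtain x b where x: "a = x + y * b" "x \<in> J" "b \<in> P" unfolding adj_def by blast
    define b' where "b' = hc j b"
    have b'C: "b' \<in> C j" unfolding b'_def using hc_C[OF x(3)] .
    have "a = hc (Suc j) a" using Suc.prems by (simp add: hc_id)
    also have "\<dots> = hc (Suc j) x + y * b'"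
      unfolding x(1) b'_def using hc_mult[OF y(1) x(3), of "Suc j"] by (simp add: hc_add)
    finally have a: "a = hc (Suc j) x + y * b'" .
    have hx: "hc (Suc j) x \<in> J" using hidealD(6)[OF J x(2)] .
    have yP: "y \<in> P" using C_P[OF y(1)] .
    have "p * a \<in> J \<longleftrightarrow> p * b' \<in> J" if p: "p \<in> P" for p
    proof
      assume "p * a \<in> J"
      then have "p * a - p * hc (Suc j) x \<in> J" using hidealD(4,9)[OF J] hx p by blast
      then have "y * (p * b') \<in> J" unfolding a by (simp add: algebra_simps)
      then show "p * b' \<in> J" using y(2) p C_P[OF b'C] by (simp add: nzd_def poly_ring_mult)
    next
      assume "p * b' \<in> J"
      then have "y * (p * b') + p * hc (Suc j) x \<in> J" using hidealD(3,4)[OF J] hx p yP by blast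
      then show "p * a \<in> J" unfolding a by (simp add: algebra_simps)
    qed
    then have c: "colon J b' = colon J a" by (auto simp: colon_def)
    have "b' \<notin> J" using Suc.prems(2) a hx hidealD(3,4)[OF J] yP by metis
    then show ?thesis using Suc.IH[OF b'C] c by metis
  qed (use Suc.prems in blast)
qed

text \<open>Nonzero submodules of a module of depth \<open>e\<close> have dimension at least \<open>e\<close>.\<close>

lemma dep_hs_colon:
  fixes J :: "'k::field mpoly set"
  shows "hideal J \<Longrightarrow> dep e J \<Longrightarrow> a \<in> C j \<Longrightarrow> a \<notin> J \<Longrightarrow> geo e $ m \<le> (hs (colon J a) :: real fps) $ m"
proof (induction e arbitrary: J a j m)
  case 0
  have "1 \<notin> colon J a" using 0 by (simp add: colon_def)
  then show ?case using hf_0[OF hideal_colon(1)[OF 0(1,3)]] by (simp add: geo_def hs_def)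
next
  case (Suc e)
  obtain y where y: "y \<in> C 1" "nzd J y" "dep e (adj J y)" using Suc.prems(2) by auto
  \<comment> \<open>After the division \<open>a'\<close> is nonzero modulo J + yP, where the depth
    is at least \<open>e\<close> and the induction hypothesis applies.\<close>
  obtain j' a' where a': "a' \<in> C j'" "a' \<notin> adj J y" "colon J a' = colon J a"
    using divide_out[OF Suc.prems(1) y(1,2) Suc.prems(3,4)] by blast
  define N where "N = colon J a'"
  note J = Suc.prems(1) and Jy = hideal_adj[OF Suc.prems(1) y(1)]
  have N: "hideal N" unfolding N_def using hideal_colon(1)[OF J a'(1)] .
  have yP: "y \<in> P" using C_P[OF y(1)] .
  have nN: "nzd N y"
    using y(2) poly_ring_mult[OF _ C_P[OF a'(1)]] unfolding nzd_def N_def colon_def by (auto simp: mult.assoc)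
  have yN: "hideal (adj N y)" using hideal_adj(1)[OF N y(1)] .
  have sub: "adj N y \<subseteq> colon (adj J y) a'"
  proof (rule adj_subset[OF hideal_colon(1)[OF Jy(1) a'(1)]])
    show "N \<subseteq> colon (adj J y) a'" unfolding N_def colon_def using Jy(2) by blast
    show "y \<in> colon (adj J y) a'"
      unfolding colon_def using yP hidealD(5)[OF Jy(1) C_P[OF a'(1)] Jy(3)] by simp
  qed
  have le: "geo e $ i \<le> ((1 - fps_X) * hs N :: real fps) $ i" for i
  proof -
    have "geo e $ i \<le> (hs (colon (adj J y) a') :: real fps) $ i"
      by (rule Suc.IH[OF Jy(1) y(3) a'(1,2)])
    also have "\<dots> \<le> (hs (adj N y) :: real fps) $ i"
      using hf_mono[OF yN hideal_colon(1)[OF Jy(1) a'(1)] sub] by (simp add: hs_def)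
    also have "(hs (adj N y) :: real fps) = (1 - fps_X) * hs N"
      using hs_adj_nzd[OF N y(1) nN] by simp
    finally show ?thesis .
  qed
  \<comment> \<open>\<open>y\<close> is also a nonzerodivisor modulo \<open>N\<close>, so
    multiplying by the nonnegative series of 1 / (1 - x) recovers the series of \<open>N\<close>
    from the one modulo \<open>y\<close>.\<close>
  have "geo (Suc e) $ m \<le> (Abs_fps (\<lambda>_. 1) * ((1 - fps_X) * hs N) :: real fps) $ m"
    unfolding geo_Suc by (rule fps_mult_mono[OF le]) simp
  also have "Abs_fps (\<lambda>_. 1) * ((1 - fps_X) * hs N) = (hs N :: real fps)"
    using geo_base by (simp add: mult_ac(1)[symmetric]) (metis mult.commute mult_1)
  finally show ?case using a'(3) by (simp add: N_def)
qed

text \<open>The regular sequence grows by one quadric at a time. After \<open>i < c\<close> steps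
  the depth is at least \<open>n - i > d\<close>. If all \<open>F l\<close> killed some
  \<open>a\<close> outside \<open>J\<close>, then \<open>I\<close> would lie in J : a, whose series
  dominates \<open>geo (n - i)\<close> by \<open>dep_hs_colon\<close>, whereas the series of
  \<open>I\<close> has a pole of order at most \<open>d\<close>. So \<open>nzd_generic\<close>
  supplies the next quadric as a general combination of the \<open>F l\<close>.\<close>

lemma hs_le_complete_intersection:
  fixes I :: "'k::field mpoly set" and F :: "nat \<Rightarrow> 'k mpoly"
  assumes inf: "infinite (UNIV :: 'k set)" and I: "hideal I"
    and F: "\<And>l. l < \<mu> \<Longrightarrow> F l \<in> C 2" "\<And>l. l < \<mu> \<Longrightarrow> F l \<in> I"
    and gen: "\<And>I'. hideal I' \<Longrightarrow> (\<And>l. l < \<mu> \<Longrightarrow> F l \<in> I') \<Longrightarrow> I \<subseteq> I'"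
    and hsI: "hs I * (1 - fps_X) ^ d = (fps_of_poly N :: real fps)"
    and cd: "c + d \<le> n"
  shows "(hs I :: real fps) $ m \<le> ((1 - fps_X ^ 2) ^ c * geo n) $ m"
proof -
  have "\<exists>J. hideal J \<and> J \<subseteq> I \<and> dep (n - i) J \<and> (hs J :: real fps) = (1 - fps_X ^ 2) ^ i * geo n"
    if "i \<le> c" for i
    using that
  proof (induction i)
    case 0
    show ?case using hideal_zero dep_zero_ideal hidealD(2)[OF I]
      by (intro exI[of _ "{0}"]) (simp add: hs_zero_std)
  next
    case (Suc i)
    then obtain J where J: "hideal J" "J \<subseteq> I" "dep (n - i) J"
        "(hs J :: real fps) = (1 - fps_X ^ 2) ^ i * geo n" by auto
    define Y where "Y u = (\<Sum>l<\<mu>. smul (u ^ l) (F l))" for u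
    have YC: "Y u \<in> C 2" for u unfolding Y_def
      using F(1) by (intro mp.subspace_sum[OF C_subspace] mp.subspace_scale[OF C_subspace]) auto
    have YI: "Y u \<in> I" for u unfolding Y_def
      using F(2) hidealD(7)[OF I] by (intro hideal_sum[OF I]) auto
    have "finite {u. \<not> nzd J (Y u)}"
      unfolding Y_def
    proof (rule nzd_generic[OF J(1) F(1)])
      fix j a assume a: "a \<in> C j" "\<And>l. l < \<mu> \<Longrightarrow> F l * a \<in> J"
      show "a \<in> J"
      proof (rule ccontr)
        assume aJ: "a \<notin> J"
        have c: "hideal (colon J a)" using hideal_colon(1)[OF J(1) a(1)] .
        have "I \<subseteq> colon J a" using a(2) C_P[OF F(1)] by (intro gen[OF c]) (simp add: colon_def)
        then have "(hs (colon J a) :: real fps) $ m \<le> hs I $ m" for m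
          using hf_mono[OF I c] by (simp add: hs_def)
        then have "geo (n - i) $ m \<le> (hs I :: real fps) $ m" for m
          using dep_hs_colon[OF J(1,3) a(1) aJ] order_trans by blast
        then have "(fps_of_poly 1 * geo (n - i)) $ m \<le> (fps_of_poly N * geo d) $ m" for m
          using eq_mult_geo[OF hsI] by (simp add: fps_of_poly_1)
        from pole_order_mono[OF this] have "n - i \<le> d" by simp
        then show False using cd Suc.prems by simp
      qed
    qed
    from ex_new_if_finite[OF inf this] obtain u where u: "nzd J (Y u)" by blast
    have "dep (n - Suc i) (adj J (Y u))"
    proof (rule dep_adj[OF inf J(1) _ YC u])
      have "Suc (n - Suc i) = n - i" using cd Suc.prems by simp
      then show "dep (Suc (n - Suc i)) J" using J(3) by (simp only:)
    qed
    moreover have "adj J (Y u) \<subseteq> I" using adj_subset[OF I J(2) YI] .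
    moreover have "(hs (adj J (Y u)) :: real fps) = (1 - fps_X ^ 2) ^ Suc i * geo n"
      unfolding hs_adj_nzd[OF J(1) YC u] J(4) by (simp add: mult_ac)
    ultimately show ?case using hideal_adj(1)[OF J(1) YC] by blast
  qed
  from this[of c] obtain J where J: "hideal J" "J \<subseteq> I"
      "(hs J :: real fps) = (1 - fps_X ^ 2) ^ c * geo n" by auto
  have "(hs I :: real fps) $ m \<le> hs J $ m"
    using hf_mono[OF J(1) I J(2)] by (simp add: hs_def)
  then show ?thesis using J(3) by simp
qed

end

section \<open>Regular sequences of quadrics\<close>

text \<open>Formal Laurent series provide, uniformly for every field, an infinite extension
  field.\<close>

definition base_change :: "'k::field mpoly \<Rightarrow> 'k fls mpoly" where
  "base_change p = Poly_Mapping.map fls_const p"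

lemma cf_base_change [simp]: "cf (base_change p) m = fls_const (cf p m)"
  unfolding base_change_def by (simp add: Poly_Mapping.map.rep_eq when_def)

lemma base_change_add: "base_change (p + q) = base_change p + base_change q"
  by (rule poly_mapping_eqI) (simp add: lookup_add fls_plus_const)

lemma base_change_smul: "base_change (smul c p) = smul (fls_const c) (base_change p)"
  by (rule poly_mapping_eqI) (simp add: fls_const_mult_const)

lemma base_change_zero [simp]: "base_change 0 = 0"
  by (rule poly_mapping_eqI) simp

lemma base_change_mterm_mult: "base_change (mterm a 1 * p) = mterm a 1 * base_change p"
proof (rule poly_mapping_eqI)
  fix k
  show "cf (base_change (mterm a 1 * p)) k = cf (mterm a 1 * base_change p) k"
  proof (cases "\<exists>m. k = a + m")
    case True
    then show ?thesis by (auto simp: cf_mterm_mult)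
  next
    case False
    then show ?thesis by (simp add: cf_mterm_mult_eq_0)
  qed
qed

lemma supp_base_change [simp]: "supp (base_change p) = supp p"
  by (auto simp: in_keys_iff)

lemma base_change_one [simp]: "base_change (mterm m 1) = mterm m 1"
  by (rule poly_mapping_eqI) (simp add: lookup_single when_def)

lemma inj_base_change: "inj (base_change :: 'k::field mpoly \<Rightarrow> 'k fls mpoly)"
proof (rule injI)
  fix p q :: "'k mpoly" assume "base_change p = base_change q"
  then have "fls_const (cf p m) = fls_const (cf q m)" for m by (metis cf_base_change)
  then show "p = q" by (intro poly_mapping_eqI) (metis fls_const_nth)
qed

lemma infinite_fls: "infinite (UNIV :: 'k::field fls set)"
proof
  assume "finite (UNIV :: 'k fls set)"
  moreover have "inj (\<lambda>i :: nat. fls_X_intpow (int i) :: 'k fls)"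
  proof (rule injI)
    fix i j :: nat
    assume "(fls_X_intpow (int i) :: 'k fls) = fls_X_intpow (int j)"
    then have "fls_nth (fls_X_intpow (int i) :: 'k fls) (int i) = fls_nth (fls_X_intpow (int j)) (int i)" by simp
    then show "i = j" by (simp split: if_splits)
  qed
  ultimately show False using finite_imageD[of "\<lambda>i :: nat. fls_X_intpow (int i) :: 'k fls" UNIV]
    finite_subset[OF subset_UNIV] by blast
qed

text \<open>
  A linear relation over the field of Laurent series is a family of relations over the base
  field, one for each exponent.
\<close>

lemma dim_base_change:
  fixes V :: "'k::field mpoly set"
  assumes "finite V"
  shows "mp.dim (mp.span (base_change ` V)) = mp.dim (mp.span V)"
proof -
  obtain B where B: "B \<subseteq> V" "mp.independent B" "V \<subseteq> mp.span B"
    using mp.maximal_independent_subset by blast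
  have finB: "finite B" using B(1) assms finite_subset by blast
  have sB: "mp.span V = mp.span B" using B mp.span_eq mp.span_superset by blast
  have "mp.independent (base_change ` B)"
  proof (rule mp.independent_if_scalars_zero)
    show "finite (base_change ` B)" using finB by simp
    fix f :: "'k fls mpoly \<Rightarrow> 'k fls" and x
    assume s: "(\<Sum>x\<in>base_change ` B. smul (f x) x) = 0" and x: "x \<in> base_change ` B"
    have s': "(\<Sum>b\<in>B. smul (f (base_change b)) (base_change b)) = 0"
      using s by (subst (asm) sum.reindex) (auto intro: inj_on_subset[OF inj_base_change])
    have "fls_nth (f (base_change b)) t = 0" if b: "b \<in> B" for b t
    proof -
      have "(\<Sum>b\<in>B. smul (fls_nth (f (base_change b)) t) b) = 0"
      proof (rule poly_mapping_eqI)
        fix m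
        have "0 = fls_nth (cf (\<Sum>b\<in>B. smul (f (base_change b)) (base_change b)) m) t" unfolding s' by simp
        also have "\<dots> = (\<Sum>b\<in>B. fls_nth (f (base_change b) * fls_const (cf b m)) t)"
          by (simp add: lookup_sum fls_nth_sum)
        also have "\<dots> = (\<Sum>b\<in>B. fls_nth (f (base_change b)) t * cf b m)" by simp
        finally show "cf (\<Sum>b\<in>B. smul (fls_nth (f (base_change b)) t) b) m = cf 0 m"
          by (simp add: lookup_sum)
      qed
      then show ?thesis
        using mp.independentD[OF B(2) finB subset_refl, of "\<lambda>b. fls_nth (f (base_change b)) t" b] b by blast
    qed
    then show "f x = 0" using x by (auto intro!: fls_eqI)
  qed
  then have i: "mp.dim (mp.span (base_change ` B)) = card (base_change ` B)"
    by (simp add: mp.dim_eq_card_independent)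
  have "base_change v \<in> mp.span (base_change ` B)" if "v \<in> mp.span B" for v
    using that
  proof (induction rule: mp.span_induct_alt)
    case (step c x y)
    then show ?case
      by (simp add: base_change_add base_change_smul mp.span_add mp.span_scale mp.span_base)
  qed (simp add: mp.span_zero)
  then have "base_change ` V \<subseteq> mp.span (base_change ` B)" using B(3) by blast
  then have "mp.span (base_change ` V) = mp.span (base_change ` B)"
    using B(1) by (metis image_mono mp.span_mono mp.span_minimal mp.subspace_span subset_antisym)
  moreover have "card (base_change ` B) = card B"
    by (rule card_image) (rule inj_on_subset[OF inj_base_change subset_UNIV])
  ultimately show ?thesis using i sB mp.dim_eq_card_independent[OF B(2)] by simp
qed

context wpoly
begin

abbreviation monomials :: "nat \<Rightarrow> (nat \<Rightarrow>\<^sub>0 nat) set" where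
  "monomials j \<equiv> {m. supp m \<subseteq> {..<n} \<and> weighted_degree w m = j}"

lemma base_change_C: "f \<in> C d \<Longrightarrow> base_change f \<in> C d"
  by (simp add: poly_comp_def poly_ring_def)

text \<open>This finite spanning set of a graded component is mapped by \<open>base_change\<close>
  to the corresponding one over the extension field, so \<open>dim_base_change\<close> shows that
  Hilbert functions are unaffected.\<close>

lemma gen_ideal_span:
  fixes fs :: "'k::field mpoly list"
  assumes fs: "set fs \<subseteq> C d"
  shows "gen_ideal n fs \<inter> C j =
    mp.span (if d \<le> j then (\<lambda>(m, f). mterm m 1 * f) ` (monomials (j - d) \<times> set fs) else {})"
    (is "_ = mp.span ?S")
proof
  have h: "hideal (gen_ideal n fs)" using fs by (intro hideal_gen_ideal) auto
  have fsP: "set fs \<subseteq> P" using fs C_P by blast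
  have "?S \<subseteq> gen_ideal n fs \<inter> C j"
  proof
    fix x assume x: "x \<in> ?S"
    then have dj: "d \<le> j" by (auto split: if_splits)
    obtain m f where mf: "x = mterm m 1 * f" "m \<in> monomials (j - d)" "f \<in> set fs"
      using x dj by auto
    have "mterm m 1 \<in> C (j - d)" using mf(2) by (auto simp: poly_comp_def poly_ring_def)
    then have "x \<in> C j" using C_mult[of "mterm m 1" "j - d" f d] fs mf dj by auto
    moreover have "x \<in> gen_ideal n fs"
      unfolding mf(1) using mf gen_ideal_superset[OF fsP] poly_ring_mterm[of m n 1] by (intro hidealD(4)[OF h]) auto
    ultimately show "x \<in> gen_ideal n fs \<inter> C j" by blast
  qed
  then show "mp.span ?S \<subseteq> gen_ideal n fs \<inter> C j"
    using mp.span_minimal mp.subspace_inter[OF hideal_subspace[OF h] C_subspace] by blast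
  show "gen_ideal n fs \<inter> C j \<subseteq> mp.span ?S"
  proof
    fix p assume p: "p \<in> gen_ideal n fs \<inter> C j"
    then obtain q where q: "p = (\<Sum>i<length fs. q i * fs ! i)" "\<And>i. i < length fs \<Longrightarrow> q i \<in> P"
      by (auto simp: gen_ideal_def)
    have "p = hc j p" using p hc_id[of p j j] by simp
    also have "\<dots> = (\<Sum>i<length fs. hc j (fs ! i * q i))" unfolding q(1) hc_sum by (simp add: mult.commute)
    also have "\<dots> \<in> mp.span ?S"
    proof (rule mp.span_sum)
      fix i assume "i \<in> {..<length fs}"
      then have i: "i < length fs" and fi: "fs ! i \<in> C d" using fs by auto
      have e: "hc j (fs ! i * q i) = (if d \<le> j then fs ! i * hc (j - d) (q i) else 0)"
        using hc_mult[OF fi q(2)[OF i]] .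
      show "hc j (fs ! i * q i) \<in> mp.span ?S"
      proof (cases "d \<le> j")
        case True
        have "hc (j - d) (q i) \<in> mp.span ((\<lambda>m. mterm m 1) ` monomials (j - d))"
          using hc_C[OF q(2)[OF i]] C_span by blast
        then have "fs ! i * hc (j - d) (q i) \<in> mp.span ?S"
        proof (induction rule: mp.span_induct_alt)
          case (step c x y)
          have "x * fs ! i \<in> ?S" using step True i by force
          then show ?case
            using step by (simp add: distrib_left smul_mult_right mp.span_add mp.span_scale mp.span_base mult.commute)
        qed (simp add: mp.span_zero)
        then show ?thesis using e True by simp
      qed (simp add: e mp.span_zero)
    qed
    finally show "p \<in> mp.span ?S" .
  qed
qed

lemma hf_base_change:
  fixes fs :: "'k::field mpoly list"
  assumes fs: "set fs \<subseteq> C d"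
  shows "hf (gen_ideal n (map base_change fs)) j = hf (gen_ideal n fs) j"
proof -
  have fs': "set (map base_change fs) \<subseteq> C d"
    using fs base_change_C by auto
  have "mp.dim (C j :: 'k fls mpoly set) = mp.dim (C j :: 'k mpoly set)"
    unfolding C_span using dim_base_change[of "(\<lambda>m. mterm m 1 :: 'k mpoly) ` monomials j"] finite_monomials[of j]
    by (simp add: image_image)
  moreover have "mp.dim (gen_ideal n (map base_change fs) \<inter> C j) = mp.dim (gen_ideal n fs \<inter> C j)"
  proof -
    let ?S = "if d \<le> j then (\<lambda>(m, f). mterm m 1 * f) ` (monomials (j - d) \<times> set fs) else {}"
    have e: "(if d \<le> j then (\<lambda>(m, f). mterm m 1 * f) ` (monomials (j - d) \<times> set (map base_change fs)) else {})
        = base_change ` ?S"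
    proof -
      have "(\<lambda>(m, f). mterm m 1 * f) ` (M \<times> base_change ` F)
          = base_change ` (\<lambda>(m, f). mterm m 1 * f) ` (M \<times> F)" for M and F :: "'k mpoly set"
        unfolding image_image image_def[of base_change F]
        by (auto simp: base_change_mterm_mult image_def)
      then show ?thesis by simp
    qed
    have fin: "finite ?S" using finite_monomials by auto
    show ?thesis
      unfolding gen_ideal_span[OF fs] gen_ideal_span[OF fs'] e by (rule dim_base_change[OF fin])
  qed
  ultimately show ?thesis by (simp add: hf_def)
qed

end

context spoly
begin

lemma hs_quadrics_le:
  fixes fs :: "'k::field mpoly list"
  assumes fs: "set fs \<subseteq> C 2"
    and hs: "hs (gen_ideal n fs) * (1 - fps_X) ^ d = (fps_of_poly N :: real fps)"
    and cd: "c + d \<le> n"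
  shows "(hs (gen_ideal n fs) :: real fps) $ m \<le> ((1 - fps_X ^ 2) ^ c * geo n) $ m"
proof -
  define gs where "gs = map base_change fs"
  have gs: "set gs \<subseteq> C 2"
    using fs base_change_C by (auto simp: gs_def)
  have eq: "(hs (gen_ideal n gs) :: real fps) = hs (gen_ideal n fs)"
    unfolding hs_def gs_def hf_base_change[OF fs] ..
  have h: "hideal (gen_ideal n gs)" using gs by (intro hideal_gen_ideal) auto
  have gsP: "set gs \<subseteq> P" using gs C_P by blast
  show ?thesis
    unfolding eq[symmetric]
  proof (rule hs_le_complete_intersection[OF infinite_fls h _ _ _ _ cd, of "length gs" "\<lambda>l. gs ! l"])
    show "gs ! l \<in> C 2" if "l < length gs" for l using gs that by auto
    show "gs ! l \<in> gen_ideal n gs" if "l < length gs" for l using gen_ideal_superset[OF gsP] that by auto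
    show "gen_ideal n gs \<subseteq> I'" if "hideal I'" "\<And>l. l < length gs \<Longrightarrow> gs ! l \<in> I'" for I'
      using that by (intro gen_ideal_subset) (auto simp: in_set_conv_nth)
    show "hs (gen_ideal n gs) * (1 - fps_X) ^ d = fps_of_poly N" using hs eq by simp
  qed
qed

lemma hs_poly_geo:
  assumes "hideal J" obtains K where "(hs J :: real fps) = fps_of_poly K * geo n"
proof -
  obtain K where "(hs J :: real fps) * (1 - fps_X) ^ n = fps_of_poly K"
    using hilbert_serre[OF assms, where ?'r = real] by (auto simp: unit_weight_def)
  then show ?thesis using that eq_mult_geo by blast
qed

lemma conv_radius_hs: "hideal J \<Longrightarrow> 1 \<le> fps_conv_radius (hs J :: real fps)"
  using hs_poly_geo conv_radius_poly_geo by metis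

text \<open>The exact sequence for the colon ideal, arranged so that the excess over a regular
  quadric is visible: the last bracket is nonnegative, and by \<open>eval_hs_eq_imp_eq\<close> it
  vanishes only if J : f = J.\<close>

lemma eval_hs_adj:
  fixes x :: real
  assumes J: "hideal J" and f: "f \<in> C 2" and x: "0 < x" "x < 1"
  shows "eval_fps (hs (adj J f)) x = (1 - x ^ 2) * eval_fps (hs J) x
      + x ^ 2 * (eval_fps (hs J) x - eval_fps (hs (colon J f)) x)"
    "eval_fps (hs (colon J f)) x \<le> eval_fps (hs J) x"
proof -
  note B = hideal_colon[OF J f]
  have r: "ereal (norm x) < fps_conv_radius (hs I :: real fps)" if "hideal I" for I :: "'a mpoly set"
    by (rule less_le_trans[OF _ conv_radius_hs[OF that]]) (use x in simp)
  have "ereal (norm x) < fps_conv_radius (fps_X ^ 2 * hs (colon J f) :: real fps)"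
    using fps_conv_radius_mult[of "fps_X ^ 2 :: real fps" "hs (colon J f)"] r[OF B(1)]
    by (simp add: less_le_trans)
  then have "eval_fps (hs (adj J f)) x = eval_fps (hs J) x - x ^ 2 * eval_fps (hs (colon J f)) x"
    unfolding hs_adj[OF J f] using r[OF J] r[OF B(1)] by (simp add: eval_fps_diff eval_fps_mult)
  then show "eval_fps (hs (adj J f)) x = (1 - x ^ 2) * eval_fps (hs J) x
      + x ^ 2 * (eval_fps (hs J) x - eval_fps (hs (colon J f)) x)" by (simp add: algebra_simps)
  show "eval_fps (hs (colon J f)) x \<le> eval_fps (hs J) x"
    using hf_mono[OF J B] by (intro eval_fps_le conv_radius_hs J B x) (simp add: hs_def)
qed

text \<open>The difference of the two series has nonnegative terms, so a nonpositive sum at one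
  point makes every coefficient vanish.\<close>

lemma eval_hs_eq_imp_eq:
  fixes x :: real
  assumes J: "hideal J" "hideal J'" "J \<subseteq> J'" and x: "0 < x" "x < 1"
    and e: "eval_fps (hs J) x \<le> eval_fps (hs J' :: real fps) x"
  shows "J = J'"
proof (rule hf_eq_imp_eq[OF J])
  fix j
  have r: "summable (\<lambda>m. (hs I :: real fps) $ m * x ^ m)" if "hideal I" for I :: "'a mpoly set"
    by (intro summable_fps less_le_trans[OF _ conv_radius_hs[OF that]]) (use x in simp)
  let ?d = "\<lambda>m. (hs J :: real fps) $ m * x ^ m - hs J' $ m * x ^ m"
  have nn: "0 \<le> ?d m" for m
    using hf_mono[OF J, of m] x by (simp add: hs_def mult_right_mono)
  have s: "summable ?d" using r J by (intro summable_diff)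
  have "suminf ?d = eval_fps (hs J) x - eval_fps (hs J') x"
    unfolding eval_fps_def using r J by (intro suminf_diff[symmetric])
  then have "suminf ?d \<le> 0" using e by simp
  then have "suminf ?d = 0" using suminf_nonneg[OF s nn] by simp
  then have "?d j = 0" using suminf_eq_zero_iff[OF s nn] by blast
  then show "hf J' j = hf J j" using x by (simp add: hs_def)
qed

text \<open>Each quadric multiplies the value of the series at a point by at least 1 - x^2, while
  the total factor is at most (1 - x^2)^c with \<open>c\<close> at least the number of quadrics.
  There is no slack, so every single step is sharp and every quadric is a nonzerodivisor modulo its
  predecessors.\<close>

lemma regular_sequence_quadrics:
  fixes fs :: "'k::field mpoly list"
  assumes fs: "set fs \<subseteq> C 2"
    and hs: "hs (gen_ideal n fs) * (1 - fps_X) ^ d = (fps_of_poly N :: real fps)"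
    and N: "2 ^ length fs \<le> poly N 1"
  shows "regular_sequence n fs"
proof -
  define J where "J i = gen_ideal n (take i fs)" for i
  define \<mu> where "\<mu> = length fs"
  have hJ: "hideal (J i)" for i
    unfolding J_def using fs by (intro hideal_gen_ideal) (auto dest: in_set_takeD)
  have J\<mu>: "J \<mu> = gen_ideal n fs" by (simp add: J_def \<mu>_def)
  have fC: "fs ! i \<in> C 2" if "i < \<mu>" for i using fs that by (auto simp: \<mu>_def)
  have JS: "J (Suc i) = adj (J i) (fs ! i)" if "i < \<mu>" for i
    using gen_ideal_take_Suc that by (simp add: J_def \<mu>_def)
  have J0: "J 0 = {0}" by (simp add: J_def gen_ideal_Nil)
  define v where "v i x = eval_fps (hs (J i) :: real fps) x" for i x
  have step: "(1 - x ^ 2) * v i x \<le> v (Suc i) x" if "i < \<mu>" "0 < x" "x < 1" for i x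
    using eval_hs_adj[OF hJ fC[OF that(1)] that(2,3), of i] that by (simp add: v_def JS)
  have v0: "v 0 x = 1 / (1 - x) ^ n" if "0 < x" "x < 1" for x
    using eval_geo[OF that] by (simp add: v_def J0 hs_zero_std)
  have lower': "(1 - x ^ 2) ^ t * v a x \<le> v (a + t) x" if "a + t \<le> \<mu>" "0 < x" "x < 1" for a t x
    using that
  proof (induction t)
    case (Suc t)
    have x2: "0 \<le> 1 - x ^ 2" using Suc.prems by (simp add: power_le_one)
    have "(1 - x ^ 2) ^ Suc t * v a x = (1 - x ^ 2) * ((1 - x ^ 2) ^ t * v a x)" by simp
    also have "\<dots> \<le> (1 - x ^ 2) * v (a + t) x"
      using Suc x2 by (intro mult_left_mono) auto
    also have "\<dots> \<le> v (a + Suc t) x" using step[of "a + t" x] Suc.prems by simp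
    finally show ?case .
  qed simp
  have lower: "(1 - x ^ 2) ^ (b - a) * v a x \<le> v b x" if "a \<le> b" "b \<le> \<mu>" "0 < x" "x < 1" for a b x
    using lower'[of a "b - a" x] that by simp
  have N1: "0 < poly N 1" using N zero_less_power[of "2 :: real" "length fs"] by linarith
  have hsN: "(hs (J \<mu>) :: real fps) = fps_of_poly N * geo d" using eq_mult_geo[OF hs] J\<mu> by simp
  \<comment> \<open>The series is bounded by that of the polynomial ring, whose pole at 1 has order
    \<open>n\<close>.\<close>
  have "(fps_of_poly N * geo d) $ m \<le> (fps_of_poly 1 * geo n) $ m" for m
    using hf_mono[OF hideal_zero hJ] hidealD(2)[OF hJ]
    unfolding hsN[symmetric] hs_zero_std[symmetric, where ?'k = 'k] by (simp add: hs_def fps_of_poly_1)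
  from pole_order_mono[OF this N1] have dn: "d \<le> n" .
  define c where "c = n - d"
  have upper: "v \<mu> x \<le> (1 - x ^ 2) ^ c / (1 - x) ^ n" if x: "0 < x" "x < 1" for x
  proof -
    have p: "(1 - fps_X ^ 2) ^ c = (fps_of_poly ((1 - monom 1 2) ^ c) :: real fps)"
      by (simp add: fps_of_poly_power fps_of_poly_diff fps_of_poly_monom')
    have "v \<mu> x \<le> eval_fps ((1 - fps_X ^ 2) ^ c * geo n) x"
      unfolding v_def J\<mu>
    proof (rule eval_fps_le[OF _ _ _ x])
      show "(hs (gen_ideal n fs) :: real fps) $ m \<le> ((1 - fps_X ^ 2) ^ c * geo n) $ m" for m
        using hs_quadrics_le[OF fs hs, of c] dn by (simp add: c_def)
      show "1 \<le> fps_conv_radius (hs (gen_ideal n fs) :: real fps)" using conv_radius_hs[OF hJ] J\<mu> by metis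
    qed (simp only: p conv_radius_poly_geo)
    then show ?thesis unfolding p eval_poly_geo[OF x] by (simp add: poly_monom)
  qed
  \<comment> \<open>The upper bound with the common pole cancelled; letting \<open>x\<close> tend to
    1 gives \<open>poly N 1 \<le> 2 ^ c\<close>, and comparison with the hypothesis on
    \<open>N\<close> gives \<open>\<mu> \<le> c\<close>.\<close>
  have "poly N x \<le> (1 + x) ^ c" if x: "0 < x" "x < 1" for x
  proof -
    have "poly N x / (1 - x) ^ d \<le> (1 - x ^ 2) ^ c / (1 - x) ^ n"
      using upper[OF x] eval_poly_geo[OF x] by (simp add: v_def hsN)
    moreover have "(1 - x ^ 2) ^ c = (1 - x) ^ c * (1 + x) ^ c"
      unfolding power_mult_distrib[symmetric] by (simp add: power2_eq_square algebra_simps)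
    moreover have "(1 - x) ^ n = (1 - x) ^ c * (1 - x) ^ d"
      unfolding c_def using dn by (simp add: power_add[symmetric])
    ultimately show ?thesis using x by (simp add: field_simps)
  qed
  then have ev: "eventually (\<lambda>x. poly N x \<le> (1 + x) ^ c) (at_left 1)"
    unfolding eventually_at_left_field by (intro exI[of _ 0]) auto
  have "((\<lambda>x. poly N x) \<longlongrightarrow> poly N 1) (at_left 1)"
    "((\<lambda>x. (1 + x) ^ c) \<longlongrightarrow> (1 + 1 :: real) ^ c) (at_left 1)"
    by (intro tendsto_intros | simp)+
  from tendsto_le[OF _ this(2,1) ev] have "poly N 1 \<le> 2 ^ c" by simp
  then have "(2 :: real) ^ \<mu> \<le> 2 ^ c" using N unfolding \<mu>_def by linarith
  then have "\<mu> \<le> c" using power_increasing_iff[of "2 :: real" \<mu> c] by simp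
  then have "((3/4) :: real) ^ c \<le> (3/4) ^ \<mu>" by (intro power_decreasing) auto
  \<comment> \<open>From here on \<open>x = 1/2\<close>, where \<open>1 - x ^ 2\<close> is 3/4. As
    3/4 < 1, \<open>\<mu> \<le> c\<close> turns the upper bound with exponent \<open>c\<close> into
    one with exponent \<open>\<mu>\<close>.\<close>
  then have half: "v \<mu> (1/2) \<le> (3/4) ^ \<mu> * v 0 (1/2)"
    using upper[of "1/2"] v0[of "1/2"] by (simp add: power2_eq_square divide_right_mono order_trans)
  have vpos: "0 < v i (1/2)" if "i \<le> \<mu>" for i
  proof -
    have "0 < (3/4) ^ i * v 0 (1/2)" using v0[of "1/2"] by simp
    also have "\<dots> \<le> v i (1/2)" using lower[of 0 i "1/2"] that by (simp add: power2_eq_square)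
    finally show ?thesis .
  qed
  have "nzd (J i) (fs ! i)" if i: "i < \<mu>" for i
  proof -
    have "v (Suc i) (1/2) \<le> (3/4) * v i (1/2)"
    proof (rule ccontr)
      \<comment> \<open>A strict excess at step \<open>i\<close> is carried through the remaining
        steps by the lower bounds and contradicts \<open>half\<close>.\<close>
      assume "\<not> ?thesis"
      then have "(3/4) * ((3/4) ^ i * v 0 (1/2)) < v (Suc i) (1/2)"
        using lower[of 0 i "1/2"] i by (simp add: power2_eq_square)
      then have "(3/4) ^ (\<mu> - Suc i) * ((3/4) * ((3/4) ^ i * v 0 (1/2))) < (3/4) ^ (\<mu> - Suc i) * v (Suc i) (1/2)"
        by simp
      also have "\<dots> \<le> v \<mu> (1/2)" using lower[of "Suc i" \<mu> "1/2"] i by (simp add: power2_eq_square)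
      also have "(3/4 :: real) ^ (\<mu> - Suc i) * ((3/4) * ((3/4) ^ i * v 0 (1/2))) = (3/4) ^ (\<mu> - Suc i + Suc i) * v 0 (1/2)"
        by (simp only: power_add power_Suc mult_ac)
      finally show False using half i by simp
    qed
    then have "eval_fps (hs (J i)) (1/2) \<le> eval_fps (hs (colon (J i) (fs ! i)) :: real fps) (1/2)"
      using eval_hs_adj(1)[OF hJ fC[OF i], of "1/2" i] by (simp add: v_def JS[OF i] power2_eq_square)
    then have "J i = colon (J i) (fs ! i)"
      using eval_hs_eq_imp_eq[OF hJ hideal_colon[OF hJ fC[OF i]], of "1/2"] by simp
    then show ?thesis unfolding nzd_def colon_def by (auto simp: mult.commute)
  qed
  moreover have "1 \<notin> gen_ideal n fs"
  proof
    assume "1 \<in> gen_ideal n fs"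
    then have "C j \<subseteq> gen_ideal n fs" for j
      using hidealD(4)[OF hJ[of \<mu>], of _ 1] C_P unfolding J\<mu> by auto
    then have "gen_ideal n fs \<inter> C j = C j" for j by blast
    then have "(hs (J \<mu>) :: real fps) = 0" by (intro fps_ext) (simp add: hs_def hf_def J\<mu>)
    then show False using vpos[of \<mu>] by (simp add: v_def)
  qed
  moreover have "set fs \<subseteq> P" using fs C_P by blast
  ultimately show ?thesis using regular_sequence_iff[of fs] by (simp add: J_def \<mu>_def)
qed

end

section \<open>Presentations of standard graded algebras\<close>

context graded_algebra
begin

sublocale vs: vspace scale ..

definition gcomp :: "'a \<Rightarrow> nat \<Rightarrow> 'a" where
  "gcomp x = (THE c. (\<forall>i. c i \<in> A i) \<and> finite {i. c i \<noteq> 0} \<and> x = (\<Sum>i | c i \<noteq> 0. c i))"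

lemma gcomp: "gcomp x i \<in> A i" "finite {i. gcomp x i \<noteq> 0}" "x = (\<Sum>i | gcomp x i \<noteq> 0. gcomp x i)"
  using theI'[OF direct_sum[of x]] unfolding gcomp_def[symmetric] by auto

lemma gcomp_unique:
  assumes "\<And>i. c i \<in> A i" "finite I" "\<And>i. i \<notin> I \<Longrightarrow> c i = 0" "x = (\<Sum>i\<in>I. c i)"
  shows "gcomp x = c"
proof -
  have sub: "{i. c i \<noteq> 0} \<subseteq> I" using assms(3) by blast
  have "x = (\<Sum>i | c i \<noteq> 0. c i)"
    unfolding assms(4) using assms(2) sub by (intro sum.mono_neutral_right) auto
  then show ?thesis
    unfolding gcomp_def using assms(1) finite_subset[OF sub assms(2)]
    by (intro the1_equality[OF direct_sum]) auto
qed

lemma gcomp_superset: "finite I \<Longrightarrow> {i. gcomp x i \<noteq> 0} \<subseteq> I \<Longrightarrow> x = (\<Sum>i\<in>I. gcomp x i)"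
  by (subst gcomp(3)) (rule sum.mono_neutral_left, auto)

lemma A_zero [simp]: "0 \<in> A i" using subspace_0[OF subspace_comp] .
lemma A_add: "x \<in> A i \<Longrightarrow> y \<in> A i \<Longrightarrow> x + y \<in> A i" using subspace_add[OF subspace_comp] .
lemma A_diff: "x \<in> A i \<Longrightarrow> y \<in> A i \<Longrightarrow> x - y \<in> A i" using subspace_diff[OF subspace_comp] .
lemma A_scale: "x \<in> A i \<Longrightarrow> scale c x \<in> A i" using subspace_scale[OF subspace_comp] .
lemma A_sum: "(\<And>t. t \<in> T \<Longrightarrow> f t \<in> A i) \<Longrightarrow> sum f T \<in> A i" using subspace_sum[OF subspace_comp] .

lemma scale_mult_right: "scale c (x * y) = x * scale c y"
  using scale_mult_left[of c y x] by (simp add: mult.commute)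

lemma scale_one_mult: "scale c 1 * x = scale c x"
  using scale_mult_left[of c 1 x] by simp

lemma A_0: "x \<in> A 0 \<longleftrightarrow> (\<exists>c. x = scale c 1)" using comp_zero by auto

lemma one_A0: "1 \<in> A 0" unfolding A_0 by (intro exI[of _ 1]) simp

lemma gcomp_homog: "x \<in> A j \<Longrightarrow> gcomp x i = (if i = j then x else 0)"
  by (subst gcomp_unique[of "\<lambda>i. if i = j then x else 0" "{j}"]) auto

lemma gcomp_add: "gcomp (x + y) i = gcomp x i + gcomp y i"
proof -
  let ?I = "{i. gcomp x i \<noteq> 0} \<union> {i. gcomp y i \<noteq> 0}"
  have "gcomp (x + y) = (\<lambda>i. gcomp x i + gcomp y i)"
    using gcomp(1,2) gcomp_superset[of ?I x] gcomp_superset[of ?I y]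
    by (intro gcomp_unique[of _ ?I]) (auto simp: A_add sum.distrib)
  then show ?thesis by simp
qed

lemma gcomp_zero [simp]: "gcomp 0 i = 0" using gcomp_homog[of 0 0] by simp

lemma gcomp_sum: "gcomp (sum f T) i = (\<Sum>t\<in>T. gcomp (f t) i)"
  by (induction T rule: infinite_finite_induct) (auto simp: gcomp_add)

lemma gcomp_mult:
  assumes a: "a \<in> A s"
  shows "gcomp (a * x) i = (if s \<le> i then a * gcomp x (i - s) else 0)"
proof -
  let ?I = "{i. gcomp x i \<noteq> 0}"
  have "gcomp (a * x) = (\<lambda>i. if s \<le> i then a * gcomp x (i - s) else 0)"
  proof (rule gcomp_unique[of _ "(+) s ` ?I"])
    show "(if s \<le> i then a * gcomp x (i - s) else 0) \<in> A i" for i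
      using mult_comp[OF a gcomp(1)[of x "i - s"]] by auto
    show "finite ((+) s ` ?I)" using gcomp(2) by simp
    show "(if s \<le> i then a * gcomp x (i - s) else 0) = 0" if "i \<notin> (+) s ` ?I" for i
    proof (cases "s \<le> i")
      case True
      then have "i = s + (i - s)" by simp
      then have "i - s \<notin> ?I" using that by blast
      then show ?thesis by simp
    qed simp
    have "a * x = (\<Sum>t\<in>?I. a * gcomp x t)" using gcomp(3)[of x] by (metis sum_distrib_left)
    also have "\<dots> = (\<Sum>i\<in>(+) s ` ?I. if s \<le> i then a * gcomp x (i - s) else 0)"
      by (subst sum.reindex) auto
    finally show "a * x = \<dots>" .
  qed
  then show ?thesis by simp
qed

lemma gcomp_scale: "gcomp (scale c x) i = scale c (gcomp x i)"
  using gcomp_mult[of "scale c 1" 0 x i] A_scale[OF one_A0] by (simp add: scale_one_mult)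

lemma irrelevant_iff: "x \<in> irrelevant \<longleftrightarrow> gcomp x 0 = 0"
proof
  have "irrelevant \<subseteq> {x. gcomp x 0 = 0}"
    unfolding irrelevant_def
  proof (rule span_minimal)
    show "(\<Union>i\<in>{0<..}. A i) \<subseteq> {x. gcomp x 0 = 0}" by (auto simp: gcomp_homog)
    show "subspace {x. gcomp x 0 = 0}" by (simp add: subspace_def gcomp_add gcomp_scale)
  qed
  then show "x \<in> irrelevant \<Longrightarrow> gcomp x 0 = 0" by blast
next
  assume x: "gcomp x 0 = 0"
  have "(\<Sum>i | gcomp x i \<noteq> 0. gcomp x i) \<in> irrelevant"
    unfolding irrelevant_def
  proof (intro span_sum span_base)
    fix i assume "i \<in> {i. gcomp x i \<noteq> 0}"
    then have "0 < i" using x by (cases i) auto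
    then show "gcomp x i \<in> (\<Union>i\<in>{0<..}. A i)" using gcomp(1) by blast
  qed
  then show "x \<in> irrelevant" using gcomp(3)[of x] by simp
qed

lemma gcomp_0_residue: "gcomp x 0 = scale (residue x) 1"
proof -
  obtain c where c: "gcomp x 0 = scale c 1" using gcomp(1)[of x 0] A_0 by auto
  have iff: "x - scale c' 1 \<in> irrelevant \<longleftrightarrow> c' = c" for c'
  proof -
    have "gcomp (x - scale c' 1) 0 = gcomp x 0 + gcomp (scale (- c') 1) 0"
      using gcomp_add[of x "scale (- c') 1" 0] by simp
    also have "gcomp (scale (- c') 1) 0 = - scale c' 1" using gcomp_homog[OF A_scale[OF one_A0], of "- c'" 0] by simp
    finally show ?thesis unfolding irrelevant_iff c by (auto simp: scale_left_diff_distrib[symmetric])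
  qed
  have "residue x = c" unfolding residue_def by (rule the_equality) (simp_all add: iff)
  then show ?thesis using c by simp
qed

lemma residue_eq_iff: "residue x = c \<longleftrightarrow> gcomp x 0 = scale c 1"
  using gcomp_0_residue[of x] by auto

lemma residue_0_iff: "residue x = 0 \<longleftrightarrow> x \<in> irrelevant"
  unfolding residue_eq_iff irrelevant_iff by simp

lemma residue_zero [simp]: "residue 0 = 0" by (simp add: residue_eq_iff)

lemma residue_add: "residue (x + y) = residue x + residue y"
  by (rule residue_eq_iff[THEN iffD2], unfold gcomp_add) (simp add: gcomp_0_residue scale_left_distrib)

lemma residue_sum: "residue (sum f T) = (\<Sum>t\<in>T. residue (f t))"
  by (induction T rule: infinite_finite_induct) (auto simp: residue_add)

lemma residue_scale: "residue (scale c x) = c * residue x"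
  by (rule residue_eq_iff[THEN iffD2], unfold gcomp_scale) (simp add: gcomp_0_residue)

lemma residue_one [simp]: "residue 1 = 1"
  unfolding residue_eq_iff by (simp add: gcomp_homog[OF one_A0])

lemma residue_A0: "x \<in> A 0 \<Longrightarrow> x = scale (residue x) 1"
  using gcomp_0_residue[of x] gcomp_homog[of x 0 0] by simp

lemma residue_pos: "x \<in> A i \<Longrightarrow> 0 < i \<Longrightarrow> residue x = 0"
  unfolding residue_eq_iff by (simp add: gcomp_homog)

lemma irrelevant_A0: "x \<in> A 0 \<Longrightarrow> x \<in> irrelevant \<Longrightarrow> x = 0"
  using residue_A0[of x] residue_0_iff[of x] by simp

text \<open>The degree-one components of finitely many algebra generators span \<open>A 1\<close>:
  since (xy)_1 = x_0 y_1 + x_1 y_0 with scalars x_0 and y_0, the elements whose degree-one component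
  lies in that span form a subalgebra.\<close>

lemma finite_dim_A1: "\<exists>B. finite B \<and> A 1 \<subseteq> span B"
proof -
  obtain S where S: "finite S" "subalgebra hull S = UNIV" using finitely_generated by blast
  let ?B = "(\<lambda>s. gcomp s 1) ` S"
  let ?T = "{x. gcomp x 1 \<in> span ?B}"
  have "gcomp (x * y) 1 \<in> span ?B" if xy: "gcomp x 1 \<in> span ?B" "gcomp y 1 \<in> span ?B" for x y
  proof -
    have "gcomp (x * y) 1 = (\<Sum>i | gcomp x i \<noteq> 0. gcomp (gcomp x i * y) 1)"
      by (subst gcomp(3)[of x]) (simp add: sum_distrib_right gcomp_sum)
    also have "\<dots> \<in> span ?B"
    proof (rule span_sum)
      fix i :: nat
      consider "i = 0" | "i = 1" | "1 < i" by linarith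
      then show "gcomp (gcomp x i * y) 1 \<in> span ?B"
      proof cases
        case 1
        then show ?thesis using gcomp_0_residue[of x] xy span_scale
          by (simp add: scale_one_mult gcomp_scale)
      next
        case 2
        have "gcomp (gcomp x 1 * y) 1 = scale (residue y) (gcomp x 1)"
          using gcomp_mult[OF gcomp(1)[of x 1], of y 1] gcomp_0_residue[of y]
          by (simp add: scale_mult_right[symmetric])
        then show ?thesis using 2 xy span_scale by simp
      next
        case 3
        then show ?thesis using gcomp_mult[OF gcomp(1)[of x i], of y 1] span_zero by simp
      qed
    qed
    finally show ?thesis .
  qed
  moreover have "subspace ?T"
    by (rule subspaceI) (simp_all add: gcomp_add gcomp_scale span_zero span_add span_scale)
  moreover have "1 \<in> ?T" by (simp add: gcomp_homog[OF one_A0] span_zero)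
  ultimately have "subalgebra ?T" unfolding subalgebra_def by (intro conjI ballI) simp_all
  moreover have "S \<subseteq> ?T" by (auto intro: span_base)
  ultimately have "subalgebra hull S \<subseteq> ?T" by (intro hull_minimal)
  then have "gcomp x 1 \<in> span ?B" for x using S(2) by auto
  moreover have "gcomp x 1 = x" if "x \<in> A 1" for x using gcomp_homog[OF that, of 1] by simp
  ultimately have "A 1 \<subseteq> span ?B" by (metis subsetI)
  then show ?thesis using S(1) by blast
qed

section \<open>Evaluation of polynomials in the algebra\<close>

definition monomial_value :: "(nat \<Rightarrow> 'a) \<Rightarrow> (nat \<Rightarrow>\<^sub>0 nat) \<Rightarrow> 'a" where
  "monomial_value b m = (\<Prod>i\<in>supp m. b i ^ cf m i)"

definition ev :: "(nat \<Rightarrow> 'a) \<Rightarrow> 'k mpoly \<Rightarrow> 'a" where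
  "ev b p = (\<Sum>m\<in>supp p. scale (cf p m) (monomial_value b m))"

lemma monomial_value_superset:
  "finite T \<Longrightarrow> supp m \<subseteq> T \<Longrightarrow> monomial_value b m = (\<Prod>i\<in>T. b i ^ cf m i)"
  unfolding monomial_value_def by (rule prod.mono_neutral_left) (auto simp: in_keys_iff)

lemma monomial_value_add: "monomial_value b (m + m') = monomial_value b m * monomial_value b m'"
proof -
  let ?T = "supp m \<union> supp m'"
  have "monomial_value b (m + m') = (\<Prod>i\<in>?T. b i ^ cf (m + m') i)"
    using keys_add[of m m'] by (intro monomial_value_superset) auto
  then show ?thesis
    by (simp add: lookup_add power_add prod.distrib monomial_value_superset[of ?T])
qed

lemma ev_superset:
  "finite T \<Longrightarrow> supp p \<subseteq> T \<Longrightarrow> ev b p = (\<Sum>m\<in>T. scale (cf p m) (monomial_value b m))"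
  unfolding ev_def by (rule sum.mono_neutral_left) (auto simp: in_keys_iff)

lemma ev_add: "ev b (p + q) = ev b p + ev b q"
proof -
  let ?T = "supp p \<union> supp q"
  have "ev b (p + q) = (\<Sum>m\<in>?T. scale (cf (p + q) m) (monomial_value b m))"
    using keys_add[of p q] by (intro ev_superset) auto
  then show ?thesis
    by (simp add: lookup_add scale_left_distrib sum.distrib ev_superset[of ?T])
qed

lemma ev_zero [simp]: "ev b 0 = 0" by (simp add: ev_def)

lemma ev_sum: "ev b (sum f T) = (\<Sum>t\<in>T. ev b (f t))"
  by (induction T rule: infinite_finite_induct) (auto simp: ev_add)

lemma ev_mterm: "ev b (mterm m c) = scale c (monomial_value b m)"
  by (cases "c = 0") (simp_all add: ev_def)

lemma ev_one [simp]: "ev b 1 = 1"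
  using ev_mterm[of b 0 1] by (simp add: monomial_value_def)

lemma ev_smul: "ev b (smul c p) = scale c (ev b p)"
  using ev_superset[of "supp p" "smul c p" b]
  by (auto simp: ev_def scale_sum_right in_keys_iff subset_iff)

lemma ev_mult: "ev b (p * q) = ev b p * ev b q"
proof -
  have t: "ev b (mterm m c * q) = ev b (mterm m c) * ev b q" for m c
  proof -
    have "ev b (mterm m c * q) = (\<Sum>t\<in>supp q. scale (c * cf q t) (monomial_value b m * monomial_value b t))"
      unfolding mterm_mult_sum by (simp add: ev_sum ev_mterm monomial_value_add)
    also have "\<dots> = scale c (monomial_value b m) * ev b q"
      unfolding ev_def sum_distrib_left
      by (intro sum.cong refl) (metis scale_mult_left scale_mult_right scale_scale)
    finally show ?thesis by (simp add: ev_mterm)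
  qed
  have "ev b (p * q) = (\<Sum>m\<in>supp p. ev b (mterm m (cf p m) * q))"
    by (subst (1) mpoly_sum_terms[of p]) (simp add: sum_distrib_right ev_sum)
  also have "\<dots> = (\<Sum>m\<in>supp p. ev b (mterm m (cf p m))) * ev b q"
    by (simp add: t sum_distrib_right)
  also have "(\<Sum>m\<in>supp p. ev b (mterm m (cf p m))) = ev b p"
    by (subst ev_def, simp only: ev_mterm)
  finally show ?thesis .
qed

lemma ev_uminus: "ev b (- p) = - ev b p"
  using ev_add[of b p "- p"] by (simp add: eq_neg_iff_add_eq_0 add.commute)

lemma ev_diff: "ev b (p - q) = ev b p - ev b q"
  using ev_add[of b p "- q"] ev_uminus[of b q] by simp

lemma ev_var: "ev b (var i) = b i"
  unfolding var_def by (simp add: ev_mterm monomial_value_def)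

lemma linear_ev: "Vector_Spaces.linear smul scale (ev b)"
  by unfold_locales (simp_all add: ev_add ev_smul)

lemma prod_A:
  assumes "finite T" "\<And>i. i \<in> T \<Longrightarrow> b i \<in> A 1"
  shows "(\<Prod>i\<in>T. b i ^ f i) \<in> A (\<Sum>i\<in>T. f i)"
  using assms
proof (induction T rule: finite_induct)
  case empty
  show ?case by (simp add: one_A0)
next
  case (insert i T)
  have "b i ^ e \<in> A e" for e
  proof (induction e)
    case (Suc e)
    then show ?case using mult_comp[of "b i" 1 "b i ^ e" e] insert.prems by simp
  qed (simp add: one_A0)
  then show ?case using mult_comp insert by auto
qed

end

text \<open>The variables go to a basis of \<open>A 1\<close>, so the presentation is minimal: its
  kernel contains no nonzero linear form.\<close>

locale standard_presentation = graded_algebra scale A + spoly n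
  for scale :: "'k::field \<Rightarrow> 'a::comm_ring_1 \<Rightarrow> 'a" and A :: "nat \<Rightarrow> 'a set" and n :: nat +
  fixes b :: "nat \<Rightarrow> 'a"
  assumes std: "standard_graded"
    and b_inj: "inj_on b {..<n}" and b_indep: "independent (b ` {..<n})" and b_span: "span (b ` {..<n}) = A 1"
begin

lemma b_A1: "i < n \<Longrightarrow> b i \<in> A 1"
  using span_base[of "b i" "b ` {..<n}"] b_span by simp

lemma ev_C: assumes "p \<in> C j" shows "ev b p \<in> A j"
  unfolding ev_def
proof (intro A_sum A_scale)
  fix m assume m: "m \<in> supp p"
  then have "supp m \<subseteq> {..<n}" "(\<Sum>i\<in>supp m. cf m i) = j"
    using assms by (auto simp: poly_comp_def poly_ring_def weighted_degree_def unit_weight_def)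
  then show "monomial_value b m \<in> A j"
    unfolding monomial_value_def using prod_A[of "supp m" b "cf m"] b_A1 by auto
qed

lemma ev_surj: "ev b ` P = UNIV"
proof -
  have "subalgebra (ev b ` P)"
    unfolding subalgebra_def subspace_def
  proof (intro conjI ballI allI)
    show "0 \<in> ev b ` P" by (intro image_eqI[of _ _ 0]) simp_all
    show "1 \<in> ev b ` P" by (intro image_eqI[of _ _ 1]) simp_all
    fix x assume "x \<in> ev b ` P"
    then obtain p where p: "x = ev b p" "p \<in> P" by blast
    show "scale c x \<in> ev b ` P" for c
      using p by (intro image_eqI[of _ _ "smul c p"]) (auto simp: ev_smul)
    fix y assume "y \<in> ev b ` P"
    then obtain q where q: "y = ev b q" "q \<in> P" by blast
    show "x + y \<in> ev b ` P" using p q by (intro image_eqI[of _ _ "p + q"]) (auto simp: ev_add)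
    show "x * y \<in> ev b ` P" using p q by (intro image_eqI[of _ _ "p * q"]) (auto simp: ev_mult)
  qed
  moreover from this have "A 1 \<subseteq> ev b ` P"
  proof -
    have "b ` {..<n} \<subseteq> ev b ` P"
      by (auto intro!: image_eqI[of _ _ "var _"] simp: ev_var)
    then have "span (b ` {..<n}) \<subseteq> ev b ` P"
      using \<open>subalgebra (ev b ` P)\<close> span_minimal by (auto simp: subalgebra_def)
    then show ?thesis using b_span by simp
  qed
  ultimately have "subalgebra hull (A 1) \<subseteq> ev b ` P" by (intro hull_minimal)
  then show ?thesis using std by (auto simp: standard_graded_def)
qed

lemma gcomp_ev: assumes "p \<in> P" shows "gcomp (ev b p) j = ev b (hc j p)"
proof -
  let ?I = "weighted_degree unit_weight ` supp p"
  have "gcomp (ev b p) = (\<lambda>j. ev b (hc j p))"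
  proof (rule gcomp_unique[of _ ?I])
    show "ev b (hc j p) \<in> A j" for j using ev_C hc_C[OF assms] by blast
    show "ev b (hc j p) = 0" if "j \<notin> ?I" for j
    proof -
      have "hc j p = 0" unfolding hc_def using that by (intro restr_eq_0) auto
      then show ?thesis by simp
    qed
    show "ev b p = (\<Sum>j\<in>?I. ev b (hc j p))" unfolding ev_sum[symmetric] sum_hc[symmetric] ..
  qed simp
  then show ?thesis by simp
qed

lemma ev_C_image: "ev b ` C j = A j"
proof
  show "ev b ` C j \<subseteq> A j" using ev_C by blast
  show "A j \<subseteq> ev b ` C j"
  proof
    fix x assume x: "x \<in> A j"
    obtain p where p: "x = ev b p" "p \<in> P" using ev_surj by blast
    have "x = ev b (hc j p)" using gcomp_ev[OF p(2), of j] gcomp_homog[OF x, of j] p(1) by simp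
    then show "x \<in> ev b ` C j" using hc_C[OF p(2)] by blast
  qed
qed

definition ker :: "'k mpoly set" where "ker = {p \<in> P. ev b p = 0}"

lemma hideal_ker: "hideal ker"
  unfolding hideal_def
proof (intro conjI ballI allI)
  show "ker \<subseteq> P" "0 \<in> ker" by (auto simp: ker_def)
  fix p assume p: "p \<in> ker"
  show "p + q \<in> ker" if "q \<in> ker" for q using p that by (auto simp: ker_def ev_add)
  show "q * p \<in> ker" if "q \<in> P" for q using p that by (auto simp: ker_def ev_mult)
  show "hc j p \<in> ker" for j
    using p gcomp_ev[of p j] C_P[OF hc_C[of p j]] by (auto simp: ker_def)
qed

sublocale evp: vspace_pair smul scale ..

lemma A_dim: "vs.has_dim (A j) (dim (A j))" and dim_A: "dim (A j) = hf ker j"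
proof -
  have k: "{v \<in> C j. ev b v = 0} = ker \<inter> C j" using C_P by (auto simp: ker_def)
  show "vs.has_dim (A j) (dim (A j))"
    using evp.dim_kernel_image(2)[OF linear_ev[of b] C_dim[of j]] unfolding ev_C_image .
  show "dim (A j) = hf ker j"
    using evp.dim_kernel_image(1)[OF linear_ev[of b] C_dim[of j]] unfolding k ev_C_image hf_def by simp
qed

lemma hilbert_series_ker: "hilbert_series = hs ker"
  unfolding hilbert_series_def hs_def dim_A by simp

end

lemma (in graded_algebra) standard_presentation_exists:
  assumes "standard_graded"
  shows "\<exists>n b. standard_presentation scale A n b"
proof -
  obtain B where B: "finite B" "A 1 \<subseteq> span B" using finite_dim_A1 by blast
  have "vs.has_dim (A 1) (dim (A 1))" using vs.has_dim_dim[OF subspace_comp B] .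
  then obtain B' where B': "finite B'" "independent B'" "span B' = A 1"
    unfolding vs.has_dim_def by blast
  obtain b where b: "bij_betw b {..<card B'} B'" using ex_bij_betw_nat_finite[OF B'(1)] atLeast0LessThan by metis
  have "standard_presentation scale A (card B') b"
    using assms b B' by unfold_locales (auto simp: bij_betw_def)
  then show ?thesis by blast
qed

section \<open>The linear resolution of a Koszul algebra\<close>

definition unit_vec :: "nat \<Rightarrow> nat \<Rightarrow> 'a::comm_ring_1" where
  "unit_vec b t = (if t = b then 1 else 0)"

lemma free_module_zero [simp]: "(\<lambda>_. 0) \<in> free_module m"
  by (simp add: free_module_def)

lemma free_module_lin_comb:
  "(\<And>t. t \<in> T \<Longrightarrow> f t \<in> free_module m) \<Longrightarrow> (\<lambda>b. \<Sum>t\<in>T. x t * f t b) \<in> free_module m"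
  by (simp add: free_module_def)

lemma unit_vec_free: "b < m \<Longrightarrow> unit_vec b \<in> free_module m"
  by (simp add: free_module_def unit_vec_def)

lemma free_module_expand:
  "v \<in> free_module m \<Longrightarrow> v = (\<lambda>t. \<Sum>b<m. v b * unit_vec b t)"
  by (rule ext) (auto simp: unit_vec_def free_module_def if_distrib[of "(*) _"] cong: if_cong)

text \<open>The given resolution may be non-minimal; only its Tor is known to be linear. It serves
  to compute Tor with coefficients in syzygy modules, while the linear resolution itself is
  constructed separately.\<close>

locale koszul_resolution = standard_presentation scale A n b
  for scale :: "'k::field \<Rightarrow> 'a::comm_ring_1 \<Rightarrow> 'a" and A :: "nat \<Rightarrow> 'a set" and n :: nat
    and b :: "nat \<Rightarrow> 'a" +
  fixes r :: "nat \<Rightarrow> nat" and e :: "nat \<Rightarrow> nat \<Rightarrow> nat"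
    and d :: "nat \<Rightarrow> (nat \<Rightarrow> 'a) \<Rightarrow> (nat \<Rightarrow> 'a)" and \<epsilon> :: "(nat \<Rightarrow> 'a) \<Rightarrow> 'k"
  assumes res: "free_resolution r e d \<epsilon>"
    and tor: "\<And>i j. i \<noteq> j \<Longrightarrow> tor_cycles r e d i j = tor_boundaries r e d i j"
begin

abbreviation "FM i \<equiv> free_module (r i) :: (nat \<Rightarrow> 'a) set"
abbreviation "FC i \<equiv> free_comp A (r i) (e i)"

lemma FC_iff: "v \<in> FC i s \<longleftrightarrow> v \<in> FM i \<and> (\<forall>t<r i. if e i t \<le> s then v t \<in> A (s - e i t) else v t = 0)"
  by (simp add: free_comp_def)

lemma FC_FM: "v \<in> FC i s \<Longrightarrow> v \<in> FM i" by (simp add: FC_iff)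

lemma FC_zero [simp]: "(\<lambda>_. 0) \<in> FC i s" by (simp add: FC_iff)

lemma FC_diff: "u \<in> FC i s \<Longrightarrow> v \<in> FC i s \<Longrightarrow> (\<lambda>t. u t - v t) \<in> FC i s"
  by (auto simp: FC_iff free_module_def A_diff)

lemma FC_lin_comb:
  assumes "\<And>c. c \<in> T \<Longrightarrow> x c \<in> A m" "\<And>c. c \<in> T \<Longrightarrow> f c \<in> FC i s"
  shows "(\<lambda>t. \<Sum>c\<in>T. x c * f c t) \<in> FC i (m + s)"
  unfolding FC_iff
proof (intro conjI allI impI)
  show "(\<lambda>t. \<Sum>c\<in>T. x c * f c t) \<in> FM i"
    by (rule free_module_lin_comb) (rule FC_FM[OF assms(2)])
  fix t assume t: "t < r i"
  have f: "if e i t \<le> s then f c t \<in> A (s - e i t) else f c t = 0" if "c \<in> T" for c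
    using assms(2)[OF that] t by (simp add: FC_iff)
  show "if e i t \<le> m + s then (\<Sum>c\<in>T. x c * f c t) \<in> A (m + s - e i t) else (\<Sum>c\<in>T. x c * f c t) = 0"
  proof (cases "e i t \<le> s")
    case True
    have "x c * f c t \<in> A (m + s - e i t)" if "c \<in> T" for c
      using mult_comp[OF assms(1)[OF that], of "f c t" "s - e i t"] f[OF that] True by simp
    then show ?thesis using True by (simp add: A_sum)
  next
    case False
    then show ?thesis using f by simp
  qed
qed

lemma d_FM: "v \<in> FM (Suc i) \<Longrightarrow> d i v \<in> FM i"
  and d_add: "u \<in> FM (Suc i) \<Longrightarrow> v \<in> FM (Suc i) \<Longrightarrow> d i (\<lambda>t. u t + v t) = (\<lambda>t. d i u t + d i v t)"
  and d_mult: "v \<in> FM (Suc i) \<Longrightarrow> d i (\<lambda>t. x * v t) = (\<lambda>t. x * d i v t)"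
  and d_FC: "v \<in> FC (Suc i) s \<Longrightarrow> d i v \<in> FC i s"
proof -
  have g: "graded_linear_map A (r (Suc i)) (e (Suc i)) (r i) (e i) (d i)"
    using conjunct1[OF res[unfolded free_resolution_def]] by (rule spec)
  note G = g[unfolded graded_linear_map_def]
  show "v \<in> FM (Suc i) \<Longrightarrow> d i v \<in> FM i" using conjunct1[OF G] by (rule subsetD[OF _ imageI])
  show "u \<in> FM (Suc i) \<Longrightarrow> v \<in> FM (Suc i) \<Longrightarrow> d i (\<lambda>t. u t + v t) = (\<lambda>t. d i u t + d i v t)"
    using conjunct1[OF conjunct2[OF G]] by simp
  show "v \<in> FM (Suc i) \<Longrightarrow> d i (\<lambda>t. x * v t) = (\<lambda>t. x * d i v t)"
    using conjunct1[OF conjunct2[OF conjunct2[OF G]]] by simp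
  show "v \<in> FC (Suc i) s \<Longrightarrow> d i v \<in> FC i s"
    using spec[OF conjunct2[OF conjunct2[OF conjunct2[OF G]]]] by (rule subsetD[OF _ imageI])
qed

lemma d_zero [simp]: "d i (\<lambda>_. 0) = (\<lambda>_. 0)"
  using d_mult[of "\<lambda>_. 0" i 0] by simp

lemma d_lin_comb:
  assumes "finite T" "\<And>c. c \<in> T \<Longrightarrow> f c \<in> FM (Suc i)"
  shows "d i (\<lambda>t. \<Sum>c\<in>T. x c * f c t) = (\<lambda>t. \<Sum>c\<in>T. x c * d i (f c) t)"
  using assms
proof (induction T rule: finite_induct)
  case (insert c T)
  have 1: "(\<lambda>t. x c * f c t) \<in> FM (Suc i)" using insert.prems by (simp add: free_module_def)
  have 2: "(\<lambda>t. \<Sum>c\<in>T. x c * f c t) \<in> FM (Suc i)" using insert.prems by (intro free_module_lin_comb) auto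
  have "d i (\<lambda>t. \<Sum>c\<in>insert c T. x c * f c t) = d i (\<lambda>t. x c * f c t + (\<Sum>c\<in>T. x c * f c t))"
    using insert.hyps by simp
  also have "\<dots> = (\<lambda>t. x c * d i (f c) t + (\<Sum>c\<in>T. x c * d i (f c) t))"
    using d_add[OF 1 2] d_mult insert by simp
  finally show ?case using insert.hyps by simp
qed simp

lemma d_diff:
  assumes "u \<in> FM (Suc i)" "v \<in> FM (Suc i)"
  shows "d i (\<lambda>t. u t - v t) = (\<lambda>t. d i u t - d i v t)"
proof -
  have "(\<lambda>t. - 1 * v t) \<in> FM (Suc i)" using assms(2) by (simp add: free_module_def)
  from d_add[OF assms(1) this] d_mult[OF assms(2), of "- 1"] show ?thesis by simp
qed

lemma eps_add: "u \<in> FM 0 \<Longrightarrow> v \<in> FM 0 \<Longrightarrow> \<epsilon> (\<lambda>t. u t + v t) = \<epsilon> u + \<epsilon> v"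
  and eps_mult: "v \<in> FM 0 \<Longrightarrow> \<epsilon> (\<lambda>t. x * v t) = residue x * \<epsilon> v"
  and eps_pos: "0 < s \<Longrightarrow> v \<in> FC 0 s \<Longrightarrow> \<epsilon> v = 0"
  and eps_surj: "\<exists>v\<in>FM 0. \<epsilon> v = c"
  and exact_0: "v \<in> FM 0 \<Longrightarrow> \<epsilon> v = 0 \<longleftrightarrow> v \<in> d 0 ` FM 1"
  and exact_Suc: "v \<in> FM (Suc i) \<Longrightarrow> d i v = (\<lambda>_. 0) \<longleftrightarrow> v \<in> d (Suc i) ` FM (Suc (Suc i))"
proof -
  note R1 = conjunct2[OF res[unfolded free_resolution_def]]
  note R2 = conjunct2[OF R1] note R3 = conjunct2[OF R2] note R4 = conjunct2[OF R3]
  note R5 = conjunct2[OF R4] note R6 = conjunct2[OF R5]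
  show "u \<in> FM 0 \<Longrightarrow> v \<in> FM 0 \<Longrightarrow> \<epsilon> (\<lambda>t. u t + v t) = \<epsilon> u + \<epsilon> v" using conjunct1[OF R1] by simp
  show "v \<in> FM 0 \<Longrightarrow> \<epsilon> (\<lambda>t. x * v t) = residue x * \<epsilon> v" using conjunct1[OF R2] by simp
  show "0 < s \<Longrightarrow> v \<in> FC 0 s \<Longrightarrow> \<epsilon> v = 0" using conjunct1[OF R3] by simp
  show "\<exists>v\<in>FM 0. \<epsilon> v = c" using conjunct1[OF R4] by (metis UNIV_I imageE)
  show "v \<in> FM 0 \<Longrightarrow> \<epsilon> v = 0 \<longleftrightarrow> v \<in> d 0 ` FM 1" using conjunct1[OF R5] by simp
  show "v \<in> FM (Suc i) \<Longrightarrow> d i v = (\<lambda>_. 0) \<longleftrightarrow> v \<in> d (Suc i) ` FM (Suc (Suc i))"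
    using spec[OF R6, of i] by simp
qed

lemma eps_lin_comb:
  assumes "finite T" "\<And>c. c \<in> T \<Longrightarrow> f c \<in> FM 0"
  shows "\<epsilon> (\<lambda>t. \<Sum>c\<in>T. x c * f c t) = (\<Sum>c\<in>T. residue (x c) * \<epsilon> (f c))"
  using assms
proof (induction T rule: finite_induct)
  case empty
  show ?case using eps_mult[of "\<lambda>_. 0" 0] by simp
next
  case (insert c T)
  have 1: "(\<lambda>t. x c * f c t) \<in> FM 0" using insert.prems by (simp add: free_module_def)
  have 2: "(\<lambda>t. \<Sum>c\<in>T. x c * f c t) \<in> FM 0" using insert.prems by (intro free_module_lin_comb) auto
  have "\<epsilon> (\<lambda>t. \<Sum>c\<in>insert c T. x c * f c t) = \<epsilon> (\<lambda>t. x c * f c t + (\<Sum>c\<in>T. x c * f c t))"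
    using insert.hyps by simp
  then show ?case using eps_add[OF 1 2] eps_mult insert by simp
qed

section \<open>Homogeneous components in the resolution\<close>

definition hproj :: "nat \<Rightarrow> nat \<Rightarrow> (nat \<Rightarrow> 'a) \<Rightarrow> nat \<Rightarrow> 'a" where
  "hproj i s v t = (if e i t \<le> s then gcomp (v t) (s - e i t) else 0)"

lemma hproj_FC: "v \<in> FM i \<Longrightarrow> hproj i s v \<in> FC i s"
  by (auto simp: FC_iff hproj_def gcomp(1) free_module_def)

lemma hproj_homog:
  assumes "v \<in> FC i s"
  shows "hproj i s' v = (if s' = s then v else (\<lambda>_. 0))"
proof
  fix t
  show "hproj i s' v t = (if s' = s then v else (\<lambda>_. 0)) t"
  proof (cases "t < r i")
    case True
    then have "if e i t \<le> s then v t \<in> A (s - e i t) else v t = 0" using assms by (simp add: FC_iff)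
    then show ?thesis by (auto simp: hproj_def gcomp_homog split: if_splits)
  next
    case False
    then have "v t = 0" using assms by (simp add: FC_iff free_module_def)
    then show ?thesis by (simp add: hproj_def)
  qed
qed

lemma hproj_sum: "hproj i s (\<lambda>t. \<Sum>c\<in>T. f c t) = (\<lambda>t. \<Sum>c\<in>T. hproj i s (f c) t)"
  by (rule ext) (simp add: hproj_def gcomp_sum)

lemma hproj_expand:
  assumes v: "v \<in> FM i"
  shows "\<exists>S. finite S \<and> s0 \<in> S \<and> v = (\<lambda>t. \<Sum>s\<in>S. hproj i s v t)"
proof -
  define S where "S = insert s0 (\<Union>t<r i. (+) (e i t) ` {j. gcomp (v t) j \<noteq> 0})"
  have fin: "finite S" unfolding S_def using gcomp(2) by simp
  have "v t = (\<Sum>s\<in>S. hproj i s v t)" for t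
  proof (cases "t < r i")
    case True
    let ?G = "(+) (e i t) ` {j. gcomp (v t) j \<noteq> 0}"
    have sub: "?G \<subseteq> S" unfolding S_def using True by blast
    have "(\<Sum>s\<in>S. hproj i s v t) = (\<Sum>s\<in>?G. hproj i s v t)"
    proof (rule sum.mono_neutral_right[OF fin sub], intro ballI)
      fix s assume s: "s \<in> S - ?G"
      show "hproj i s v t = 0"
      proof (cases "e i t \<le> s")
        case True
        then have "s = e i t + (s - e i t)" by simp
        then have "gcomp (v t) (s - e i t) = 0" using s by (metis (mono_tags) DiffD2 image_eqI mem_Collect_eq)
        then show ?thesis by (simp add: hproj_def)
      qed (simp add: hproj_def)
    qed
    also have "\<dots> = (\<Sum>j | gcomp (v t) j \<noteq> 0. gcomp (v t) j)"
      by (subst sum.reindex) (auto simp: hproj_def)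
    finally show ?thesis using gcomp(3)[of "v t"] by simp
  next
    case False
    then have vt: "v t = 0" using v by (simp add: free_module_def)
    then have "hproj i s v t = 0" for s by (simp add: hproj_def)
    then show ?thesis using vt by simp
  qed
  then have "v = (\<lambda>t. \<Sum>s\<in>S. hproj i s v t)" by (rule ext)
  moreover have "s0 \<in> S" by (simp add: S_def)
  ultimately show ?thesis using fin by blast
qed

lemma d_hproj:
  assumes v: "v \<in> FM (Suc i)"
  shows "d i (hproj (Suc i) s v) = hproj i s (d i v)"
proof -
  obtain S where S: "finite S" "s \<in> S" "v = (\<lambda>t. \<Sum>s\<in>S. hproj (Suc i) s v t)"
    using hproj_expand[OF v, of s] by blast
  have "d i v = d i (\<lambda>t. \<Sum>s\<in>S. hproj (Suc i) s v t)" using S(3) by (rule arg_cong)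
  also have "\<dots> = (\<lambda>t. \<Sum>s\<in>S. d i (hproj (Suc i) s v) t)"
    using d_lin_comb[OF S(1) FC_FM[OF hproj_FC[OF v]], where x = "\<lambda>_. 1"] by simp
  finally have "d i v = (\<lambda>t. \<Sum>s\<in>S. d i (hproj (Suc i) s v) t)" .
  then have "hproj i s (d i v) = (\<lambda>t. \<Sum>s'\<in>S. hproj i s (d i (hproj (Suc i) s' v)) t)"
    by (simp add: hproj_sum)
  also have "\<dots> = (\<lambda>t. \<Sum>s'\<in>S. if s = s' then d i (hproj (Suc i) s' v) t else 0)"
    using hproj_homog[OF d_FC[OF hproj_FC[OF v]]] by (intro ext sum.cong) auto
  also have "\<dots> = d i (hproj (Suc i) s v)" using S by simp
  finally show ?thesis by simp
qed

text \<open>Exactness is given without regard to degrees; projecting a preimage to degree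
  \<open>s\<close> gives a homogeneous one because \<open>d\<close> commutes with
  \<open>hproj\<close>.\<close>

lemma exact_graded:
  assumes "v \<in> FC a s" "case a of 0 \<Rightarrow> \<epsilon> v = 0 | Suc a' \<Rightarrow> d a' v = (\<lambda>_. 0)"
  shows "\<exists>u\<in>FC (Suc a) s. d a u = v"
proof -
  have "v \<in> d a ` FM (Suc a)"
    using assms FC_FM[OF assms(1)] exact_0[of v] exact_Suc[of v] by (auto split: nat.splits)
  then obtain u where u: "u \<in> FM (Suc a)" "v = d a u" by blast
  have "d a (hproj (Suc a) s u) = v"
    using d_hproj[OF u(1)] hproj_homog[OF assms(1)] u(2) by simp
  then show ?thesis using hproj_FC[OF u(1)] by blast
qed

lemma d_d: "u \<in> FM (Suc (Suc i)) \<Longrightarrow> d i (d (Suc i) u) = (\<lambda>_. 0)"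
  using exact_Suc[of "d (Suc i) u" i] d_FM by blast

lemma eps_d: "u \<in> FM 1 \<Longrightarrow> \<epsilon> (d 0 u) = 0"
  using exact_0[of "d 0 u"] d_FM[of u 0] by auto

definition submod :: "(nat \<Rightarrow> 'a) set \<Rightarrow> nat \<Rightarrow> bool" where
  "submod Z p \<longleftrightarrow> Z \<subseteq> free_module p \<and>
     (\<forall>T x f. finite T \<longrightarrow> (\<forall>c\<in>T. f c \<in> Z) \<longrightarrow> (\<lambda>t. \<Sum>c\<in>(T :: nat set). x c * f c t) \<in> Z)"

text \<open>
  For a graded submodule \<open>Z\<close> of \<open>R\<^sup>p\<close>, the homology of \<open>F \<otimes> Z\<close> in homological degree \<open>a\<close> is
  \<open>Tor\<^sub>a(k, Z)\<close>. An element of \<open>F\<^sub>a \<otimes> Z\<close> is a matrix \<open>\<xi>\<close> with rows in \<open>Z\<close> and columns in \<open>F\<^sub>a\<close>.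
\<close>

definition tor_vanishes :: "(nat \<Rightarrow> 'a) set \<Rightarrow> bool" where
  "tor_vanishes Z \<longleftrightarrow> (\<forall>a s \<xi>. s \<noteq> Suc a \<longrightarrow> (\<forall>c. (\<lambda>t. \<xi> t c) \<in> FC a s) \<longrightarrow> (\<forall>t. \<xi> t \<in> Z) \<longrightarrow>
     (\<forall>c a'. a = Suc a' \<longrightarrow> d a' (\<lambda>t. \<xi> t c) = (\<lambda>_. 0)) \<longrightarrow>
     (\<exists>\<eta>. (\<forall>c. (\<lambda>t. \<eta> t c) \<in> FC (Suc a) s) \<and> (\<forall>t. \<eta> t \<in> Z) \<and> (\<forall>c. d a (\<lambda>t. \<eta> t c) = (\<lambda>t. \<xi> t c))))"

text \<open>The properties passed on from one syzygy module to the next. Degrees are those of the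
  coordinates, without shifts, so every syzygy module is renormalised to have its generators in
  degree one.\<close>

definition linear_syzygy :: "(nat \<Rightarrow> 'a) set \<Rightarrow> nat \<Rightarrow> bool" where
  "linear_syzygy Z p \<longleftrightarrow> submod Z p \<and> (\<forall>z\<in>Z. (\<forall>c. z c \<in> A 0) \<longrightarrow> z = (\<lambda>_. 0)) \<and> tor_vanishes Z"

text \<open>By \<open>linear_generation\<close> such a family is a minimal system of generators of a
  linear syzygy module, and its length is a Betti number.\<close>

definition linear_basis :: "(nat \<Rightarrow> 'a) set \<Rightarrow> nat \<Rightarrow> (nat \<Rightarrow> nat \<Rightarrow> 'a) \<Rightarrow> bool" where
  "linear_basis Z q \<Gamma> \<longleftrightarrow> (\<forall>c<q. \<Gamma> c \<in> Z \<and> (\<forall>t. \<Gamma> c t \<in> A 1)) \<and>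
     (\<forall>z\<in>Z. (\<forall>t. z t \<in> A 1) \<longrightarrow> (\<exists>k. z = (\<lambda>t. \<Sum>c<q. scale (k c) (\<Gamma> c t)))) \<and>
     (\<forall>k. (\<lambda>t. \<Sum>c<q. scale (k c) (\<Gamma> c t)) = (\<lambda>_. 0) \<longrightarrow> (\<forall>c<q. k c = 0))"

definition syzygies :: "nat \<Rightarrow> (nat \<Rightarrow> nat \<Rightarrow> 'a) \<Rightarrow> (nat \<Rightarrow> 'a) set" where
  "syzygies q \<Gamma> = {v \<in> free_module q. \<forall>t. (\<Sum>c<q. v c * \<Gamma> c t) = 0}"

lemma eps_expand:
  assumes "v \<in> FM 0"
  shows "\<epsilon> v = (\<Sum>t<r 0. residue (v t) * \<epsilon> (unit_vec t))"
proof -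
  have "\<epsilon> v = \<epsilon> (\<lambda>u. \<Sum>t<r 0. v t * unit_vec t u)" using free_module_expand[OF assms] by simp
  also have "\<dots> = (\<Sum>t<r 0. residue (v t) * \<epsilon> (unit_vec t))"
    by (rule eps_lin_comb) (simp_all add: unit_vec_free)
  finally show ?thesis .
qed

text \<open>This is Tor_a(k, m) = Tor_(a+1)(k, k). A cycle \<open>v\<close> with coefficients in m
  equals \<open>d a u\<close> by exactness. Then \<open>u\<close> is a cycle modulo m, so outside
  degree a + 1 the Koszul condition makes it a boundary modulo m; subtracting that boundary leaves a
  preimage of \<open>v\<close> with coefficients in m.\<close>

lemma linear_syzygy_irrelevant: "linear_syzygy {v \<in> free_module 1. v 0 \<in> irrelevant} 1"
proof -
  let ?Z = "{v \<in> free_module 1. v 0 \<in> irrelevant}"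
  have sub: "submod ?Z 1"
    unfolding submod_def
  proof (intro conjI allI impI)
    fix T :: "nat set" and x f assume T: "\<forall>c\<in>T. f c \<in> ?Z"
    have "gcomp (x c * f c 0) 0 = 0" if "c \<in> T" for c
    proof -
      have "residue (f c 0) = 0" using T that residue_0_iff by simp
      have "gcomp (x c * f c 0) 0 = (\<Sum>i | gcomp (x c) i \<noteq> 0. gcomp (gcomp (x c) i * f c 0) 0)"
        by (subst gcomp(3)[of "x c"]) (simp add: sum_distrib_right gcomp_sum)
      also have "\<dots> = 0"
        using gcomp_mult[OF gcomp(1)] \<open>residue (f c 0) = 0\<close> gcomp_0_residue[of "f c 0"]
        by (intro sum.neutral) auto
      finally show ?thesis .
    qed
    then have "(\<Sum>c\<in>T. x c * f c 0) \<in> irrelevant"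
      unfolding irrelevant_iff by (simp add: gcomp_sum)
    moreover have "(\<lambda>t. \<Sum>c\<in>T. x c * f c t) \<in> free_module 1"
      using T by (intro free_module_lin_comb) blast
    ultimately show "(\<lambda>t. \<Sum>c\<in>T. x c * f c t) \<in> ?Z" by simp
  qed blast
  have deg0: "z = (\<lambda>_. 0)" if "z \<in> ?Z" "\<forall>c. z c \<in> A 0" for z
  proof
    fix c show "z c = 0"
      using that irrelevant_A0[of "z 0"] by (cases c) (auto simp: free_module_def)
  qed
  have "tor_vanishes ?Z"
    unfolding tor_vanishes_def
  proof (intro allI impI)
    fix a s \<xi>
    assume s: "s \<noteq> Suc a" and col: "\<forall>c. (\<lambda>t. \<xi> t c) \<in> FC a s" and row: "\<forall>t. \<xi> t \<in> ?Z"
      and cyc: "\<forall>c a'. a = Suc a' \<longrightarrow> d a' (\<lambda>t. \<xi> t c) = (\<lambda>_. 0)"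
    define v where "v = (\<lambda>t. \<xi> t 0)"
    have v: "v \<in> FC a s" "\<And>t. v t \<in> irrelevant" using col row by (auto simp: v_def)
    have \<xi>: "\<xi> t c = (if c = 0 then v t else 0)" for t c
      using row by (cases c) (auto simp: v_def free_module_def)
    have "\<epsilon> v = 0" if "a = 0"
      using eps_expand[of v] FC_FM[OF v(1)] that residue_0_iff[THEN iffD2, OF v(2)] by simp
    moreover have "d a' v = (\<lambda>_. 0)" if "a = Suc a'" for a' using cyc that unfolding v_def by blast
    ultimately have "case a of 0 \<Rightarrow> \<epsilon> v = 0 | Suc a' \<Rightarrow> d a' v = (\<lambda>_. 0)" by (cases a) simp_all
    from exact_graded[OF v(1) this] obtain u where u: "u \<in> FC (Suc a) s" "d a u = v" by blast
    have "u \<in> tor_cycles r e d (Suc a) s"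
      using u v FC_FM[OF v(1)] by (simp add: tor_cycles_def irrelevant_free_def)
    then have "u \<in> tor_boundaries r e d (Suc a) s" using tor s by metis
    then obtain u' where u': "u' \<in> FC (Suc (Suc a)) s" "(\<lambda>t. u t - d (Suc a) u' t) \<in> irrelevant_free (r (Suc a))"
      unfolding tor_boundaries_def by blast
    define w where "w = (\<lambda>t. u t - d (Suc a) u' t)"
    have w: "w \<in> FC (Suc a) s" unfolding w_def by (rule FC_diff[OF u(1) d_FC[OF u'(1)]])
    have dw: "d a w = v"
      unfolding w_def using d_diff[OF FC_FM[OF u(1)] d_FM[OF FC_FM[OF u'(1)]]] u d_d[OF FC_FM[OF u'(1)]] by simp
    have wi: "w t \<in> irrelevant" for t
      using u'(2) FC_FM[OF w] residue_0_iff[of 0] unfolding w_def[symmetric] irrelevant_free_def free_module_def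
      by (cases "t < r (Suc a)") auto
    define \<eta> where "\<eta> t c = (if c = 0 then w t else 0)" for t and c :: nat
    have "(\<lambda>t. \<eta> t c) \<in> FC (Suc a) s" for c using w by (cases "c = 0") (simp_all add: \<eta>_def)
    moreover have "\<eta> t \<in> ?Z" for t using wi by (simp add: \<eta>_def free_module_def)
    moreover have "d a (\<lambda>t. \<eta> t c) = (\<lambda>t. \<xi> t c)" for c
      using dw by (cases "c = 0") (simp_all add: \<eta>_def \<xi>)
    ultimately show "\<exists>\<eta>. (\<forall>c. (\<lambda>t. \<eta> t c) \<in> FC (Suc a) s) \<and> (\<forall>t. \<eta> t \<in> ?Z)
        \<and> (\<forall>c. d a (\<lambda>t. \<eta> t c) = (\<lambda>t. \<xi> t c))" by blast
  qed
  then show ?thesis using sub deg0 by (auto simp: linear_syzygy_def)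
qed

text \<open>A lift of \<open>\<epsilon>\<close> to a linear map from F_0 to the algebra itself,
  sending basis vectors to scalars. It preserves degrees because \<open>\<epsilon>\<close> vanishes
  on basis vectors of positive degree, and it turns elements of F_0 \<otimes> Z back into elements
  of Z.\<close>

definition aug :: "(nat \<Rightarrow> 'a) \<Rightarrow> 'a" where
  "aug v = (\<Sum>t<r 0. v t * scale (\<epsilon> (unit_vec t)) 1)"

lemma residue_aug: "v \<in> FM 0 \<Longrightarrow> residue (aug v) = \<epsilon> v"
  unfolding aug_def using eps_expand[of v]
  by (simp add: residue_sum scale_mult_right[symmetric] residue_scale mult.commute)

lemma unit_vec_FC: "t < r i \<Longrightarrow> unit_vec t \<in> FC i (e i t)"
  by (auto simp: FC_iff unit_vec_free unit_vec_def one_A0)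

lemma aug_A: assumes "v \<in> FC 0 s" shows "aug v \<in> A s"
  unfolding aug_def
proof (rule A_sum)
  fix t assume "t \<in> {..<r 0}"
  then have t: "t < r 0" by simp
  show "v t * scale (\<epsilon> (unit_vec t)) 1 \<in> A s"
  proof (cases "e 0 t = 0")
    case True
    then have "v t \<in> A s" using assms t by (auto simp: FC_iff dest: spec[of _ t])
    then show ?thesis using A_scale by (simp add: scale_mult_right[symmetric])
  next
    case False
    then have "\<epsilon> (unit_vec t) = 0" using eps_pos[OF _ unit_vec_FC[OF t]] by simp
    then show ?thesis by simp
  qed
qed

lemma aug_lin_comb: "aug (\<lambda>t. \<Sum>c\<in>T. x c * f c t) = (\<Sum>c\<in>T. x c * aug (f c))"
  unfolding aug_def sum_distrib_left sum_distrib_right by (subst sum.swap) (simp add: mult.assoc)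

lemma aug_one: "\<exists>v\<in>FC 0 0. aug v = 1"
proof -
  obtain v where v: "v \<in> FM 0" "\<epsilon> v = 1" using eps_surj by blast
  obtain S where S: "finite S" "0 \<in> S" "v = (\<lambda>t. \<Sum>s\<in>S. hproj 0 s v t)"
    using hproj_expand[OF v(1), of 0] by blast
  have FM: "hproj 0 s v \<in> FM 0" for s using hproj_FC[OF v(1)] FC_FM by blast
  have "\<epsilon> v = \<epsilon> (\<lambda>t. \<Sum>s\<in>S. hproj 0 s v t)" using S(3) by (rule arg_cong)
  also have "\<dots> = (\<Sum>s\<in>S. \<epsilon> (hproj 0 s v))"
    using eps_lin_comb[OF S(1) FM, where x = "\<lambda>_. 1"] by simp
  also have "\<dots> = \<epsilon> (hproj 0 0 v)"
    using eps_pos[OF _ hproj_FC[OF v(1)]] S(1,2) by (subst sum.remove[of _ 0]) (auto intro!: sum.neutral)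
  finally have "residue (aug (hproj 0 0 v)) = 1" using v(2) residue_aug[OF FM] by simp
  then have "aug (hproj 0 0 v) = 1" using residue_A0[OF aug_A[OF hproj_FC[OF v(1)]]] by simp
  then show ?thesis using hproj_FC[OF v(1)] by blast
qed

lemma submod_lin_comb:
  "submod Z p \<Longrightarrow> finite T \<Longrightarrow> (\<And>c. c \<in> T \<Longrightarrow> f c \<in> Z) \<Longrightarrow> (\<lambda>t. \<Sum>c\<in>(T :: nat set). x c * f c t) \<in> Z"
  by (simp add: submod_def)

lemma submod_scale: "submod Z p \<Longrightarrow> z \<in> Z \<Longrightarrow> (\<lambda>t. x * z t) \<in> Z"
  using submod_lin_comb[of Z p "{0}" "\<lambda>_. z" "\<lambda>_. x"] by simp

lemma submod_zero: "submod Z p \<Longrightarrow> (\<lambda>_. 0) \<in> Z"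
  using submod_lin_comb[of Z p "{}"] by simp

text \<open>\<open>Tor\<^sub>0(k, Z) = Z / \<mm>Z\<close> is concentrated in degree one, so Nakayama's lemma applies.\<close>

lemma linear_generation:
  assumes Z: "linear_syzygy Z p" and \<Gamma>: "linear_basis Z q \<Gamma>"
  shows "z \<in> Z \<Longrightarrow> (\<And>c. z c \<in> A (Suc s)) \<Longrightarrow>
    \<exists>x. x \<in> free_module q \<and> (\<forall>c. x c \<in> A s) \<and> z = (\<lambda>t. \<Sum>c<q. x c * \<Gamma> c t)"
proof (induction s arbitrary: z rule: less_induct)
  case (less s z)
  have sub: "submod Z p" and tv: "tor_vanishes Z" and deg0: "\<And>z. z \<in> Z \<Longrightarrow> (\<And>c. z c \<in> A 0) \<Longrightarrow> z = (\<lambda>_. 0)"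
    using Z by (auto simp: linear_syzygy_def)
  show ?case
  proof (cases "s = 0")
    case True
    then obtain k where "z = (\<lambda>t. \<Sum>c<q. scale (k c) (\<Gamma> c t))"
      using \<Gamma> less.prems unfolding linear_basis_def by (metis One_nat_def)
    then show ?thesis
      using True A_scale[OF one_A0]
      by (intro exI[of _ "\<lambda>c. if c < q then scale (k c) 1 else 0"]) (auto simp: free_module_def scale_one_mult)
  next
    case False
    obtain v where v: "v \<in> FC 0 0" "aug v = 1" using aug_one by blast
    \<comment> \<open>The tensor of \<open>v\<close> and \<open>z\<close> has degree
      \<open>Suc s\<close>, which is not 1, so the vanishing of Tor_0 makes it a boundary. Applying
      \<open>aug\<close> then writes \<open>z\<close> as a combination of rows
      \<open>\<eta> u\<close> in \<open>Z\<close> with coefficients \<open>m u\<close> in the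
      irrelevant ideal.\<close>
    define \<xi> where "\<xi> t c = v t * z c" for t c
    have "(\<lambda>t. \<xi> t c) \<in> FC 0 (Suc s)" for c
      using FC_lin_comb[of "{c}" z "Suc s" "\<lambda>_. v" 0 0] v(1) less.prems(2)
      by (simp add: \<xi>_def mult.commute)
    moreover have "\<xi> t \<in> Z" for t unfolding \<xi>_def using submod_scale[OF sub less.prems(1)] by simp
    ultimately obtain \<eta> where \<eta>: "\<And>c. (\<lambda>t. \<eta> t c) \<in> FC 1 (Suc s)" "\<And>t. \<eta> t \<in> Z"
        "\<And>c. d 0 (\<lambda>t. \<eta> t c) = (\<lambda>t. \<xi> t c)"
      using tv[unfolded tor_vanishes_def, rule_format, of "Suc s" 0 \<xi>] False by auto
    define m where "m u = aug (d 0 (unit_vec u))" for u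
    have mA: "m u \<in> A (e 1 u)" and mr: "residue (m u) = 0" if "u < r 1" for u
    proof -
      have u: "unit_vec u \<in> FC (Suc 0) (e 1 u)" using unit_vec_FC[of u 1] that by simp
      show "m u \<in> A (e 1 u)" unfolding m_def using aug_A[OF d_FC[OF u]] .
      have "unit_vec u \<in> FM 1" using unit_vec_free that .
      then show "residue (m u) = 0"
        unfolding m_def using residue_aug[OF d_FM[of "unit_vec u" 0]] eps_d by simp
    qed
    have zc: "z c = (\<Sum>u<r 1. \<eta> u c * m u)" for c
    proof -
      have fm: "(\<lambda>t. \<eta> t c) \<in> FM 1" using \<eta>(1) FC_FM by blast
      have uf: "unit_vec u \<in> FM (Suc 0)" if "u \<in> {..<r 1}" for u using unit_vec_free that by simp
      have "d 0 (\<lambda>t. \<eta> t c) = d 0 (\<lambda>t. \<Sum>u<r 1. \<eta> u c * unit_vec u t)" using free_module_expand[OF fm] by simp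
      also have "\<dots> = (\<lambda>t. \<Sum>u<r 1. \<eta> u c * d 0 (unit_vec u) t)"
        using d_lin_comb[OF finite_lessThan uf] by simp
      finally have "aug (\<lambda>t. \<xi> t c) = (\<Sum>u<r 1. \<eta> u c * m u)"
        using \<eta>(3) by (simp add: m_def aug_lin_comb)
      moreover have "aug (\<lambda>t. \<xi> t c) = z c * aug v"
        using aug_lin_comb[of "\<lambda>_. z c" "\<lambda>_. v" "{c}"] by (simp add: \<xi>_def mult.commute)
      ultimately show ?thesis using v(2) by simp
    qed
    have "\<exists>x. x \<in> free_module q \<and> (\<forall>c. x c \<in> A s) \<and> (\<lambda>t. \<eta> u t * m u) = (\<lambda>t. \<Sum>c<q. x c * \<Gamma> c t)"
      if u: "u < r 1" for u
    proof -
      have \<eta>A: "if e 1 u \<le> Suc s then \<eta> u c \<in> A (Suc s - e 1 u) else \<eta> u c = 0" for c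
        using \<eta>(1)[of c] u by (simp add: FC_iff)
      \<comment> \<open>For \<open>e 1 u = 0\<close> the coefficient \<open>m u\<close> is a scalar
        with residue 0; for \<open>e 1 u \<ge> Suc s\<close> the row vanishes since \<open>Z\<close>
        has nothing in degree 0; otherwise the row has smaller degree than \<open>z\<close>.\<close>
      consider "e 1 u = 0" | "e 1 u > Suc s" | "e 1 u = Suc s" | "0 < e 1 u" "e 1 u \<le> s" by linarith
      then show ?thesis
      proof cases
        case 1
        then have "m u = 0" using mA[OF u] mr[OF u] residue_A0[of "m u"] by simp
        then show ?thesis by (intro exI[of _ "\<lambda>_. 0"]) simp
      next
        case 2
        then have "\<eta> u = (\<lambda>_. 0)" using \<eta>A by (auto split: if_splits)
        then show ?thesis by (intro exI[of _ "\<lambda>_. 0"]) simp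
      next
        case 3
        then have "\<eta> u = (\<lambda>_. 0)" using \<eta>A by (intro deg0[OF \<eta>(2)]) (auto split: if_splits)
        then show ?thesis by (intro exI[of _ "\<lambda>_. 0"]) simp
      next
        case 4
        then have e: "Suc s - e 1 u = Suc (s - e 1 u)" "s - e 1 u < s" by auto
        then have "\<eta> u c \<in> A (Suc (s - e 1 u))" for c using \<eta>A[of c] 4 by simp
        from less.IH[OF e(2) \<eta>(2) this] obtain x where x: "x \<in> free_module q" "\<And>c. x c \<in> A (s - e 1 u)"
            "\<eta> u = (\<lambda>t. \<Sum>c<q. x c * \<Gamma> c t)" by blast
        have "m u * x c \<in> A s" for c using mult_comp[OF mA[OF u] x(2)] 4 by simp
        moreover have "(\<lambda>t. \<eta> u t * m u) = (\<lambda>t. \<Sum>c<q. (m u * x c) * \<Gamma> c t)"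
          unfolding x(3) by (simp add: sum_distrib_left mult_ac)
        moreover have "(\<lambda>c. m u * x c) \<in> free_module q" using x(1) by (simp add: free_module_def)
        ultimately show ?thesis by blast
      qed
    qed
    then obtain x where x: "\<And>u. u < r 1 \<Longrightarrow> x u \<in> free_module q \<and> (\<forall>c. x u c \<in> A s)
        \<and> (\<lambda>t. \<eta> u t * m u) = (\<lambda>t. \<Sum>c<q. x u c * \<Gamma> c t)" by metis
    define y where "y c = (\<Sum>u<r 1. x u c)" for c
    have "y \<in> free_module q" unfolding free_module_def
    proof (intro CollectI allI impI)
      fix c assume "q \<le> c"
      then show "y c = 0" unfolding y_def using x by (intro sum.neutral) (auto simp: free_module_def)
    qed
    moreover have "\<forall>c. y c \<in> A s" unfolding y_def using x by (auto intro!: A_sum)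
    moreover have "z = (\<lambda>t. \<Sum>c<q. y c * \<Gamma> c t)"
    proof
      fix t
      have "z t = (\<Sum>u<r 1. \<Sum>c<q. x u c * \<Gamma> c t)"
        unfolding zc using x by (intro sum.cong refl) (meson fun_cong lessThan_iff)
      also have "\<dots> = (\<Sum>c<q. y c * \<Gamma> c t)"
        by (subst sum.swap) (simp add: y_def sum_distrib_right)
      finally show "z t = (\<Sum>c<q. y c * \<Gamma> c t)" .
    qed
    ultimately show ?thesis by blast
  qed
qed

text \<open>Dimension shifting along 0 -> Z' -> R^q -> Z -> 0: Tor_a(k, Z') in degree
  \<open>s\<close> comes from Tor_(a+1)(k, Z) in degree \<open>s + 1\<close>, the generators having
  degree one. The proof is the diagram chase for the connecting map, on matrices with columns in the
  resolution and rows in the modules.\<close>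

lemma linear_syzygy_step:
  assumes Z: "linear_syzygy Z p" and \<Gamma>: "linear_basis Z q \<Gamma>"
  shows "linear_syzygy (syzygies q \<Gamma>) q"
proof -
  have subZ: "submod Z p" and tv: "tor_vanishes Z" and deg0: "\<And>z. z \<in> Z \<Longrightarrow> (\<And>c. z c \<in> A 0) \<Longrightarrow> z = (\<lambda>_. 0)"
    using Z by (auto simp: linear_syzygy_def)
  have \<Gamma>Z: "\<Gamma> c \<in> Z" and \<Gamma>A: "\<Gamma> c t \<in> A 1" if "c < q" for c t
    using \<Gamma> that by (auto simp: linear_basis_def)
  have sub: "submod (syzygies q \<Gamma>) q"
    unfolding submod_def
  proof (intro conjI allI impI)
    show "syzygies q \<Gamma> \<subseteq> free_module q" by (auto simp: syzygies_def)
    fix T :: "nat set" and x f assume T: "\<forall>u\<in>T. f u \<in> syzygies q \<Gamma>"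
    have "(\<Sum>c<q. (\<Sum>u\<in>T. x u * f u c) * \<Gamma> c t) = 0" for t
    proof -
      have "(\<Sum>c<q. (\<Sum>u\<in>T. x u * f u c) * \<Gamma> c t) = (\<Sum>u\<in>T. x u * (\<Sum>c<q. f u c * \<Gamma> c t))"
        unfolding sum_distrib_left sum_distrib_right by (subst sum.swap) (simp add: mult.assoc)
      then show ?thesis using T by (simp add: syzygies_def)
    qed
    moreover have "(\<lambda>t. \<Sum>u\<in>T. x u * f u t) \<in> free_module q"
      using T by (intro free_module_lin_comb) (auto simp: syzygies_def)
    ultimately show "(\<lambda>t. \<Sum>u\<in>T. x u * f u t) \<in> syzygies q \<Gamma>" by (simp add: syzygies_def)
  qed
  have deg0': "z = (\<lambda>_. 0)" if z: "z \<in> syzygies q \<Gamma>" "\<forall>c. z c \<in> A 0" for z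
  proof -
    have zs: "z c = scale (residue (z c)) 1" for c using residue_A0 z(2) by blast
    have "(\<Sum>c<q. scale (residue (z c)) (\<Gamma> c t)) = (\<Sum>c<q. z c * \<Gamma> c t)" for t
      by (intro sum.cong refl) (subst (2) zs, simp add: scale_one_mult)
    then have "(\<lambda>t. \<Sum>c<q. scale (residue (z c)) (\<Gamma> c t)) = (\<lambda>_. 0)"
      using z(1) by (simp add: syzygies_def)
    then have "\<forall>c<q. residue (z c) = 0"
      by (rule mp[OF spec[OF conjunct2[OF conjunct2[OF \<Gamma>[unfolded linear_basis_def]]], of "\<lambda>c. residue (z c)"]])
    then have r0: "residue (z c) = 0" if "c < q" for c using that by simp
    show ?thesis
    proof
      fix c show "z c = 0"
        using zs[of c] r0[of c] z(1) by (cases "c < q") (auto simp: syzygies_def free_module_def)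
    qed
  qed
  have "tor_vanishes (syzygies q \<Gamma>)"
    unfolding tor_vanishes_def
  proof (intro allI impI)
    fix a s \<xi>
    assume s: "s \<noteq> Suc a" and col: "\<forall>c. (\<lambda>t. \<xi> t c) \<in> FC a s" and row: "\<forall>t. \<xi> t \<in> syzygies q \<Gamma>"
      and cyc: "\<forall>c a'. a = Suc a' \<longrightarrow> d a' (\<lambda>t. \<xi> t c) = (\<lambda>_. 0)"
    have \<xi>q: "\<xi> t c = 0" if "q \<le> c" for t c using row that by (simp add: syzygies_def free_module_def)
    \<comment> \<open>Each column is lifted to F_(a+1). For \<open>a = 0\<close> this needs
      \<open>\<epsilon>\<close> to vanish on it, which holds in positive degree; in degree 0 the
      column itself is 0 by \<open>deg0'\<close>.\<close>
    have "\<exists>u. u \<in> FC (Suc a) s \<and> d a u = (\<lambda>t. \<xi> t c) \<and> (q \<le> c \<longrightarrow> u = (\<lambda>_. 0))" for c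
    proof (cases "q \<le> c \<or> (a = 0 \<and> s = 0)")
      case True
      have "\<xi> t c = 0" for t
      proof (cases "q \<le> c")
        case False
        then have as: "a = 0" "s = 0" using True by auto
        have "\<xi> t c' \<in> A 0" for c'
        proof -
          have "(\<lambda>t. \<xi> t c') \<in> FC 0 0" using col as by simp
          then show ?thesis by (cases "t < r 0") (auto simp: FC_iff free_module_def split: if_splits)
        qed
        then show ?thesis using deg0' row by metis
      qed (rule \<xi>q)
      then show ?thesis by (intro exI[of _ "\<lambda>_. 0"]) simp
    next
      case False
      then have "case a of 0 \<Rightarrow> \<epsilon> (\<lambda>t. \<xi> t c) = 0 | Suc a' \<Rightarrow> d a' (\<lambda>t. \<xi> t c) = (\<lambda>_. 0)"
        using cyc col eps_pos[of s "\<lambda>t. \<xi> t c"] by (auto split: nat.splits)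
      then show ?thesis using exact_graded col False by blast
    qed
    then obtain H where H: "\<And>c. H c \<in> FC (Suc a) s" "\<And>c. d a (H c) = (\<lambda>t. \<xi> t c)"
        "\<And>c. q \<le> c \<Longrightarrow> H c = (\<lambda>_. 0)" by metis
    \<comment> \<open>Pushing the lift along R^q -> Z gives a matrix over \<open>Z\<close> of degree
      \<open>Suc s\<close>; it is a cycle because the rows of \<open>\<xi>\<close> are
      syzygies.\<close>
    define \<xi>' where "\<xi>' t u = (\<Sum>c<q. \<Gamma> c u * H c t)" for t u
    have HF: "H c \<in> FM (Suc a)" for c using H(1) FC_FM by blast
    have 1: "(\<lambda>t. \<xi>' t u) \<in> FC (Suc a) (Suc s)" for u
      unfolding \<xi>'_def using FC_lin_comb[of "{..<q}" "\<lambda>c. \<Gamma> c u" 1 H "Suc a" s] \<Gamma>A H(1) by simp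
    have 2: "\<xi>' t \<in> Z" for t
      unfolding \<xi>'_def using submod_lin_comb[OF subZ, of "{..<q}" \<Gamma> "\<lambda>c. H c t"] \<Gamma>Z by (simp add: mult.commute)
    have 3: "d a (\<lambda>t. \<xi>' t u) = (\<lambda>_. 0)" for u
    proof -
      have "d a (\<lambda>t. \<xi>' t u) = (\<lambda>t. \<Sum>c<q. \<Gamma> c u * \<xi> t c)"
        unfolding \<xi>'_def using d_lin_comb[OF finite_lessThan HF] H(2) by simp
      then show ?thesis using row by (simp add: syzygies_def mult.commute)
    qed
    have "Suc s \<noteq> Suc (Suc a)" using s by simp
    from tv[unfolded tor_vanishes_def, rule_format, OF this, of \<xi>'] 1 2 3
    obtain \<eta> where \<eta>: "\<And>u. (\<lambda>t. \<eta> t u) \<in> FC (Suc (Suc a)) (Suc s)" "\<And>t. \<eta> t \<in> Z"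
        "\<And>u. d (Suc a) (\<lambda>t. \<eta> t u) = (\<lambda>t. \<xi>' t u)" by auto
    let ?e = "e (Suc (Suc a))" and ?r = "r (Suc (Suc a))"
    \<comment> \<open>The bounding matrix \<open>\<eta>\<close> is lifted row by row through the
      generators; \<open>Q\<close> pins the degree of each lifted row, so that the columns of the
      lift are homogeneous of degree \<open>s\<close>.\<close>
    define Q where "Q t x \<longleftrightarrow> x \<in> free_module q \<and> (\<forall>c. if ?e t \<le> s then x c \<in> A (s - ?e t) else x c = 0)
        \<and> (?r \<le> t \<longrightarrow> x = (\<lambda>_. 0)) \<and> \<eta> t = (\<lambda>u. \<Sum>c<q. x c * \<Gamma> c u)" for t x
    have "\<exists>x. Q t x" for t
    proof (cases "t < ?r \<and> ?e t \<le> s")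
      case True
      then have "\<eta> t c \<in> A (Suc (s - ?e t))" for c
        using \<eta>(1)[of c] by (auto simp: FC_iff Suc_diff_le)
      from linear_generation[OF Z \<Gamma> \<eta>(2) this] True show ?thesis by (auto simp: Q_def)
    next
      case False
      have "\<eta> t = (\<lambda>_. 0)"
      proof (rule deg0[OF \<eta>(2)])
        fix c
        show "\<eta> t c \<in> A 0"
        proof (cases "t < ?r")
          case True
          then have "if ?e t \<le> Suc s then \<eta> t c \<in> A (Suc s - ?e t) else \<eta> t c = 0"
            using \<eta>(1)[of c] by (simp add: FC_iff)
          moreover have "?e t \<le> Suc s \<Longrightarrow> Suc s - ?e t = 0" using False True by simp
          ultimately show ?thesis by (auto split: if_splits)
        next
          case False
          then have "\<eta> t c = 0" using FC_FM[OF \<eta>(1)[of c]] by (simp add: free_module_def)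
          then show ?thesis by simp
        qed
      qed
      then show ?thesis by (intro exI[of _ "\<lambda>_. 0"]) (simp add: Q_def)
    qed
    then obtain \<zeta> where "\<And>t. Q t (\<zeta> t)" by metis
    then have \<zeta>: "\<And>t. \<zeta> t \<in> free_module q"
        "\<And>t c. if ?e t \<le> s then \<zeta> t c \<in> A (s - ?e t) else \<zeta> t c = 0"
        "\<And>t. ?r \<le> t \<Longrightarrow> \<zeta> t = (\<lambda>_. 0)" "\<And>t. \<eta> t = (\<lambda>u. \<Sum>c<q. \<zeta> t c * \<Gamma> c u)"
      unfolding Q_def by auto
    have \<zeta>C: "(\<lambda>t. \<zeta> t c) \<in> FC (Suc (Suc a)) s" for c
      using \<zeta>(2,3) by (simp add: FC_iff free_module_def)
    have \<zeta>F: "(\<lambda>t. \<zeta> t c) \<in> FM (Suc (Suc a))" for c using FC_FM[OF \<zeta>C] .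
    \<comment> \<open>Subtracting the boundary of the lift does not change the image under
      \<open>d a\<close> and turns the rows into syzygies.\<close>
    define \<theta> where "\<theta> t c = H c t - d (Suc a) (\<lambda>t. \<zeta> t c) t" for t c
    have "(\<lambda>t. \<theta> t c) \<in> FC (Suc a) s" for c
      unfolding \<theta>_def by (rule FC_diff[OF H(1) d_FC[OF \<zeta>C]])
    moreover have "d a (\<lambda>t. \<theta> t c) = (\<lambda>t. \<xi> t c)" for c
      unfolding \<theta>_def using d_diff[OF HF d_FM[OF \<zeta>F]] d_d[OF \<zeta>F] H(2) by simp
    moreover have "\<theta> t \<in> syzygies q \<Gamma>" for t
    proof -
      have "\<theta> t c = 0" if "q \<le> c" for c
      proof -
        have "(\<lambda>t. \<zeta> t c) = (\<lambda>_. 0)" using \<zeta>(1) that by (auto simp: free_module_def)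
        then show ?thesis using H(3)[OF that] by (simp add: \<theta>_def)
      qed
      moreover have "(\<Sum>c<q. \<theta> t c * \<Gamma> c u) = 0" for u
      proof -
        have "(\<lambda>t. \<xi>' t u) = d (Suc a) (\<lambda>t. \<Sum>c<q. \<Gamma> c u * \<zeta> t c)"
          using \<eta>(3)[of u] \<zeta>(4) by (simp add: mult.commute)
        also have "\<dots> = (\<lambda>t. \<Sum>c<q. \<Gamma> c u * d (Suc a) (\<lambda>t. \<zeta> t c) t)"
          using d_lin_comb[OF finite_lessThan \<zeta>F] by simp
        finally have "\<xi>' t u = (\<Sum>c<q. \<Gamma> c u * d (Suc a) (\<lambda>t. \<zeta> t c) t)" by (rule fun_cong)
        then show ?thesis
          by (simp add: \<theta>_def \<xi>'_def right_diff_distrib sum_subtractf mult.commute)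
      qed
      ultimately show ?thesis by (simp add: syzygies_def free_module_def)
    qed
    ultimately show "\<exists>\<eta>. (\<forall>c. (\<lambda>t. \<eta> t c) \<in> FC (Suc a) s) \<and> (\<forall>t. \<eta> t \<in> syzygies q \<Gamma>)
        \<and> (\<forall>c. d a (\<lambda>t. \<eta> t c) = (\<lambda>t. \<xi> t c))" by blast
  qed
  then show ?thesis using sub deg0' by (auto simp: linear_syzygy_def)
qed

end

section \<open>Linear independence of indexed families\<close>

context vspace
begin

lemma family_span:
  assumes "x \<in> span (g ` {..<q::nat})"
  shows "\<exists>k. x = (\<Sum>c<q. scale (k c) (g c))"
  using assms
proof (induction rule: span_induct_alt)
  case base
  show ?case by (intro exI[of _ "\<lambda>_. 0"]) simp
next
  case (step a x y)
  then obtain i k where i: "i < q" "x = g i" and k: "y = (\<Sum>c<q. scale (k c) (g c))" by blast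
  have "(\<Sum>c<q. scale ((if c = i then a else 0) + k c) (g c))
      = (\<Sum>c<q. (if c = i then scale a (g i) else 0) + scale (k c) (g c))"
    by (intro sum.cong refl) (simp add: scale_left_distrib)
  also have "\<dots> = scale a x + y" using i k by (simp add: sum.distrib)
  finally show ?case by metis
qed

lemma family_independentD:
  assumes "inj_on g I" "independent (g ` I)" "finite I" "(\<Sum>c\<in>I. scale (k c) (g c)) = 0" "c \<in> I"
  shows "k c = 0"
proof -
  define k' where "k' v = k (the_inv_into I g v)" for v
  have "(\<Sum>v\<in>g ` I. scale (k' v) v) = (\<Sum>c\<in>I. scale (k c) (g c))"
    by (subst sum.reindex[OF assms(1)]) (simp add: k'_def the_inv_into_f_f[OF assms(1)])
  then have "k' (g c) = 0"
    using independentD[OF assms(2) finite_imageI[OF assms(3)] subset_refl, of k'] assms(4,5) by auto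
  then show ?thesis using assms by (simp add: k'_def the_inv_into_f_f)
qed

lemma family_card_le_dim:
  assumes V: "has_dim V d" and I: "finite I" and g: "\<And>i. i \<in> I \<Longrightarrow> g i \<in> V"
    and ind: "\<And>k. (\<Sum>i\<in>I. scale (k i) (g i)) = 0 \<Longrightarrow> \<forall>i\<in>I. k i = 0"
  shows "card I \<le> d"
proof -
  have inj: "inj_on g I"
  proof (rule inj_onI, rule ccontr)
    fix x y assume xy: "x \<in> I" "y \<in> I" "g x = g y" "x \<noteq> y"
    let ?k = "\<lambda>i. if i = x then 1 else if i = y then - 1 else (0 :: 'a)"
    have "(\<Sum>i\<in>I. scale (?k i) (g i)) = (\<Sum>i\<in>I. (if i = x then g x else 0) - (if i = y then g x else 0))"
      using xy by (intro sum.cong) auto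
    also have "\<dots> = 0" using xy I by (simp add: sum_subtractf)
    finally have "\<forall>i\<in>I. ?k i = 0" by (rule ind)
    then have "?k x = 0" using xy(1) by (rule bspec)
    then show False by simp
  qed
  have "independent (g ` I)"
  proof (rule independent_if_scalars_zero)
    fix f x assume f: "(\<Sum>x\<in>g ` I. scale (f x) x) = 0" and x: "x \<in> g ` I"
    have "(\<Sum>i\<in>I. scale (f (g i)) (g i)) = 0" using f by (simp add: sum.reindex[OF inj])
    then show "f x = 0" using ind[of "\<lambda>i. f (g i)"] x by blast
  qed (use I in simp)
  moreover obtain B where B: "finite B" "card B = d" "span B = V" using V has_dim_def by auto
  ultimately have "card (g ` I) \<le> card B" using g by (intro conjunct2[OF independent_span_bound]) auto
  then show ?thesis using B inj by (simp add: card_image)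
qed

end

lemma fun_sum_apply: "(sum f T) x = (\<Sum>t\<in>T. f t x)"
  by (induction T rule: infinite_finite_induct) auto

text \<open>The diagonal is assumed to vanish separately: in characteristic 2 this does not follow
  from the pairwise cancellation.\<close>

lemma alternating_sum_zero:
  fixes g :: "nat \<Rightarrow> nat \<Rightarrow> 'b::comm_monoid_add"
  assumes "\<And>j k. j < n \<Longrightarrow> k < n \<Longrightarrow> g j k + g k j = 0" "\<And>j. j < n \<Longrightarrow> g j j = 0"
  shows "(\<Sum>j<n. \<Sum>k<n. g j k) = 0"
  using assms
proof (induction n)
  case (Suc n)
  have "(\<Sum>j<Suc n. \<Sum>k<Suc n. g j k) = (\<Sum>j<n. \<Sum>k<n. g j k) + (\<Sum>j<n. g j n + g n j) + g n n"
    by (simp add: sum.distrib add_ac)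
  then show ?case using Suc by simp
qed simp

section \<open>Dimensions in the linear resolution, and generation by quadrics\<close>

context koszul_resolution
begin

definition fscale :: "'k \<Rightarrow> (nat \<Rightarrow> 'a) \<Rightarrow> nat \<Rightarrow> 'a" where
  "fscale c v t = scale c (v t)"

sublocale fv: vspace fscale
  by unfold_locales (auto simp: fscale_def fun_eq_iff scale_right_distrib scale_left_distrib)

sublocale afv: vspace_pair scale fscale ..
sublocale ffv: vspace_pair fscale fscale ..

definition part :: "(nat \<Rightarrow> 'a) set \<Rightarrow> nat \<Rightarrow> (nat \<Rightarrow> 'a) set" where
  "part Z s = {z \<in> Z. \<forall>c. z c \<in> A s}"

lemma part_free_dim: "fv.has_dim (part (free_module q) s) (q * dim (A s))"
proof (induction q)
  case 0
  have "part (free_module 0) s = {0}" by (auto simp: part_def free_module_def zero_fun_def)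
  then show ?case using fv.has_dim_zero by simp
next
  case (Suc q)
  define f where "f x t = (if t = q then x else 0)" for x :: 'a and t
  have lf: "Vector_Spaces.linear scale fscale f"
    by unfold_locales (auto simp: f_def fscale_def fun_eq_iff)
  obtain d1 d2 where dd: "vs.has_dim {v \<in> A s. f v \<in> part (free_module q) s} d1"
      "fv.has_dim {f v + u |v u. v \<in> A s \<and> u \<in> part (free_module q) s} d2"
      "dim (A s) + q * dim (A s) = d1 + d2"
    using afv.dim_pullback[OF lf A_dim Suc] by blast
  have "{v \<in> A s. f v \<in> part (free_module q) s} = {0}"
    by (auto simp: part_def free_module_def f_def)
  then have "d1 = 0" using vs.has_dim_imp_dim[OF dd(1)] vs.has_dim_imp_dim[OF vs.has_dim_zero] by simp
  moreover have "{f v + u |v u. v \<in> A s \<and> u \<in> part (free_module q) s} = part (free_module (Suc q)) s"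
  proof (intro subset_antisym subsetI)
    fix z assume "z \<in> {f v + u |v u. v \<in> A s \<and> u \<in> part (free_module q) s}"
    then show "z \<in> part (free_module (Suc q)) s"
      by (auto simp: part_def free_module_def f_def A_add)
  next
    fix z assume z: "z \<in> part (free_module (Suc q)) s"
    have "z = f (z q) + (\<lambda>t. if t = q then 0 else z t)" by (auto simp: f_def fun_eq_iff)
    moreover have "(\<lambda>t. if t = q then 0 else z t) \<in> part (free_module q) s"
      using z by (auto simp: part_def free_module_def)
    moreover have "z q \<in> A s" using z by (simp add: part_def)
    ultimately show "z \<in> {f v + u |v u. v \<in> A s \<and> u \<in> part (free_module q) s}" by blast
  qed
  ultimately show ?case using dd by simp
qed

lemma part_subspace: "submod Z p \<Longrightarrow> fv.subspace (part Z s)"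
proof -
  assume Z: "submod Z p"
  have add: "(\<lambda>t. u t + v t) \<in> Z" if "u \<in> Z" "v \<in> Z" for u v
    using submod_lin_comb[OF Z, of "{0, 1}" "\<lambda>c. if c = 0 then u else v" "\<lambda>_. 1"] that by simp
  have "(\<lambda>t. scale c (u t)) \<in> Z" if "u \<in> Z" for u c
    using submod_scale[OF Z that, of "scale c 1"] by (simp add: scale_one_mult)
  then show ?thesis
    using add submod_zero[OF Z]
    unfolding fv.subspace_def part_def
    by (auto simp: zero_fun_def plus_fun_def fscale_def[abs_def] A_add A_scale)
qed

lemma part_dim: "submod Z p \<Longrightarrow> fv.has_dim (part Z s) (fv.dim (part Z s))"
  by (rule fv.has_dim_subset(1)[OF part_free_dim[of p s] part_subspace])
    (auto simp: part_def submod_def)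

lemma linear_basis_exists:
  assumes Z: "submod Z p"
  shows "\<exists>\<Gamma>. linear_basis Z (fv.dim (part Z 1)) \<Gamma>"
proof -
  obtain B where B: "finite B" "fv.independent B" "card B = fv.dim (part Z 1)" "fv.span B = part Z 1"
    using part_dim[OF Z, of 1] fv.has_dim_def by auto
  obtain g where "bij_betw g {..<card B} B" using ex_bij_betw_nat_finite[OF B(1)] atLeast0LessThan by metis
  then have g: "inj_on g {..<card B}" "g ` {..<card B} = B" by (auto simp: bij_betw_def)
  have gZ: "g c \<in> part Z 1" if "c < card B" for c
    using fv.span_base[of "g c" B] g(2) that B(4) by auto
  have "linear_basis Z (card B) g"
    unfolding linear_basis_def
  proof (intro conjI allI impI ballI)
    show "g c \<in> Z" "g c t \<in> A 1" if "c < card B" for c t using gZ[OF that] by (auto simp: part_def)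
    show "\<exists>k. z = (\<lambda>t. \<Sum>c<card B. scale (k c) (g c t))" if "z \<in> Z" "\<forall>t. z t \<in> A 1" for z
    proof -
      have "z \<in> fv.span (g ` {..<card B})" using that B(4) g(2) by (simp add: part_def)
      then obtain k where "z = (\<Sum>c<card B. fscale (k c) (g c))" using fv.family_span by blast
      then have "z = (\<lambda>t. \<Sum>c<card B. scale (k c) (g c t))" by (simp add: fun_eq_iff fun_sum_apply fscale_def)
      then show ?thesis by blast
    qed
    fix k c assume k: "(\<lambda>t. \<Sum>c<card B. scale (k c) (g c t)) = (\<lambda>_. 0)" and c: "c < card B"
    have "(\<Sum>c<card B. fscale (k c) (g c)) = 0"
      using k by (simp add: fun_eq_iff fun_sum_apply fscale_def)
    then show "k c = 0" using fv.family_independentD[OF g(1) _ finite_lessThan, of k c] g(2) B(2) c by simp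
  qed
  then show ?thesis using B(3) by auto
qed

lemma linear_basis_dim:
  assumes Z: "submod Z p" and \<Gamma>: "linear_basis Z q \<Gamma>"
  shows "fv.dim (part Z 1) = q"
proof (rule antisym)
  show "q \<le> fv.dim (part Z 1)"
  proof -
    have "card {..<q} \<le> fv.dim (part Z 1)"
    proof (rule fv.family_card_le_dim[OF part_dim[OF Z], of _ \<Gamma>])
      show "\<Gamma> i \<in> part Z 1" if "i \<in> {..<q}" for i using \<Gamma> that by (auto simp: linear_basis_def part_def)
      fix k assume "(\<Sum>i<q. fscale (k i) (\<Gamma> i)) = 0"
      then have "(\<lambda>t. \<Sum>c<q. scale (k c) (\<Gamma> c t)) = (\<lambda>_. 0)"
        by (simp add: fun_eq_iff fun_sum_apply fscale_def)
      then show "\<forall>i\<in>{..<q}. k i = 0" using \<Gamma> unfolding linear_basis_def by auto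
    qed simp
    then show ?thesis by simp
  qed
  have "part Z 1 \<subseteq> fv.span (\<Gamma> ` {..<q})"
  proof
    fix z assume "z \<in> part Z 1"
    then obtain k where "z = (\<lambda>t. \<Sum>c<q. scale (k c) (\<Gamma> c t))"
      using \<Gamma> unfolding linear_basis_def part_def by blast
    then have "z = (\<Sum>c<q. fscale (k c) (\<Gamma> c))" by (simp add: fun_eq_iff fun_sum_apply fscale_def)
    then show "z \<in> fv.span (\<Gamma> ` {..<q})"
      by (simp only:) (intro fv.span_sum fv.span_scale fv.span_base imageI)
  qed
  then have "fv.dim (part Z 1) \<le> card (\<Gamma> ` {..<q})" by (rule fv.dim_le_card) simp
  then show "fv.dim (part Z 1) \<le> q" using card_image_le[of "{..<q}" \<Gamma>] by simp
qed

text \<open>Dimensions in 0 -> Z'_s -> (R_s)^q -> Z_(s+1) -> 0, where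
  \<open>linear_generation\<close> provides the surjectivity.\<close>

lemma syzygy_dims:
  assumes Z: "linear_syzygy Z p" and \<Gamma>: "linear_basis Z q \<Gamma>"
  shows "q * dim (A s) = fv.dim (part Z (Suc s)) + fv.dim (part (syzygies q \<Gamma>) s)"
proof -
  have subZ: "submod Z p" using Z by (simp add: linear_syzygy_def)
  have \<Gamma>Z: "\<Gamma> c \<in> Z" and \<Gamma>A: "\<Gamma> c t \<in> A 1" if "c < q" for c t
    using \<Gamma> that by (auto simp: linear_basis_def)
  define L where "L v t = (\<Sum>c<q. v c * \<Gamma> c t)" for v t
  have lin: "Vector_Spaces.linear fscale fscale L"
    by unfold_locales (auto simp: L_def fscale_def fun_eq_iff distrib_right sum.distrib scale_sum_right scale_mult_left)
  have k: "{v \<in> part (free_module q) s. L v = 0} = part (syzygies q \<Gamma>) s"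
    by (auto simp: part_def syzygies_def L_def fun_eq_iff)
  have i: "L ` part (free_module q) s = part Z (Suc s)"
  proof (intro subset_antisym subsetI)
    fix z assume "z \<in> L ` part (free_module q) s"
    then obtain v where v: "z = L v" "\<And>c. v c \<in> A s" by (auto simp: part_def)
    have "z c \<in> A (Suc s)" for c
      unfolding v(1) L_def using mult_comp[OF v(2) \<Gamma>A] by (intro A_sum) auto
    moreover have "z \<in> Z"
      unfolding v(1) L_def[abs_def] using submod_lin_comb[OF subZ, of "{..<q}" \<Gamma> v] \<Gamma>Z by simp
    ultimately show "z \<in> part Z (Suc s)" by (simp add: part_def)
  next
    fix z assume "z \<in> part Z (Suc s)"
    then obtain x where "x \<in> free_module q" "\<forall>c. x c \<in> A s" "z = (\<lambda>t. \<Sum>c<q. x c * \<Gamma> c t)"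
      using linear_generation[OF Z \<Gamma>, of z s] by (auto simp: part_def)
    then show "z \<in> L ` part (free_module q) s"
      by (intro image_eqI[of _ _ x]) (auto simp: part_def L_def)
  qed
  show ?thesis
    using ffv.dim_kernel_image(1)[OF lin part_free_dim[of q s]] unfolding k i by simp
qed

definition irr :: "(nat \<Rightarrow> 'a) set" where
  "irr = {v \<in> free_module 1. v 0 \<in> irrelevant}"

definition gens :: "nat \<Rightarrow> nat \<Rightarrow> 'a" where
  "gens c t = (if t = 0 then b c else 0)"

lemma linear_basis_irr: "linear_basis irr n gens"
  unfolding linear_basis_def
proof (intro conjI allI impI ballI)
  show "gens c \<in> irr" "gens c t \<in> A 1" if "c < n" for c t
    using b_A1[OF that] residue_pos[of "b c" 1] residue_0_iff[of "b c"]
    by (auto simp: irr_def gens_def free_module_def)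
  fix z assume z: "z \<in> irr" "\<forall>t. z t \<in> A 1"
  then have "z 0 \<in> span (b ` {..<n})" using b_span by simp
  then obtain k where k: "z 0 = (\<Sum>c<n. scale (k c) (b c))" using vs.family_span by blast
  have "z = (\<lambda>t. \<Sum>c<n. scale (k c) (gens c t))"
  proof
    fix t show "z t = (\<Sum>c<n. scale (k c) (gens c t))"
      using k z by (cases t) (auto simp: gens_def irr_def free_module_def)
  qed
  then show "\<exists>k. z = (\<lambda>t. \<Sum>c<n. scale (k c) (gens c t))" by blast
next
  fix k c assume k: "(\<lambda>t. \<Sum>c<n. scale (k c) (gens c t)) = (\<lambda>_. 0)" and c: "c < n"
  have "(\<Sum>c<n. scale (k c) (b c)) = 0" using fun_cong[OF k, of 0] by (simp add: gens_def)
  then show "k c = 0" using vs.family_independentD[OF b_inj b_indep finite_lessThan, of k c] c by simp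
qed

lemma linear_syzygy_irr: "linear_syzygy irr 1"
  unfolding irr_def by (rule linear_syzygy_irrelevant)

text \<open>\<open>Z i\<close> is the \<open>i + 1\<close>-st syzygy module of \<open>k\<close>, so \<open>q i\<close> is the \<open>i + 1\<close>-st Betti number.\<close>

lemma linear_resolution_exists:
  "\<exists>Z q \<Gamma>. Z 0 = irr \<and> q 0 = n \<and> \<Gamma> 0 = gens \<and> (\<forall>i. linear_basis (Z i) (q i) (\<Gamma> i)) \<and>
     (\<forall>i. Z (Suc i) = syzygies (q i) (\<Gamma> i)) \<and> (\<forall>i. \<exists>p. linear_syzygy (Z i) p)"
proof -
  define good where "good i x \<longleftrightarrow> (case x of (Z, q, \<Gamma>) \<Rightarrow>
      (\<exists>p. linear_syzygy Z p) \<and> linear_basis Z q \<Gamma> \<and> (i = (0::nat) \<longrightarrow> x = (irr, n, gens)))" for i x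
  define succ where "succ i x y \<longleftrightarrow> (case x of (Z, q, \<Gamma>) \<Rightarrow> fst y = syzygies q \<Gamma>)" for i :: nat
    and x y :: "(nat \<Rightarrow> 'a) set \<times> nat \<times> (nat \<Rightarrow> nat \<Rightarrow> 'a)"
  have "\<exists>f. \<forall>i. good i (f i) \<and> succ i (f i) (f (Suc i))"
  proof (rule dependent_nat_choice)
    show "\<exists>x. good 0 x"
      unfolding good_def using linear_basis_irr linear_syzygy_irr by (intro exI[of _ "(irr, n, gens)"]) auto
    fix x i assume "good i x"
    then obtain Z q \<Gamma> p where x: "x = (Z, q, \<Gamma>)" "linear_syzygy Z p" "linear_basis Z q \<Gamma>"
      by (auto simp: good_def split: prod.splits)
    have s: "linear_syzygy (syzygies q \<Gamma>) q" using linear_syzygy_step[OF x(2,3)] .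
    then obtain \<Gamma>' where "linear_basis (syzygies q \<Gamma>) (fv.dim (part (syzygies q \<Gamma>) 1)) \<Gamma>'"
      using linear_basis_exists[of "syzygies q \<Gamma>" q] unfolding linear_syzygy_def by blast
    then show "\<exists>y. good (Suc i) y \<and> succ i x y"
      using s x(1) unfolding good_def succ_def
      by (intro exI[of _ "(syzygies q \<Gamma>, fv.dim (part (syzygies q \<Gamma>) 1), \<Gamma>')"]) auto
  qed
  then obtain f where f: "\<And>i. good i (f i)" "\<And>i. succ i (f i) (f (Suc i))" by blast
  show ?thesis
    using f(1)[of 0] f unfolding good_def succ_def
    by (intro exI[of _ "\<lambda>i. fst (f i)"] exI[of _ "\<lambda>i. fst (snd (f i))"] exI[of _ "\<lambda>i. snd (snd (f i))"])
      (simp add: case_prod_unfold)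
qed

text \<open>Uses the linearity of the second step of the resolution. For \<open>g\<close> = \<Sum>
  x_i h_i in the kernel, the values of the \<open>h i\<close> form a syzygy of the
  \<open>b i\<close>, hence a combination of linear syzygies, and each linear syzygy lifts to a
  quadric in the kernel. Removing these quadrics from \<open>g\<close> leaves coefficients that lie
  in the kernel themselves, in degree one less.\<close>

lemma hideal_quadrics:
  assumes J: "hideal J" and quad: "ker \<inter> C 2 \<subseteq> J"
  shows "ker \<subseteq> J"
proof -
  obtain Z q \<Gamma> where R: "Z 0 = irr" "q 0 = n" "\<Gamma> 0 = gens" "\<And>i. linear_basis (Z i) (q i) (\<Gamma> i)"
      "\<And>i. Z (Suc i) = syzygies (q i) (\<Gamma> i)" "\<And>i. \<exists>p. linear_syzygy (Z i) p"
    using linear_resolution_exists by blast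
  obtain p where p: "linear_syzygy (Z 1) p" using R(6) by blast
  have Z1: "Z 1 = syzygies n gens" using R(5)[of 0] R(1-3) by simp
  note K = hidealD[OF hideal_ker]
  have 1: "ker \<inter> C j \<subseteq> J" for j
  proof (induction j rule: less_induct)
    case (less j)
    show ?case
    proof
      fix g assume g: "g \<in> ker \<inter> C j"
      have evg: "ev b g = 0" using g by (simp add: ker_def)
      consider "j = 0" | "j = 1" | "j = 2" | "2 < j" by linarith
      then show "g \<in> J"
      proof cases
        case 1
        \<comment> \<open>The kernel is zero in degree 0: its codimension 1 already exhausts the
          one-dimensional space of constants.\<close>
        have "hf ker 0 = 1" using hf_0[OF hideal_ker] by (simp add: ker_def)
        then have d: "mp.dim (C 0 :: 'k mpoly set) - mp.dim (ker \<inter> C 0) = 1" by (simp add: hf_def)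
        have d0: "mp.dim ({0} :: 'k mpoly set) = 0" using mp.has_dim_imp_dim[OF mp.has_dim_zero] .
        have "mp.dim (C 0 :: 'k mpoly set) = 1"
        proof -
          have "hf ({0} :: 'k mpoly set) 0 = 1" using hf_0[OF hideal_zero] by simp
          moreover have "({0} :: 'k mpoly set) \<inter> C 0 = {0}" using mp.subspace_0[OF C_subspace] by auto
          ultimately show ?thesis using d0 by (simp add: hf_def)
        qed
        then have "mp.dim (ker \<inter> C 0) = 0" using d by simp
        moreover have "{0} \<subseteq> ker \<inter> C 0"
          using hidealD(2)[OF hideal_ker] mp.subspace_0[OF C_subspace] by simp
        ultimately have "{0} = ker \<inter> C 0"
          using mp.has_dim_subset(3)[OF hideal_dim(1)[OF hideal_ker, of 0] mp.has_dim_subspace[OF mp.has_dim_zero]]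
            d0 by simp
        then have "ker \<inter> C 0 = {0}" ..
        then show ?thesis using g 1 hidealD(2)[OF J] by auto
      next
        case 2
        then obtain c where c: "g = (\<Sum>i<n. smul (c i) (var i))" using C1_linear_combination[of g] g by auto
        then have "(\<Sum>i<n. scale (c i) (b i)) = 0" using evg by (simp add: ev_sum ev_smul ev_var)
        then have "c i = 0" if "i < n" for i
          using vs.family_independentD[OF b_inj b_indep finite_lessThan, of c i] that by simp
        then show ?thesis using c hidealD(2)[OF J] by simp
      next
        case 3
        then show ?thesis using g quad by auto
      next
        case 4
        obtain h where hC: "\<And>i. h i \<in> C (j - 1)" and gh: "g = (\<Sum>i<n. var i * h i)"
          using var_expansion[of g j] g 4 by auto
        define v where "v i = (if i < n then ev b (h i) else 0)" for i
        have "(\<Sum>c<n. v c * gens c t) = 0" for t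
        proof -
          have "(\<Sum>c<n. v c * b c) = ev b g"
            unfolding gh by (simp add: ev_sum ev_mult ev_var v_def mult.commute)
          then show ?thesis using evg by (cases "t = 0") (simp_all add: gens_def)
        qed
        then have vZ: "v \<in> Z 1" unfolding Z1 syzygies_def by (simp add: free_module_def v_def)
        have "v c \<in> A (Suc (j - 2))" for c
          using ev_C[OF hC[of c]] 4 by (simp add: v_def Suc_diff_Suc numeral_2_eq_2)
        from linear_generation[OF p R(4)[of 1] vZ this]
        obtain x where x: "\<And>c. x c \<in> A (j - 2)" "v = (\<lambda>t. \<Sum>c<q 1. x c * \<Gamma> 1 c t)" by blast
        have "\<exists>y. y \<in> C (j - 2) \<and> ev b y = x c" for c
          using x(1)[of c] ev_C_image[of "j - 2"] by (metis imageE)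
        then obtain y where y: "\<And>c. y c \<in> C (j - 2)" "\<And>c. ev b (y c) = x c" by metis
        have \<Gamma>1: "\<Gamma> 1 c \<in> Z 1" "\<Gamma> 1 c t \<in> A 1" if "c < q 1" for c t
          using R(4)[of 1] that unfolding linear_basis_def by auto
        have "\<exists>l. l \<in> C 1 \<and> (c < q 1 \<longrightarrow> ev b l = \<Gamma> 1 c i)" for c i
          using \<Gamma>1(2)[of c i] ev_C_image[of 1] mp.subspace_0[OF C_subspace] by (metis imageE)
        then obtain l where l: "\<And>c i. l c i \<in> C 1" "\<And>c i. c < q 1 \<Longrightarrow> ev b (l c i) = \<Gamma> 1 c i" by metis
        define Q where "Q c = (\<Sum>i<n. var i * l c i)" for c
        have Q: "Q c \<in> J" if "c < q 1" for c
        proof -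
          have "var i * l c i \<in> C 2" if "i < n" for i using C_mult[OF var_C1[OF that] l(1)[of c i]] by (simp add: numeral_2_eq_2)
          then have "Q c \<in> C 2" unfolding Q_def by (intro mp.subspace_sum[OF C_subspace]) auto
          moreover have "ev b (Q c) = (\<Sum>i<n. \<Gamma> 1 c i * gens i 0)"
            unfolding Q_def using l(2)[OF that] by (simp add: ev_sum ev_mult ev_var gens_def mult.commute)
          then have "ev b (Q c) = 0" using \<Gamma>1(1)[OF that] unfolding Z1 syzygies_def by simp
          ultimately show ?thesis using quad C_P by (auto simp: ker_def)
        qed
        \<comment> \<open>After this correction the coefficients evaluate to 0, so the induction
          hypothesis applies to them.\<close>
        define h' where "h' i = h i - (\<Sum>c<q 1. y c * l c i)" for i
        have j1: "j - 2 + 1 = j - 1" "j - 1 < j" using 4 by auto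
        have h'C: "h' i \<in> C (j - 1)" for i
        proof -
          have "(\<Sum>c<q 1. y c * l c i) \<in> C (j - 1)"
            using C_mult[OF y(1) l(1)] j1(1) by (intro mp.subspace_sum[OF C_subspace]) simp
          then show ?thesis unfolding h'_def using mp.subspace_diff[OF C_subspace hC] by blast
        qed
        have "ev b (h' i) = 0" if "i < n" for i
        proof -
          have "ev b (\<Sum>c<q 1. y c * l c i) = (\<Sum>c<q 1. x c * \<Gamma> 1 c i)"
            using y(2) l(2) by (simp add: ev_sum ev_mult)
          also have "\<dots> = v i" using fun_cong[OF x(2), of i] by simp
          finally show ?thesis using that by (simp add: h'_def ev_diff v_def)
        qed
        then have "h' i \<in> ker \<inter> C (j - 1)" if "i < n" for i
          using h'C C_P[OF h'C] that by (simp add: ker_def)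
        then have h'J: "h' i \<in> J" if "i < n" for i
          using less.IH[OF j1(2)] that by blast
        have "g = (\<Sum>i<n. var i * h' i) + (\<Sum>c<q 1. y c * Q c)"
        proof -
          have "(\<Sum>c<q 1. y c * Q c) = (\<Sum>i<n. var i * (\<Sum>c<q 1. y c * l c i))"
            unfolding Q_def sum_distrib_left by (subst sum.swap) (simp add: mult_ac)
          then show ?thesis unfolding gh h'_def by (simp add: right_diff_distrib sum_subtractf)
        qed
        moreover have "(\<Sum>i<n. var i * h' i) \<in> J"
          using hidealD(4)[OF J poly_ring_var h'J] by (intro hideal_sum[OF J]) auto
        moreover have "(\<Sum>c<q 1. y c * Q c) \<in> J"
          using hidealD(4)[OF J C_P[OF y(1)] Q] by (intro hideal_sum[OF J]) auto
        ultimately show ?thesis using hidealD(3)[OF J] by metis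
      qed
    qed
  qed
  show ?thesis
  proof
    fix g assume g: "g \<in> ker"
    have "hc j g \<in> J" for j using 1[of j] K(6)[OF g] hc_C K(1) g by blast
    then show "g \<in> J" using hideal_hcI[OF J] by blast
  qed
qed

end

section \<open>The Clifford module\<close>

text \<open>
  A Clifford-type module: \<open>\<theta>\<close> is an element of the dual of \<open>k[z\<^sub>0, \<dots>] \<otimes> \<Lambda>(y\<^sub>0, \<dots>)\<close>, and \<open>D j\<close> is
  dual to the multiplication with \<open>y\<^sub>j\<close> in the Clifford algebra of the quadratic form \<open>\<Sum>z\<^sub>l \<beta>\<^sub>l\<close>.
\<close>

locale fock =
  fixes n \<mu> :: nat and \<beta> :: "nat \<Rightarrow> nat \<Rightarrow> nat \<Rightarrow> 'k::field"
begin

definition sg :: "nat \<Rightarrow> nat set \<Rightarrow> 'k" where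
  "sg j \<sigma> = (- 1) ^ card {t \<in> \<sigma>. t < j}"

definition low :: "nat \<Rightarrow> (nat set \<Rightarrow> (nat \<Rightarrow> nat) \<Rightarrow> 'k) \<Rightarrow> nat set \<Rightarrow> (nat \<Rightarrow> nat) \<Rightarrow> 'k" where
  "low j \<theta> \<sigma> \<alpha> = (if j \<in> \<sigma> then 0 else sg j \<sigma> * \<theta> (insert j \<sigma>) \<alpha>)"

definition raise :: "nat \<Rightarrow> (nat set \<Rightarrow> (nat \<Rightarrow> nat) \<Rightarrow> 'k) \<Rightarrow> nat set \<Rightarrow> (nat \<Rightarrow> nat) \<Rightarrow> 'k" where
  "raise j \<theta> \<sigma> \<alpha> = (if j \<in> \<sigma> then sg j \<sigma> * \<theta> (\<sigma> - {j}) \<alpha> else 0)"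

definition shf :: "nat \<Rightarrow> (nat set \<Rightarrow> (nat \<Rightarrow> nat) \<Rightarrow> 'k) \<Rightarrow> nat set \<Rightarrow> (nat \<Rightarrow> nat) \<Rightarrow> 'k" where
  "shf l \<theta> \<sigma> \<alpha> = \<theta> \<sigma> (\<alpha>(l := Suc (\<alpha> l)))"

definition Bop :: "nat \<Rightarrow> nat \<Rightarrow> (nat set \<Rightarrow> (nat \<Rightarrow> nat) \<Rightarrow> 'k) \<Rightarrow> nat set \<Rightarrow> (nat \<Rightarrow> nat) \<Rightarrow> 'k" where
  "Bop j k \<theta> \<sigma> \<alpha> = (\<Sum>l<\<mu>. \<beta> l j k * shf l \<theta> \<sigma> \<alpha>)"

text \<open>Chevalley's action of the Clifford algebra on the exterior algebra: y_j acts as exterior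
  multiplication plus contraction along the bilinear form \<Sum> z_l \<beta>_l. Under duality
  exterior multiplication becomes \<open>low j\<close>, contraction becomes \<open>raise k\<close>,
  and multiplication by z_l becomes \<open>shf l\<close>.\<close>

definition D :: "nat \<Rightarrow> (nat set \<Rightarrow> (nat \<Rightarrow> nat) \<Rightarrow> 'k) \<Rightarrow> nat set \<Rightarrow> (nat \<Rightarrow> nat) \<Rightarrow> 'k" where
  "D j \<theta> \<sigma> \<alpha> = low j \<theta> \<sigma> \<alpha> + (\<Sum>k<n. raise k (Bop j k \<theta>) \<sigma> \<alpha>)"

section \<open>Anticommutation relations\<close>

lemma sg_sq: "sg j \<sigma> * sg j \<sigma> = 1"
  by (simp add: sg_def power_mult_distrib[symmetric])

lemma sg_insert: "j \<notin> \<sigma> \<Longrightarrow> sg k (insert j \<sigma>) = (if j < k then - sg k \<sigma> else sg k \<sigma>)"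
proof (cases "j < k")
  case True
  assume "j \<notin> \<sigma>"
  moreover have "{t \<in> insert j \<sigma>. t < k} = insert j {t \<in> \<sigma>. t < k}" using True by auto
  moreover have "finite {t \<in> \<sigma>. t < k}" by (rule finite_subset[of _ "{..<k}"]) auto
  ultimately show ?thesis using True by (simp add: sg_def)
next
  case False
  then have "{t \<in> insert j \<sigma>. t < k} = {t \<in> \<sigma>. t < k}" by auto
  then show ?thesis using False by (simp add: sg_def)
qed

lemma sg_remove: "j \<in> \<sigma> \<Longrightarrow> sg k (\<sigma> - {j}) = (if j < k then - sg k \<sigma> else sg k \<sigma>)"
  using sg_insert[of j "\<sigma> - {j}" k] by (auto simp: insert_absorb split: if_splits)

lemma low_low: "low j (low k \<theta>) \<sigma> \<alpha> + low k (low j \<theta>) \<sigma> \<alpha> = 0" "low j (low j \<theta>) \<sigma> \<alpha> = 0"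
  by (auto simp: low_def sg_insert insert_commute)

lemma raise_raise: "raise j (raise k \<theta>) \<sigma> \<alpha> + raise k (raise j \<theta>) \<sigma> \<alpha> = 0" "raise j (raise j \<theta>) \<sigma> \<alpha> = 0"
proof -
  show "raise j (raise j \<theta>) \<sigma> \<alpha> = 0" by (simp add: raise_def)
  have "\<sigma> - {j} - {k} = \<sigma> - {k} - {j}" by auto
  then show "raise j (raise k \<theta>) \<sigma> \<alpha> + raise k (raise j \<theta>) \<sigma> \<alpha> = 0"
    by (auto simp: raise_def sg_remove)
qed

lemma low_raise: "low j (raise k \<theta>) \<sigma> \<alpha> + raise k (low j \<theta>) \<sigma> \<alpha> = (if j = k then \<theta> \<sigma> \<alpha> else 0)"
proof (cases "j = k")
  case True
  then show ?thesis
    by (auto simp: low_def raise_def sg_insert sg_remove sg_sq insert_absorb mult.assoc[symmetric])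
next
  case False
  then have "k \<in> \<sigma> \<Longrightarrow> j \<notin> \<sigma> \<Longrightarrow> insert j \<sigma> - {k} = insert j (\<sigma> - {k})" by auto
  then show ?thesis using False
    by (auto simp: low_def raise_def sg_insert sg_remove)
qed

lemma low_add: "low j (\<lambda>\<sigma> \<alpha>. f \<sigma> \<alpha> + g \<sigma> \<alpha>) \<sigma> \<alpha> = low j f \<sigma> \<alpha> + low j g \<sigma> \<alpha>"
  by (simp add: low_def distrib_left)

lemma low_sum: "low j (\<lambda>\<sigma> \<alpha>. \<Sum>t\<in>T. f t \<sigma> \<alpha>) \<sigma> \<alpha> = (\<Sum>t\<in>T. low j (f t) \<sigma> \<alpha>)"
  by (simp add: low_def sum_distrib_left)

lemma raise_add: "raise j (\<lambda>\<sigma> \<alpha>. f \<sigma> \<alpha> + g \<sigma> \<alpha>) \<sigma> \<alpha> = raise j f \<sigma> \<alpha> + raise j g \<sigma> \<alpha>"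
  by (simp add: raise_def distrib_left)

lemma raise_sum: "raise j (\<lambda>\<sigma> \<alpha>. \<Sum>t\<in>T. f t \<sigma> \<alpha>) \<sigma> \<alpha> = (\<Sum>t\<in>T. raise j (f t) \<sigma> \<alpha>)"
  by (simp add: raise_def sum_distrib_left)

lemma Bop_low: "Bop j k (low i \<theta>) = low i (Bop j k \<theta>)"
  by (intro ext) (simp add: Bop_def shf_def low_def sum_distrib_left mult_ac)

lemma Bop_raise: "Bop j k (raise i \<theta>) = raise i (Bop j k \<theta>)"
  by (intro ext) (simp add: Bop_def shf_def raise_def sum_distrib_left mult_ac)

lemma Bop_add: "Bop j k (\<lambda>\<sigma> \<alpha>. f \<sigma> \<alpha> + g \<sigma> \<alpha>) \<sigma> \<alpha> = Bop j k f \<sigma> \<alpha> + Bop j k g \<sigma> \<alpha>"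
  by (simp add: Bop_def shf_def distrib_left sum.distrib)

lemma Bop_sum: "Bop j k (\<lambda>\<sigma> \<alpha>. \<Sum>t\<in>T. f t \<sigma> \<alpha>) \<sigma> \<alpha> = (\<Sum>t\<in>T. Bop j k (f t) \<sigma> \<alpha>)"
  unfolding Bop_def shf_def sum_distrib_left by (rule sum.swap)

lemma Bop_Bop: "Bop j k (Bop j' k' \<theta>) = Bop j' k' (Bop j k \<theta>)"
proof (intro ext)
  fix \<sigma> \<alpha>
  have "Bop j k (Bop j' k' \<theta>) \<sigma> \<alpha>
      = (\<Sum>l<\<mu>. \<Sum>m<\<mu>. \<beta> l j k * (\<beta> m j' k' * shf l (shf m \<theta>) \<sigma> \<alpha>))"
    by (simp add: Bop_def shf_def sum_distrib_left)
  also have "\<dots> = (\<Sum>m<\<mu>. \<Sum>l<\<mu>. \<beta> m j' k' * (\<beta> l j k * shf m (shf l \<theta>) \<sigma> \<alpha>))"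
  proof (subst sum.swap, intro sum.cong refl)
    fix l m
    show "\<beta> l j k * (\<beta> m j' k' * shf l (shf m \<theta>) \<sigma> \<alpha>) = \<beta> m j' k' * (\<beta> l j k * shf m (shf l \<theta>) \<sigma> \<alpha>)"
      by (cases "l = m") (auto simp: shf_def fun_upd_twist mult_ac)
  qed
  also have "\<dots> = Bop j' k' (Bop j k \<theta>) \<sigma> \<alpha>" by (simp add: Bop_def shf_def sum_distrib_left)
  finally show "Bop j k (Bop j' k' \<theta>) \<sigma> \<alpha> = Bop j' k' (Bop j k \<theta>) \<sigma> \<alpha>" .
qed

lemma D_D:
  "D j (D k \<theta>) \<sigma> \<alpha> = low j (low k \<theta>) \<sigma> \<alpha> + (\<Sum>m<n. low j (raise m (Bop k m \<theta>)) \<sigma> \<alpha>)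
    + (\<Sum>m<n. raise m (low k (Bop j m \<theta>)) \<sigma> \<alpha>)
    + (\<Sum>m<n. \<Sum>p<n. raise m (raise p (Bop k p (Bop j m \<theta>))) \<sigma> \<alpha>)"
proof -
  have D_eq: "D k \<theta> = (\<lambda>\<sigma> \<alpha>. low k \<theta> \<sigma> \<alpha> + (\<Sum>m<n. raise m (Bop k m \<theta>) \<sigma> \<alpha>))"
    by (intro ext) (simp add: D_def)
  have 1: "low j (D k \<theta>) \<sigma> \<alpha> = low j (low k \<theta>) \<sigma> \<alpha> + (\<Sum>m<n. low j (raise m (Bop k m \<theta>)) \<sigma> \<alpha>)"
    unfolding D_eq low_add low_sum ..
  have "Bop j m (D k \<theta>) = (\<lambda>\<sigma> \<alpha>. low k (Bop j m \<theta>) \<sigma> \<alpha> + (\<Sum>p<n. raise p (Bop k p (Bop j m \<theta>)) \<sigma> \<alpha>))" for m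
    unfolding D_eq by (intro ext) (simp add: Bop_add Bop_sum Bop_low Bop_raise Bop_Bop[of j m])
  then have 2: "raise m (Bop j m (D k \<theta>)) \<sigma> \<alpha> = raise m (low k (Bop j m \<theta>)) \<sigma> \<alpha>
      + (\<Sum>p<n. raise m (raise p (Bop k p (Bop j m \<theta>))) \<sigma> \<alpha>)" for m
    by (simp add: raise_add raise_sum)
  show ?thesis by (subst D_def) (simp add: 1 2 sum.distrib add.assoc)
qed

text \<open>Pure \<open>low\<close> and pure \<open>raise\<close> terms cancel; the mixed terms
  collapse to a single index by \<open>low_raise\<close>, each of the two pairings contributing one
  of the operators \<open>Bop\<close>.\<close>

lemma D_anticommute:
  assumes "j < n" "k < n"
  shows "D j (D k \<theta>) \<sigma> \<alpha> + D k (D j \<theta>) \<sigma> \<alpha> = Bop j k \<theta> \<sigma> \<alpha> + Bop k j \<theta> \<sigma> \<alpha>"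
proof -
  have a: "(\<Sum>m<n. low i (raise m (Bop i' m \<theta>)) \<sigma> \<alpha>) + (\<Sum>m<n. raise m (low i (Bop i' m \<theta>)) \<sigma> \<alpha>)
      = Bop i' i \<theta> \<sigma> \<alpha>" if "i < n" for i i'
    unfolding sum.distrib[symmetric] low_raise using that by simp
  have b: "(\<Sum>m<n. \<Sum>p<n. raise m (raise p (Bop k p (Bop j m \<theta>))) \<sigma> \<alpha>)
      + (\<Sum>m<n. \<Sum>p<n. raise m (raise p (Bop j p (Bop k m \<theta>))) \<sigma> \<alpha>) = 0"
  proof -
    have "(\<Sum>m<n. \<Sum>p<n. raise m (raise p (Bop j p (Bop k m \<theta>))) \<sigma> \<alpha>)
        = (\<Sum>m<n. \<Sum>p<n. raise p (raise m (Bop k p (Bop j m \<theta>))) \<sigma> \<alpha>)"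
      by (subst sum.swap) (simp add: Bop_Bop[of j])
    then show ?thesis by (simp add: sum.distrib[symmetric] raise_raise)
  qed
  have rearrange: "(x1 + y1 + z1 + w1) + (x2 + y2 + z2 + w2) = (y2 + z1) + (y1 + z2)"
    if "x1 + x2 = 0" "w1 + w2 = 0" for x1 x2 y1 y2 z1 z2 w1 w2 :: 'k
  proof -
    have "(x1 + y1 + z1 + w1) + (x2 + y2 + z2 + w2) = (x1 + x2) + (w1 + w2) + ((y2 + z1) + (y1 + z2))"
      by (simp only: add_ac)
    then show ?thesis using that by simp
  qed
  show ?thesis
    unfolding D_D rearrange[OF low_low(1) b] a[OF assms(1)] a[OF assms(2)] ..
qed

text \<open>Not a special case of \<open>D_anticommute\<close>, which for \<open>k = j\<close> gives
  only twice this equation.\<close>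

lemma D_square:
  assumes "j < n"
  shows "D j (D j \<theta>) \<sigma> \<alpha> = Bop j j \<theta> \<sigma> \<alpha>"
proof -
  have "(\<Sum>m<n. low j (raise m (Bop j m \<theta>)) \<sigma> \<alpha>) + (\<Sum>m<n. raise m (low j (Bop j m \<theta>)) \<sigma> \<alpha>)
      = Bop j j \<theta> \<sigma> \<alpha>"
    unfolding sum.distrib[symmetric] low_raise using assms by simp
  moreover have "(\<Sum>m<n. \<Sum>p<n. raise m (raise p (Bop j p (Bop j m \<theta>))) \<sigma> \<alpha>) = 0"
  proof (rule alternating_sum_zero)
    fix m p
    show "raise m (raise p (Bop j p (Bop j m \<theta>))) \<sigma> \<alpha> + raise p (raise m (Bop j m (Bop j p \<theta>))) \<sigma> \<alpha> = 0"
      unfolding Bop_Bop[of j m j p] by (rule raise_raise)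
  qed (rule raise_raise)
  ultimately show ?thesis unfolding D_D low_low(2) by simp
qed

text \<open>Homogeneous elements, where the y_j have degree 1 and the z_l degree 2, as the squares
  of the y_j require.\<close>

definition fdeg :: "nat \<Rightarrow> (nat set \<Rightarrow> (nat \<Rightarrow> nat) \<Rightarrow> 'k) set" where
  "fdeg i = {\<theta>. \<forall>\<sigma> \<alpha>. \<theta> \<sigma> \<alpha> \<noteq> 0 \<longrightarrow> \<sigma> \<subseteq> {..<n} \<and> (\<forall>l\<ge>\<mu>. \<alpha> l = 0) \<and> card \<sigma> + 2 * (\<Sum>l<\<mu>. \<alpha> l) = i}"

lemma fdegD:
  "\<theta> \<in> fdeg i \<Longrightarrow> \<theta> \<sigma> \<alpha> \<noteq> 0 \<Longrightarrow> \<sigma> \<subseteq> {..<n} \<and> (\<forall>l\<ge>\<mu>. \<alpha> l = 0) \<and> card \<sigma> + 2 * (\<Sum>l<\<mu>. \<alpha> l) = i"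
  by (simp add: fdeg_def)

lemma fdeg_add: "f \<in> fdeg i \<Longrightarrow> g \<in> fdeg i \<Longrightarrow> (\<lambda>\<sigma> \<alpha>. f \<sigma> \<alpha> + g \<sigma> \<alpha>) \<in> fdeg i"
  unfolding fdeg_def by (clarsimp, metis add_0)

lemma fdeg_scale: "f \<in> fdeg i \<Longrightarrow> (\<lambda>\<sigma> \<alpha>. c * f \<sigma> \<alpha>) \<in> fdeg i"
  unfolding fdeg_def mem_Collect_eq mult_eq_0_iff by blast

lemma fdeg_zero: "(\<lambda>\<sigma> \<alpha>. 0) \<in> fdeg i"
  unfolding fdeg_def by auto

lemma fdeg_sum: "(\<And>t. t \<in> T \<Longrightarrow> f t \<in> fdeg i) \<Longrightarrow> (\<lambda>\<sigma> \<alpha>. \<Sum>t\<in>T. f t \<sigma> \<alpha>) \<in> fdeg i"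
  by (induction T rule: infinite_finite_induct) (auto simp: fdeg_zero fdeg_add)

lemma sum_upd: "l < \<mu> \<Longrightarrow> (\<Sum>t<\<mu>. (\<alpha>(l := Suc (\<alpha> l))) t) = Suc (\<Sum>t<\<mu>. \<alpha> t :: nat)"
proof -
  assume l: "l < \<mu>"
  have "(\<Sum>t<\<mu>. (\<alpha>(l := Suc (\<alpha> l))) t) = (\<Sum>t<\<mu>. \<alpha> t + (if t = l then 1 else 0))"
    by (intro sum.cong) auto
  then show ?thesis using l by (simp add: sum.distrib)
qed

lemma shf_fdeg: "l < \<mu> \<Longrightarrow> \<theta> \<in> fdeg (Suc (Suc i)) \<Longrightarrow> shf l \<theta> \<in> fdeg i"
  unfolding fdeg_def[of i]
proof (intro CollectI allI impI)
  fix \<sigma> \<alpha> assume l: "l < \<mu>" and "\<theta> \<in> fdeg (Suc (Suc i))" "shf l \<theta> \<sigma> \<alpha> \<noteq> 0"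
  then have *: "\<sigma> \<subseteq> {..<n}" "\<forall>t\<ge>\<mu>. (\<alpha>(l := Suc (\<alpha> l))) t = 0"
      "card \<sigma> + 2 * (\<Sum>t<\<mu>. (\<alpha>(l := Suc (\<alpha> l))) t) = Suc (Suc i)"
    using fdegD[of \<theta> "Suc (Suc i)" \<sigma> "\<alpha>(l := Suc (\<alpha> l))"] by (auto simp: shf_def)
  have "\<alpha> t = 0" if "t \<ge> \<mu>" for t using *(2)[rule_format, OF that] l that by simp
  then show "\<sigma> \<subseteq> {..<n} \<and> (\<forall>l\<ge>\<mu>. \<alpha> l = 0) \<and> card \<sigma> + 2 * (\<Sum>l<\<mu>. \<alpha> l) = i"
    using *(1,3) unfolding sum_upd[OF l] by simp
qed

lemma Bop_fdeg: "\<theta> \<in> fdeg (Suc (Suc i)) \<Longrightarrow> Bop j k \<theta> \<in> fdeg i"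
proof -
  assume "\<theta> \<in> fdeg (Suc (Suc i))"
  then have "(\<lambda>\<sigma> \<alpha>. \<Sum>l\<in>{..<\<mu>}. \<beta> l j k * shf l \<theta> \<sigma> \<alpha>) \<in> fdeg i"
    by (intro fdeg_sum fdeg_scale shf_fdeg) auto
  then show ?thesis unfolding Bop_def[abs_def] .
qed

lemma D_fdeg:
  assumes j: "j < n" and \<theta>: "\<theta> \<in> fdeg (Suc i)"
  shows "D j \<theta> \<in> fdeg i"
proof -
  have "low j \<theta> \<in> fdeg i"
    unfolding fdeg_def
  proof (intro CollectI allI impI)
    fix \<sigma> \<alpha> assume "low j \<theta> \<sigma> \<alpha> \<noteq> 0"
    then have js: "j \<notin> \<sigma>" "\<theta> (insert j \<sigma>) \<alpha> \<noteq> 0" by (auto simp: low_def split: if_splits)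
    have s: "insert j \<sigma> \<subseteq> {..<n}" "\<forall>l\<ge>\<mu>. \<alpha> l = 0" "card (insert j \<sigma>) + 2 * (\<Sum>l<\<mu>. \<alpha> l) = Suc i"
      using fdegD[OF \<theta>, of "insert j \<sigma>" \<alpha>] js(2) by blast+
    then have "finite \<sigma>" by (meson finite_insert finite_lessThan finite_subset)
    then show "\<sigma> \<subseteq> {..<n} \<and> (\<forall>l\<ge>\<mu>. \<alpha> l = 0) \<and> card \<sigma> + 2 * (\<Sum>l<\<mu>. \<alpha> l) = i"
      using s js(1) by simp
  qed
  moreover have "raise k (Bop j k \<theta>) \<in> fdeg i" if k: "k < n" for k
    unfolding fdeg_def
  proof (intro CollectI allI impI)
    fix \<sigma> \<alpha> assume "raise k (Bop j k \<theta>) \<sigma> \<alpha> \<noteq> 0"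
    then have ks: "k \<in> \<sigma>" "Bop j k \<theta> (\<sigma> - {k}) \<alpha> \<noteq> 0" by (auto simp: raise_def split: if_splits)
    have "\<exists>l<\<mu>. shf l \<theta> (\<sigma> - {k}) \<alpha> \<noteq> 0"
    proof (rule ccontr)
      assume "\<not> ?thesis"
      then show False using ks(2) by (simp add: Bop_def)
    qed
    then obtain l where l: "l < \<mu>" "\<theta> (\<sigma> - {k}) (\<alpha>(l := Suc (\<alpha> l))) \<noteq> 0" by (auto simp: shf_def)
    have s: "\<sigma> - {k} \<subseteq> {..<n}" "\<forall>t\<ge>\<mu>. (\<alpha>(l := Suc (\<alpha> l))) t = 0"
        "card (\<sigma> - {k}) + 2 * (\<Sum>t<\<mu>. (\<alpha>(l := Suc (\<alpha> l))) t) = Suc i"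
      using fdegD[OF \<theta>, of "\<sigma> - {k}" "\<alpha>(l := Suc (\<alpha> l))"] l(2) by blast+
    have sn: "\<sigma> \<subseteq> {..<n}" using s(1) k by auto
    then have "card \<sigma> = Suc (card (\<sigma> - {k}))"
      using ks(1) finite_subset[OF sn] by (intro card.remove) auto
    moreover have "\<alpha> t = 0" if "t \<ge> \<mu>" for t using s(2)[rule_format, OF that] l(1) that by simp
    ultimately show "\<sigma> \<subseteq> {..<n} \<and> (\<forall>l\<ge>\<mu>. \<alpha> l = 0) \<and> card \<sigma> + 2 * (\<Sum>l<\<mu>. \<alpha> l) = i"
      using s(3) sn unfolding sum_upd[OF l(1)] by simp
  qed
  ultimately have "(\<lambda>\<sigma> \<alpha>. low j \<theta> \<sigma> \<alpha> + (\<Sum>k\<in>{..<n}. raise k (Bop j k \<theta>) \<sigma> \<alpha>)) \<in> fdeg i"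
    by (intro fdeg_add fdeg_sum) auto
  then show ?thesis unfolding D_def[abs_def] .
qed

lemma D_add: "D j (\<lambda>\<sigma> \<alpha>. f \<sigma> \<alpha> + g \<sigma> \<alpha>) = (\<lambda>\<sigma> \<alpha>. D j f \<sigma> \<alpha> + D j g \<sigma> \<alpha>)"
proof -
  have "Bop j k (\<lambda>\<sigma> \<alpha>. f \<sigma> \<alpha> + g \<sigma> \<alpha>) = (\<lambda>\<sigma> \<alpha>. Bop j k f \<sigma> \<alpha> + Bop j k g \<sigma> \<alpha>)" for k
    by (intro ext) (rule Bop_add)
  then show ?thesis by (intro ext) (simp add: D_def low_add raise_add sum.distrib)
qed

lemma D_scale: "D j (\<lambda>\<sigma> \<alpha>. c * f \<sigma> \<alpha>) = (\<lambda>\<sigma> \<alpha>. c * D j f \<sigma> \<alpha>)"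
  by (intro ext) (simp add: D_def low_def raise_def Bop_def shf_def sum_distrib_left distrib_left mult_ac if_distrib cong: if_cong)

text \<open>Dual to the generation of the Clifford algebra by the y_j. Squares and anticommutators
  of the operators \<open>D j\<close> vanish on \<open>\<theta>\<close>; by \<open>ind\<close>, the
  linear independence of the quadrics, each \<open>shf l\<close> kills \<open>\<theta>\<close> as
  well. Then \<open>D j\<close> reduces to \<open>low j\<close>, and an element of positive degree
  killed by all \<open>shf l\<close> and \<open>low j\<close> is zero.\<close>

lemma D_kernel:
  assumes ind: "\<And>c. (\<And>j. j < n \<Longrightarrow> (\<Sum>l<\<mu>. \<beta> l j j * c l) = 0) \<Longrightarrow>
      (\<And>j k. j < n \<Longrightarrow> k < n \<Longrightarrow> (\<Sum>l<\<mu>. \<beta> l j k * c l) + (\<Sum>l<\<mu>. \<beta> l k j * c l) = 0) \<Longrightarrow> \<forall>l<\<mu>. c l = 0"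
    and \<theta>: "\<theta> \<in> fdeg (Suc i)" and D0: "\<And>j. j < n \<Longrightarrow> D j \<theta> = (\<lambda>\<sigma> \<alpha>. 0)"
  shows "\<theta> = (\<lambda>\<sigma> \<alpha>. 0)"
proof -
  have DD: "D k (D j \<theta>) \<sigma> \<alpha> = 0" if "j < n" for j k \<sigma> \<alpha>
    unfolding D0[OF that] using D_scale[of k 0 "\<lambda>_ _. 0"] by simp
  have s0: "shf l \<theta> \<sigma> \<alpha> = 0" if "l < \<mu>" for l \<sigma> \<alpha>
  proof -
    have "\<forall>l<\<mu>. shf l \<theta> \<sigma> \<alpha> = 0"
    proof (rule ind)
      show "(\<Sum>l<\<mu>. \<beta> l j j * shf l \<theta> \<sigma> \<alpha>) = 0" if "j < n" for j
        using D_square[OF that, of \<theta> \<sigma> \<alpha>] DD[OF that] by (simp add: Bop_def)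
      show "(\<Sum>l<\<mu>. \<beta> l j k * shf l \<theta> \<sigma> \<alpha>) + (\<Sum>l<\<mu>. \<beta> l k j * shf l \<theta> \<sigma> \<alpha>) = 0" if "j < n" "k < n" for j k
        using D_anticommute[OF that, of \<theta> \<sigma> \<alpha>] DD[OF that(1)] DD[OF that(2)] by (simp add: Bop_def)
    qed
    then show ?thesis using that by blast
  qed
  have l0: "low j \<theta> \<sigma> \<alpha> = 0" if "j < n" for j \<sigma> \<alpha>
  proof -
    have "(\<Sum>k<n. raise k (Bop j k \<theta>) \<sigma> \<alpha>) = 0" using s0 by (intro sum.neutral) (simp add: raise_def Bop_def)
    then show ?thesis using fun_cong[OF fun_cong[OF D0[OF that]], of \<sigma> \<alpha>] by (simp add: D_def)
  qed
  have "\<theta> \<sigma> \<alpha> = 0" for \<sigma> \<alpha>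
  proof (rule ccontr)
    assume nz: "\<theta> \<sigma> \<alpha> \<noteq> 0"
    have s: "\<sigma> \<subseteq> {..<n}" "card \<sigma> + 2 * (\<Sum>l<\<mu>. \<alpha> l) = Suc i" using fdegD[OF \<theta>, of \<sigma> \<alpha>] nz by blast+
    have "\<alpha> l = 0" if "l < \<mu>" for l
    proof (rule ccontr)
      assume "\<alpha> l \<noteq> 0"
      then have "(\<alpha>(l := \<alpha> l - 1))(l := Suc ((\<alpha>(l := \<alpha> l - 1)) l)) = \<alpha>" by (auto simp: fun_eq_iff)
      then have "shf l \<theta> \<sigma> (\<alpha>(l := \<alpha> l - 1)) = \<theta> \<sigma> \<alpha>" by (simp only: shf_def)
      then show False using s0[OF that] nz by simp
    qed
    then have "card \<sigma> = Suc i" using s(2) by simp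
    then obtain j where j: "j \<in> \<sigma>" by (metis card.empty equals0I nat.distinct(1))
    then have "low j \<theta> (\<sigma> - {j}) \<alpha> = sg j (\<sigma> - {j}) * \<theta> \<sigma> \<alpha>" by (simp add: low_def insert_absorb)
    moreover have "sg j (\<sigma> - {j}) \<noteq> 0" using sg_sq[of j "\<sigma> - {j}"] by auto
    ultimately show False using l0[of j] j s(1) nz by auto
  qed
  then show ?thesis by (intro ext)
qed

end

section \<open>Betti numbers and the Hilbert series\<close>

locale linear_resolution = koszul_resolution scale A n b r e d \<epsilon>
  for scale :: "'k::field \<Rightarrow> 'a::comm_ring_1 \<Rightarrow> 'a" and A :: "nat \<Rightarrow> 'a set" and n :: nat
    and b :: "nat \<Rightarrow> 'a" and r e d \<epsilon> +
  fixes Z :: "nat \<Rightarrow> (nat \<Rightarrow> 'a) set" and q :: "nat \<Rightarrow> nat" and \<Gamma> :: "nat \<Rightarrow> nat \<Rightarrow> nat \<Rightarrow> 'a"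
  assumes Z_0: "Z 0 = irr" and basis: "\<And>i. linear_basis (Z i) (q i) (\<Gamma> i)"
    and Z_Suc: "\<And>i. Z (Suc i) = syzygies (q i) (\<Gamma> i)" and lin: "\<And>i. \<exists>p. linear_syzygy (Z i) p"
begin

definition betti :: "nat \<Rightarrow> nat" where
  "betti i = (case i of 0 \<Rightarrow> 1 | Suc i' \<Rightarrow> q i')"

lemma betti_simps [simp]: "betti 0 = 1" "betti (Suc i) = q i"
  by (simp_all add: betti_def)

lemma Z_submod: "\<exists>p. submod (Z i) p"
  using lin by (auto simp: linear_syzygy_def)

lemma part_Z_0: "fv.dim (part (Z i) 0) = 0"
proof -
  obtain p where p: "linear_syzygy (Z i) p" using lin by blast
  have "part (Z i) 0 = {0}"
  proof (intro subset_antisym subsetI)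
    fix z assume z: "z \<in> part (Z i) 0"
    then have "z = (\<lambda>_. 0)" using p unfolding linear_syzygy_def part_def by blast
    then show "z \<in> {0}" by (simp add: zero_fun_def)
  next
    fix z :: "nat \<Rightarrow> 'a" assume "z \<in> {0}"
    moreover have "(\<lambda>_. 0) \<in> Z i" using p submod_zero by (auto simp: linear_syzygy_def)
    ultimately show "z \<in> part (Z i) 0" by (simp add: part_def zero_fun_def)
  qed
  then show ?thesis using fv.has_dim_imp_dim[OF fv.has_dim_zero] by simp
qed

definition zs :: "nat \<Rightarrow> int fps" where
  "zs i = Abs_fps (\<lambda>s. int (fv.dim (part (Z i) s)))"

lemma zs_step: "of_nat (q i) * fps_X * hilbert_series = zs i + fps_X * zs (Suc i)"
proof (rule fps_ext)
  fix s
  obtain p where p: "linear_syzygy (Z i) p" using lin by blast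
  have "(of_nat (q i) * fps_X * hilbert_series) $ s = (if s = 0 then 0 else int (q i) * int (dim (A (s - 1))))"
    by (simp add: hilbert_series_def mult.assoc fps_mult_of_nat_nth)
  then show "(of_nat (q i) * fps_X * hilbert_series) $ s = (zs i + fps_X * zs (Suc i)) $ s"
    using syzygy_dims[OF p basis, of "s - 1"]
    by (cases s) (simp_all add: zs_def part_Z_0 Z_Suc of_nat_mult[symmetric] del: of_nat_mult)
qed

lemma dim_A0: "dim (A 0) = 1"
  using hf_0[OF hideal_ker] by (simp add: dim_A ker_def)

lemma zs_0: "hilbert_series = 1 + zs 0"
proof (rule fps_ext)
  fix s
  show "hilbert_series $ s = (1 + zs 0) $ s"
  proof (cases "s = 0")
    case True
    then show ?thesis by (simp add: hilbert_series_def zs_def part_Z_0 dim_A0)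
  next
    case False
    have "part (Z 0) s = part (free_module 1) s"
      using residue_pos[of _ s] residue_0_iff False by (auto simp: part_def Z_0 irr_def)
    then show ?thesis
      using False fv.has_dim_imp_dim[OF part_free_dim[of 1 s]] by (simp add: hilbert_series_def zs_def)
  qed
qed

text \<open>Telescoping: the Hilbert series times the partial sum up to \<open>m\<close> is 1 up to
  a signed term x^m \<open>zs m\<close>. As \<open>zs m\<close> has no constant term, the error does
  not reach degree \<open>m\<close>.\<close>

lemma poincare_hilbert: "hilbert_series * Abs_fps (\<lambda>i. (- 1) ^ i * int (betti i)) = 1"
proof (rule fps_ext)
  fix j
  let ?S = "\<lambda>m. \<Sum>i\<le>m. of_int ((- 1) ^ i * int (betti i)) * fps_X ^ i :: int fps"
  have "hilbert_series * ?S m = 1 + (- 1) ^ m * fps_X ^ m * zs m" for m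
  proof (induction m)
    case 0
    show ?case by (simp add: zs_0)
  next
    case (Suc m)
    have "hilbert_series * ?S (Suc m) = hilbert_series * ?S m
        + (- 1) ^ Suc m * fps_X ^ m * (of_nat (q m) * fps_X * hilbert_series)"
      by (simp add: distrib_left right_diff_distrib mult_ac)
    also have "\<dots> = 1 + (- 1) ^ Suc m * fps_X ^ Suc m * zs (Suc m)"
      unfolding Suc.IH zs_step by (simp add: algebra_simps)
    finally show ?case .
  qed
  then have "(hilbert_series * ?S j) $ j = (1 :: int fps) $ j + ((- 1) ^ j * (fps_X ^ j * zs j)) $ j"
    by (simp add: mult.assoc)
  also have "((- 1) ^ j * (fps_X ^ j * zs j)) $ j = 0"
    by (cases "even j") (simp_all add: fps_X_power_mult_nth zs_def part_Z_0)
  finally have "(hilbert_series * ?S j) $ j = (1 :: int fps) $ j" by simp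
  moreover have "(hilbert_series * Abs_fps (\<lambda>i. (- 1) ^ i * int (betti i))) $ j = (hilbert_series * ?S j) $ j"
    unfolding fps_mult_nth
  proof (intro sum.cong refl arg_cong2[where f = "(*)"])
    fix t assume t: "t \<in> {0..j}"
    have "?S j $ (j - t) = (\<Sum>i\<le>j. if i = j - t then (- 1) ^ i * int (betti i) else 0)"
      unfolding fps_sum_nth
    proof (intro sum.cong refl)
      fix i
      show "(of_int ((- 1) ^ i * int (betti i)) * fps_X ^ i :: int fps) $ (j - t)
          = (if i = j - t then (- 1) ^ i * int (betti i) else 0)"
        by (subst fps_of_int[symmetric]) (auto simp: fps_X_power_nth)
    qed
    then show "Abs_fps (\<lambda>i. (- 1) ^ i * int (betti i)) $ (j - t) = ?S j $ (j - t)" by simp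
  qed
  ultimately show "(hilbert_series * Abs_fps (\<lambda>i. (- 1) ^ i * int (betti i))) $ j = (1 :: int fps) $ j" by simp
qed

end

lemma (in fock) D_linear:
  "D j (\<lambda>\<sigma> \<alpha>. c * f \<sigma> \<alpha> + g \<sigma> \<alpha>) = (\<lambda>\<sigma> \<alpha>. c * D j f \<sigma> \<alpha> + D j g \<sigma> \<alpha>)"
  using D_add[of j "\<lambda>\<sigma> \<alpha>. c * f \<sigma> \<alpha>" g] D_scale[of j c f] by simp

text \<open>\<open>rel\<close> says that the quadrics with coefficients \<open>\<beta>\<close>
  vanish in the algebra, \<open>ind\<close> that they are linearly independent as polynomials: a
  quadric is zero iff its square coefficients and its symmetrised mixed coefficients are.\<close>

locale clifford_resolution = linear_resolution scale A n b r e d \<epsilon> Z q \<Gamma> + fock n \<mu> \<beta>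
  for scale :: "'k::field \<Rightarrow> 'a::comm_ring_1 \<Rightarrow> 'a" and A :: "nat \<Rightarrow> 'a set" and n :: nat
    and b :: "nat \<Rightarrow> 'a" and r e d \<epsilon> Z q \<Gamma> and \<mu> :: nat and \<beta> :: "nat \<Rightarrow> nat \<Rightarrow> nat \<Rightarrow> 'k" +
  assumes rel: "\<And>l. l < \<mu> \<Longrightarrow> (\<Sum>j<n. \<Sum>k<n. scale (\<beta> l j k) (b j * b k)) = 0"
    and ind: "\<And>c l. (\<And>j. j < n \<Longrightarrow> (\<Sum>l<\<mu>. \<beta> l j j * c l) = 0) \<Longrightarrow>
      (\<And>j k. j < n \<Longrightarrow> k < n \<Longrightarrow> (\<Sum>l<\<mu>. \<beta> l j k * c l) + (\<Sum>l<\<mu>. \<beta> l k j * c l) = 0) \<Longrightarrow>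
      l < \<mu> \<Longrightarrow> c l = 0"
begin

text \<open>Coordinates beyond \<open>q i\<close> are fixed to be 0, which makes the choice
  unique.\<close>

definition coords :: "nat \<Rightarrow> (nat \<Rightarrow> 'a) \<Rightarrow> nat \<Rightarrow> 'k" where
  "coords i z = (SOME k. (\<forall>c\<ge>q i. k c = 0) \<and> z = (\<lambda>t. \<Sum>c<q i. scale (k c) (\<Gamma> i c t)))"

lemma coords:
  assumes "z \<in> part (Z i) 1"
  shows "\<forall>c\<ge>q i. coords i z c = 0" "(\<Sum>c<q i. scale (coords i z c) (\<Gamma> i c t)) = z t"
proof -
  obtain k where k: "z = (\<lambda>t. \<Sum>c<q i. scale (k c) (\<Gamma> i c t))"
    using basis[of i] assms unfolding linear_basis_def part_def by blast
  have "\<exists>k. (\<forall>c\<ge>q i. k c = 0) \<and> z = (\<lambda>t. \<Sum>c<q i. scale (k c) (\<Gamma> i c t))"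
    by (rule exI[of _ "\<lambda>c. if c < q i then k c else 0"]) (simp add: k)
  from someI_ex[OF this] have "(\<forall>c\<ge>q i. coords i z c = 0)
      \<and> z = (\<lambda>t. \<Sum>c<q i. scale (coords i z c) (\<Gamma> i c t))"
    unfolding coords_def .
  then show "\<forall>c\<ge>q i. coords i z c = 0" "(\<Sum>c<q i. scale (coords i z c) (\<Gamma> i c t)) = z t"
    by (auto dest: fun_cong[of z _ t])
qed

lemma coords_unique:
  assumes "z \<in> part (Z i) 1" "\<And>c. q i \<le> c \<Longrightarrow> k c = 0" "\<And>t. z t = (\<Sum>c<q i. scale (k c) (\<Gamma> i c t))"
  shows "coords i z = k"
proof
  fix c
  have "(\<lambda>t. \<Sum>c<q i. scale (coords i z c - k c) (\<Gamma> i c t)) = (\<lambda>_. 0)"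
    using coords(2)[OF assms(1)] assms(3) by (simp add: scale_left_diff_distrib sum_subtractf)
  moreover have "\<forall>k. (\<lambda>t. \<Sum>c<q i. scale (k c) (\<Gamma> i c t)) = (\<lambda>_. 0) \<longrightarrow> (\<forall>c<q i. k c = 0)"
    using basis[of i] unfolding linear_basis_def by simp
  ultimately have "\<forall>c<q i. coords i z c - k c = 0"
    using spec[of _ "\<lambda>c. coords i z c - k c"] by blast
  then show "coords i z c = k c" using coords(1)[OF assms(1)] assms(2)[of c] by (cases "c < q i") auto
qed

text \<open>The comparison map from the dual of the Clifford algebra to the linear resolution.\<close>

primrec \<phi> :: "nat \<Rightarrow> (nat set \<Rightarrow> (nat \<Rightarrow> nat) \<Rightarrow> 'k) \<Rightarrow> nat \<Rightarrow> 'k" where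
  "\<phi> 0 \<theta> t = (if t = 0 then \<theta> {} (\<lambda>_. 0) else 0)"
| "\<phi> (Suc i) \<theta> t = coords i (\<lambda>t. \<Sum>j<n. scale (\<phi> i (D j \<theta>) t) (b j)) t"

declare \<phi>.simps(2) [simp del]

text \<open>The differential \<Sum> x_j \<otimes> D_j of the Clifford module followed by the
  comparison map: a vector of linear forms, whose coordinates in the basis \<open>\<Gamma> i\<close>
  are \<open>\<phi> (Suc i)\<close>.\<close>

definition \<zeta> :: "nat \<Rightarrow> (nat set \<Rightarrow> (nat \<Rightarrow> nat) \<Rightarrow> 'k) \<Rightarrow> nat \<Rightarrow> 'a" where
  "\<zeta> i \<theta> t = (\<Sum>j<n. scale (\<phi> i (D j \<theta>) t) (b j))"

lemma \<phi>_Suc: "\<phi> (Suc i) \<theta> = coords i (\<zeta> i \<theta>)"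
  by (rule ext) (simp add: \<zeta>_def[abs_def] \<phi>.simps(2))

text \<open>Named as a predicate because linearity of \<open>\<phi> i\<close> and membership of
  \<open>\<zeta> i\<close> in the syzygy module need a joint induction: \<open>coords\<close> is
  meaningful only on that module.\<close>

definition \<phi>_linear :: "nat \<Rightarrow> bool" where
  "\<phi>_linear i \<longleftrightarrow> (\<forall>f\<in>fdeg i. \<forall>g\<in>fdeg i. \<forall>c t.
     \<phi> i (\<lambda>\<sigma> \<alpha>. c * f \<sigma> \<alpha> + g \<sigma> \<alpha>) t = c * \<phi> i f t + \<phi> i g t)"

lemma \<phi>_linearD:
  "\<phi>_linear i \<Longrightarrow> f \<in> fdeg i \<Longrightarrow> g \<in> fdeg i \<Longrightarrow>
    \<phi> i (\<lambda>\<sigma> \<alpha>. c * f \<sigma> \<alpha> + g \<sigma> \<alpha>) t = c * \<phi> i f t + \<phi> i g t"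
  by (simp add: \<phi>_linear_def)

lemma \<phi>_zero: "\<phi>_linear i \<Longrightarrow> \<phi> i (\<lambda>\<sigma> \<alpha>. 0) t = 0"
  using \<phi>_linearD[of i "\<lambda>\<sigma> \<alpha>. 0" "\<lambda>\<sigma> \<alpha>. 0" "- 1" t] fdeg_zero by simp

lemma \<phi>_sum:
  assumes "\<phi>_linear i" "finite T" "\<And>l. l \<in> T \<Longrightarrow> f l \<in> fdeg i"
  shows "\<phi> i (\<lambda>\<sigma> \<alpha>. \<Sum>l\<in>T. c l * f l \<sigma> \<alpha>) t = (\<Sum>l\<in>T. c l * \<phi> i (f l) t)"
  using assms(2,3)
proof (induction T rule: finite_induct)
  case empty
  then show ?case using \<phi>_zero[OF assms(1)] by simp
next
  case (insert l T)
  have "(\<lambda>\<sigma> \<alpha>. \<Sum>l\<in>T. c l * f l \<sigma> \<alpha>) \<in> fdeg i"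
    using insert.prems by (intro fdeg_sum fdeg_scale) auto
  then have "\<phi> i (\<lambda>\<sigma> \<alpha>. c l * f l \<sigma> \<alpha> + (\<Sum>l\<in>T. c l * f l \<sigma> \<alpha>)) t
      = c l * \<phi> i (f l) t + \<phi> i (\<lambda>\<sigma> \<alpha>. \<Sum>l\<in>T. c l * f l \<sigma> \<alpha>) t"
    by (rule \<phi>_linearD[OF assms(1) insert.prems[OF insertI1]])
  then show ?case using insert by simp
qed

lemma \<zeta>_linear:
  assumes "\<phi>_linear i" "f \<in> fdeg (Suc i)" "g \<in> fdeg (Suc i)"
  shows "\<zeta> i (\<lambda>\<sigma> \<alpha>. c * f \<sigma> \<alpha> + g \<sigma> \<alpha>) t = scale c (\<zeta> i f t) + \<zeta> i g t"
proof -
  have "\<phi> i (D j (\<lambda>\<sigma> \<alpha>. c * f \<sigma> \<alpha> + g \<sigma> \<alpha>)) t = c * \<phi> i (D j f) t + \<phi> i (D j g) t" if "j < n" for j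
    unfolding D_linear by (rule \<phi>_linearD[OF assms(1) D_fdeg[OF that assms(2)] D_fdeg[OF that assms(3)]])
  then show ?thesis
    by (simp add: \<zeta>_def scale_left_distrib sum.distrib scale_sum_right)
qed

lemma \<zeta>_A1: "\<zeta> i \<theta> t \<in> A 1"
  unfolding \<zeta>_def by (intro A_sum A_scale b_A1) simp

text \<open>The differential squares to zero: by the Clifford relations \<Sum> x_j x_k D_k D_j
  equals \<Sum> f_l \<open>shf l\<close>, and the quadrics f_l vanish in the algebra. The
  \<open>D k (D j \<theta>)\<close> are replaced by \<open>Bop\<close> inside an alternating sum,
  with \<open>D_square\<close> on the diagonal.\<close>

lemma quadratic_relation:
  assumes lin: "\<phi>_linear i" and \<theta>: "\<theta> \<in> fdeg (Suc (Suc i))"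
  shows "(\<Sum>j<n. \<Sum>k<n. scale (\<phi> i (D k (D j \<theta>)) t) (b j * b k)) = 0"
proof -
  have DD: "D k (D j \<theta>) \<in> fdeg i" if "j < n" "k < n" for j k
    using D_fdeg[OF that(2) D_fdeg[OF that(1) \<theta>]] .
  have B: "Bop j k \<theta> \<in> fdeg i" for j k using Bop_fdeg[OF \<theta>] .
  have \<phi>B: "\<phi> i (Bop j k \<theta>) t = (\<Sum>l<\<mu>. \<beta> l j k * \<phi> i (shf l \<theta>) t)" for j k
    unfolding Bop_def[abs_def] by (rule \<phi>_sum[OF lin]) (auto intro: shf_fdeg[OF _ \<theta>])
  have \<phi>D: "\<phi> i (D k (D j \<theta>)) t + \<phi> i (D j (D k \<theta>)) t = \<phi> i (Bop j k \<theta>) t + \<phi> i (Bop k j \<theta>) t"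
    if "j < n" "k < n" for j k
  proof -
    have "(\<lambda>\<sigma> \<alpha>. 1 * D k (D j \<theta>) \<sigma> \<alpha> + D j (D k \<theta>) \<sigma> \<alpha>) = (\<lambda>\<sigma> \<alpha>. 1 * Bop j k \<theta> \<sigma> \<alpha> + Bop k j \<theta> \<sigma> \<alpha>)"
      using D_anticommute[OF that, of \<theta>] by (intro ext) (simp add: add.commute)
    from arg_cong[OF this, of "\<lambda>x. \<phi> i x t"] show ?thesis
      unfolding \<phi>_linearD[OF lin DD[OF that] DD[OF that(2,1)]] \<phi>_linearD[OF lin B[of j k] B[of k j]] by simp
  qed
  have "(\<Sum>j<n. \<Sum>k<n. scale (\<phi> i (D k (D j \<theta>)) t - \<phi> i (Bop j k \<theta>) t) (b j * b k)) = 0"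
  proof (rule alternating_sum_zero)
    fix j k assume jk: "j < n" "k < n"
    have "scale x (b j * b k) + scale y (b k * b j) = scale (x + y) (b j * b k)" for x y
      by (simp add: scale_left_distrib mult.commute)
    moreover have "(u - v) + (u' - v') = 0" if "u + u' = v + v'" for u u' v v' :: 'k
      using that by (simp add: algebra_simps)
    ultimately show "scale (\<phi> i (D k (D j \<theta>)) t - \<phi> i (Bop j k \<theta>) t) (b j * b k)
        + scale (\<phi> i (D j (D k \<theta>)) t - \<phi> i (Bop k j \<theta>) t) (b k * b j) = 0"
      using \<phi>D[OF jk] by simp
  next
    fix j assume j: "j < n"
    have "D j (D j \<theta>) = Bop j j \<theta>" using D_square[OF j, of \<theta>] by (intro ext)
    then show "scale (\<phi> i (D j (D j \<theta>)) t - \<phi> i (Bop j j \<theta>) t) (b j * b j) = 0" by simp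
  qed
  then have "(\<Sum>j<n. \<Sum>k<n. scale (\<phi> i (D k (D j \<theta>)) t) (b j * b k))
      = (\<Sum>j<n. \<Sum>k<n. scale (\<phi> i (Bop j k \<theta>) t) (b j * b k))"
    by (simp add: scale_left_diff_distrib sum_subtractf)
  also have "\<dots> = (\<Sum>j<n. \<Sum>k<n. \<Sum>l<\<mu>. scale (\<phi> i (shf l \<theta>) t) (scale (\<beta> l j k) (b j * b k)))"
    unfolding \<phi>B by (simp add: scale_sum_left mult.commute)
  also have "\<dots> = (\<Sum>j<n. \<Sum>l<\<mu>. \<Sum>k<n. scale (\<phi> i (shf l \<theta>) t) (scale (\<beta> l j k) (b j * b k)))"
    by (rule sum.cong[OF refl]) (rule sum.swap)
  also have "\<dots> = (\<Sum>l<\<mu>. \<Sum>j<n. \<Sum>k<n. scale (\<phi> i (shf l \<theta>) t) (scale (\<beta> l j k) (b j * b k)))"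
    by (rule sum.swap)
  also have "\<dots> = (\<Sum>l<\<mu>. scale (\<phi> i (shf l \<theta>) t) (\<Sum>j<n. \<Sum>k<n. scale (\<beta> l j k) (b j * b k)))"
    by (simp add: scale_sum_right)
  also have "\<dots> = 0" by (intro sum.neutral ballI) (simp add: rel)
  finally show ?thesis .
qed

lemma \<phi>_step:
  assumes lin: "\<phi>_linear i" and \<zeta>: "\<And>\<theta>. \<theta> \<in> fdeg (Suc i) \<Longrightarrow> \<zeta> i \<theta> \<in> part (Z i) 1"
  shows "\<phi>_linear (Suc i)"
  unfolding \<phi>_linear_def
proof (intro ballI allI)
  fix f g c t assume fg: "f \<in> fdeg (Suc i)" "g \<in> fdeg (Suc i)"
  let ?h = "\<lambda>\<sigma> \<alpha>. c * f \<sigma> \<alpha> + g \<sigma> \<alpha>"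
  have h: "?h \<in> fdeg (Suc i)" using fdeg_add[OF fdeg_scale[OF fg(1), of c] fg(2)] .
  have "coords i (\<zeta> i ?h) = (\<lambda>t. c * coords i (\<zeta> i f) t + coords i (\<zeta> i g) t)"
  proof (rule coords_unique[OF \<zeta>[OF h]])
    show "c * coords i (\<zeta> i f) t + coords i (\<zeta> i g) t = 0" if "q i \<le> t" for t
      using that coords(1)[OF \<zeta>[OF fg(1)]] coords(1)[OF \<zeta>[OF fg(2)]] by simp
    show "\<zeta> i ?h t = (\<Sum>s<q i. scale (c * coords i (\<zeta> i f) s + coords i (\<zeta> i g) s) (\<Gamma> i s t))" for t
    proof -
      have "(\<Sum>s<q i. scale (c * coords i (\<zeta> i f) s + coords i (\<zeta> i g) s) (\<Gamma> i s t))
          = scale c (\<Sum>s<q i. scale (coords i (\<zeta> i f) s) (\<Gamma> i s t)) + (\<Sum>s<q i. scale (coords i (\<zeta> i g) s) (\<Gamma> i s t))"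
        by (simp add: scale_left_distrib sum.distrib scale_sum_right)
      also have "\<dots> = \<zeta> i ?h t"
        unfolding coords(2)[OF \<zeta>[OF fg(1)]] coords(2)[OF \<zeta>[OF fg(2)]] \<zeta>_linear[OF lin fg] ..
      finally show ?thesis by simp
    qed
  qed
  then show "\<phi> (Suc i) ?h t = c * \<phi> (Suc i) f t + \<phi> (Suc i) g t" unfolding \<phi>_Suc by simp
qed

lemma \<zeta>_step:
  assumes lin: "\<phi>_linear i" and \<zeta>: "\<And>\<theta>. \<theta> \<in> fdeg (Suc i) \<Longrightarrow> \<zeta> i \<theta> \<in> part (Z i) 1"
    and \<theta>: "\<theta> \<in> fdeg (Suc (Suc i))"
  shows "\<zeta> (Suc i) \<theta> \<in> part (Z (Suc i)) 1"
proof -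
  have z: "\<zeta> i (D j \<theta>) \<in> part (Z i) 1" if "j < n" for j using \<zeta>[OF D_fdeg[OF that \<theta>]] .
  have "(\<Sum>c<q i. \<zeta> (Suc i) \<theta> c * \<Gamma> i c t) = 0" for t
  proof -
    have "(\<Sum>c<q i. \<zeta> (Suc i) \<theta> c * \<Gamma> i c t)
        = (\<Sum>c<q i. \<Sum>j<n. b j * scale (coords i (\<zeta> i (D j \<theta>)) c) (\<Gamma> i c t))"
      unfolding \<zeta>_def[of "Suc i"] \<phi>_Suc sum_distrib_right
      by (intro sum.cong refl) (simp add: scale_mult_left[symmetric] scale_mult_right[symmetric])
    also have "\<dots> = (\<Sum>j<n. b j * (\<Sum>c<q i. scale (coords i (\<zeta> i (D j \<theta>)) c) (\<Gamma> i c t)))"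
      by (subst sum.swap) (simp add: sum_distrib_left)
    also have "\<dots> = (\<Sum>j<n. b j * \<zeta> i (D j \<theta>) t)"
      by (intro sum.cong refl) (simp add: coords(2)[OF z])
    also have "\<dots> = (\<Sum>j<n. \<Sum>k<n. scale (\<phi> i (D k (D j \<theta>)) t) (b j * b k))"
      unfolding \<zeta>_def by (simp add: sum_distrib_left scale_mult_right)
    also have "\<dots> = 0" by (rule quadratic_relation[OF lin \<theta>])
    finally show ?thesis .
  qed
  moreover have "\<zeta> (Suc i) \<theta> c = 0" if "q i \<le> c" for c
    unfolding \<zeta>_def[of "Suc i"] \<phi>_Suc using coords(1)[OF z] that by (intro sum.neutral) auto
  ultimately show ?thesis
    using \<zeta>_A1 by (simp add: part_def Z_Suc syzygies_def free_module_def)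
qed

lemma \<zeta>_0: "\<zeta> 0 \<theta> \<in> part (Z 0) 1"
proof -
  have "\<zeta> 0 \<theta> 0 \<in> irrelevant" using \<zeta>_A1 residue_pos[of _ 1] residue_0_iff by auto
  moreover have "\<zeta> 0 \<theta> c = 0" if "1 \<le> c" for c using that by (simp add: \<zeta>_def)
  ultimately show ?thesis using \<zeta>_A1 by (simp add: part_def Z_0 irr_def free_module_def)
qed

lemma \<phi>_linear: "\<phi>_linear i" and \<zeta>_part: "\<theta> \<in> fdeg (Suc i) \<Longrightarrow> \<zeta> i \<theta> \<in> part (Z i) 1"
proof -
  have "\<phi>_linear i \<and> (\<forall>\<theta>. \<theta> \<in> fdeg (Suc i) \<longrightarrow> \<zeta> i \<theta> \<in> part (Z i) 1)"
  proof (induction i)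
    case 0
    then show ?case using \<zeta>_0 by (simp add: \<phi>_linear_def)
  next
    case (Suc i)
    then show ?case using \<phi>_step[of i] \<zeta>_step[of i] by blast
  qed
  then show "\<phi>_linear i" "\<theta> \<in> fdeg (Suc i) \<Longrightarrow> \<zeta> i \<theta> \<in> part (Z i) 1" by blast+
qed

text \<open>If the linear form with coefficients \<open>\<phi> i (D j \<theta>)\<close> vanishes, so
  does each coefficient, the \<open>b j\<close> being independent. Inductively every
  \<open>D j \<theta>\<close> is 0, and \<open>D_kernel\<close> applies.\<close>

lemma \<zeta>_injective:
  assumes "\<theta> \<in> fdeg (Suc i)" "\<And>t. \<zeta> i \<theta> t = 0"
  shows "\<theta> = (\<lambda>\<sigma> \<alpha>. 0)"
  using assms
proof (induction i arbitrary: \<theta>)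
  case 0
  have "D j \<theta> = (\<lambda>\<sigma> \<alpha>. 0)" if "j < n" for j
  proof (intro ext, rule ccontr)
    fix \<sigma> \<alpha> assume nz: "D j \<theta> \<sigma> \<alpha> \<noteq> 0"
    have s: "\<sigma> \<subseteq> {..<n} \<and> (\<forall>l\<ge>\<mu>. \<alpha> l = 0) \<and> card \<sigma> + 2 * (\<Sum>l<\<mu>. \<alpha> l) = 0"
      using fdegD[OF D_fdeg[OF that 0(1)], of \<sigma> \<alpha>] nz by blast
    then have "finite \<sigma>" using finite_subset[of \<sigma> "{..<n}"] by simp
    then have "\<sigma> = {}" using s by simp
    moreover have "\<alpha> = (\<lambda>_. 0)"
    proof
      show "\<alpha> l = 0" for l using s by (cases "l < \<mu>") auto
    qed
    ultimately have "\<phi> 0 (D j \<theta>) 0 \<noteq> 0" using nz by simp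
    then show False
      using vs.family_independentD[OF b_inj b_indep finite_lessThan, of "\<lambda>j. \<phi> 0 (D j \<theta>) 0" j] 0(2)[of 0] that
      unfolding \<zeta>_def by blast
  qed
  then show ?case using D_kernel[OF _ 0(1)] ind by blast
next
  case (Suc i)
  have "D j \<theta> = (\<lambda>\<sigma> \<alpha>. 0)" if j: "j < n" for j
  proof (rule Suc.IH[OF D_fdeg[OF j Suc.prems(1)]])
    fix t
    have "coords i (\<zeta> i (D j \<theta>)) c = 0" for c
      using vs.family_independentD[OF b_inj b_indep finite_lessThan, of "\<lambda>j. \<phi> (Suc i) (D j \<theta>) c" j] Suc.prems(2)[of c] j
      unfolding \<zeta>_def[of "Suc i"] \<phi>_Suc by blast
    then show "\<zeta> i (D j \<theta>) t = 0"
      using coords(2)[OF \<zeta>_part[OF D_fdeg[OF j Suc.prems(1)]], of t] by simp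
  qed
  then show ?case using D_kernel[OF _ Suc.prems(1)] ind by blast
qed

lemma \<zeta>_sum:
  assumes "finite T" "\<And>l. l \<in> T \<Longrightarrow> f l \<in> fdeg (Suc i)"
  shows "\<zeta> i (\<lambda>\<sigma> \<alpha>. \<Sum>l\<in>T. c l * f l \<sigma> \<alpha>) t = (\<Sum>l\<in>T. scale (c l) (\<zeta> i (f l) t))"
  using assms
proof (induction T rule: finite_induct)
  case empty
  have "\<zeta> i (\<lambda>\<sigma> \<alpha>. 0) t + \<zeta> i (\<lambda>\<sigma> \<alpha>. 0) t = \<zeta> i (\<lambda>\<sigma> \<alpha>. 0) t"
    using \<zeta>_linear[OF \<phi>_linear fdeg_zero fdeg_zero, of i 1 t] by simp
  then show ?case by simp
next
  case (insert l T)
  have "(\<lambda>\<sigma> \<alpha>. \<Sum>l\<in>T. c l * f l \<sigma> \<alpha>) \<in> fdeg (Suc i)"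
    using insert.prems by (intro fdeg_sum fdeg_scale) auto
  then have "\<zeta> i (\<lambda>\<sigma> \<alpha>. c l * f l \<sigma> \<alpha> + (\<Sum>l\<in>T. c l * f l \<sigma> \<alpha>)) t
      = scale (c l) (\<zeta> i (f l) t) + \<zeta> i (\<lambda>\<sigma> \<alpha>. \<Sum>l\<in>T. c l * f l \<sigma> \<alpha>) t"
    by (rule \<zeta>_linear[OF \<phi>_linear insert.prems[OF insertI1]])
  then show ?case using insert by simp
qed

text \<open>Only the duals of the monomials in the z_l are counted: those of degree \<open>p\<close>
  have Clifford degree \<open>2 * p\<close>, and \<open>\<zeta>\<close> maps them to independent
  elements of the degree-one part of a syzygy module.\<close>

lemma geo_le_betti: "geo \<mu> $ p \<le> betti (2 * p)"
proof (cases p)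
  case 0
  have "geo \<mu> $ 0 = 1" by (simp add: geo_def fps_nth_power_0)
  then show ?thesis using 0 by simp
next
  case (Suc p')
  define i where "i = Suc (2 * p')"
  have i: "2 * p = Suc i" by (simp add: i_def Suc)
  interpret S: spoly \<mu> .
  define M where "M = {m. supp m \<subseteq> {..<\<mu>} \<and> weighted_degree unit_weight m = p}"
  have finM: "finite M" unfolding M_def by (rule S.finite_monomials)
  define \<theta> where "\<theta> m \<sigma> \<alpha> = (if \<sigma> = {} \<and> \<alpha> = cf m then 1 else (0 :: 'k))"
    for m :: "nat \<Rightarrow>\<^sub>0 nat" and \<sigma> :: "nat set" and \<alpha>
  have \<theta>: "\<theta> m \<in> fdeg (Suc i)" if "m \<in> M" for m
  proof -
    have "(\<Sum>l<\<mu>. cf m l) = p"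
      using that weighted_degree_superset[of "{..<\<mu>}" m unit_weight] by (simp add: M_def unit_weight_def)
    moreover have "cf m l = 0" if "\<mu> \<le> l" for l using \<open>m \<in> M\<close> that by (force simp: M_def in_keys_iff)
    ultimately show ?thesis by (auto simp: fdeg_def \<theta>_def i[symmetric])
  qed
  have "card M \<le> fv.dim (part (Z i) 1)"
  proof (rule fv.family_card_le_dim[OF part_dim finM])
    obtain p' where "submod (Z i) p'" using Z_submod by blast
    then show "submod (Z i) (SOME p'. submod (Z i) p')" by (rule someI)
    show "\<zeta> i (\<theta> m) \<in> part (Z i) 1" if "m \<in> M" for m using \<zeta>_part[OF \<theta>[OF that]] .
    fix k assume k: "(\<Sum>m\<in>M. fscale (k m) (\<zeta> i (\<theta> m))) = 0"
    have "(\<lambda>\<sigma> \<alpha>. \<Sum>m\<in>M. k m * \<theta> m \<sigma> \<alpha>) = (\<lambda>\<sigma> \<alpha>. 0)"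
    proof (rule \<zeta>_injective)
      show "(\<lambda>\<sigma> \<alpha>. \<Sum>m\<in>M. k m * \<theta> m \<sigma> \<alpha>) \<in> fdeg (Suc i)"
        using \<theta> by (intro fdeg_sum fdeg_scale) auto
      show "\<zeta> i (\<lambda>\<sigma> \<alpha>. \<Sum>m\<in>M. k m * \<theta> m \<sigma> \<alpha>) t = 0" for t
        using fun_cong[OF k, of t] \<zeta>_sum[OF finM \<theta>, where c = k and t = t] by (simp add: fun_sum_apply fscale_def)
    qed
    then have "(\<Sum>m\<in>M. k m * \<theta> m {} (cf m')) = 0" for m' by (rule fun_cong[OF fun_cong])
    moreover have "(\<Sum>m\<in>M. k m * \<theta> m {} (cf m')) = (\<Sum>m\<in>M. if m = m' then k m else 0)" for m'
      by (intro sum.cong refl) (auto simp: \<theta>_def lookup_inject)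
    ultimately have "(if m' \<in> M then k m' else 0) = 0" for m' using finM by simp
    then show "\<forall>m\<in>M. k m = 0" by metis
  qed
  then have "card M \<le> betti (2 * p)"
    using linear_basis_dim[OF _ basis[of i]] Z_submod[of i] unfolding i by auto
  \<comment> \<open>The number of monomials is bounded below through the Hilbert function of the
    polynomial ring in \<open>\<mu>\<close> variables.\<close>
  moreover have "geo \<mu> $ p \<le> card M"
  proof -
    have "geo \<mu> $ p = real (S.hf ({0} :: 'k mpoly set) p)"
      unfolding S.hs_zero_std[symmetric, where ?'k = 'k] by (simp add: S.hs_def)
    also have "S.hf ({0} :: 'k mpoly set) p \<le> mp.dim (S.C p :: 'k mpoly set)" by (simp add: S.hf_def)
    also have "mp.dim (S.C p :: 'k mpoly set) \<le> card ((\<lambda>m. mterm m 1 :: 'k mpoly) ` M)"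
      using S.C_span[of p, where ?'k = 'k] finM by (intro mp.dim_le_card) (simp_all add: M_def)
    also have "\<dots> \<le> card M" using finM by (rule card_image_le)
    finally show ?thesis by simp
  qed
  ultimately show ?thesis by linarith
qed

end

section \<open>The numerator of the Hilbert series\<close>

definition fps_of_int_fps :: "int fps \<Rightarrow> 'r::comm_ring_1 fps" where
  "fps_of_int_fps f = Abs_fps (\<lambda>i. of_int (f $ i))"

lemma fps_of_int_fps_nth [simp]: "fps_of_int_fps f $ i = of_int (f $ i)"
  by (simp add: fps_of_int_fps_def)

lemma fps_of_int_fps_mult: "fps_of_int_fps (f * g) = fps_of_int_fps f * fps_of_int_fps g"
  by (rule fps_ext) (simp add: fps_mult_nth)

lemma fps_of_int_fps_1 [simp]: "fps_of_int_fps 1 = 1"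
  by (rule fps_ext) simp

lemma fps_of_int_fps_power: "fps_of_int_fps (f ^ m) = fps_of_int_fps f ^ m"
  by (induction m) (simp_all add: fps_of_int_fps_mult)

lemma fps_of_int_fps_one_minus_X [simp]: "fps_of_int_fps (1 - fps_X) = 1 - fps_X"
  by (rule fps_ext) (simp add: fps_X_def)

lemma fps_of_int_fps_poly: "fps_of_int_fps (fps_of_poly p) = fps_of_poly (map_poly of_int p)"
  by (rule fps_ext) (simp add: coeff_map_poly)

lemma poly_map_of_int: "poly (map_poly of_int p) (of_int z :: 'r::comm_ring_1) = of_int (poly p z)"
  by (induction p) (simp_all add: map_poly_pCons)

lemma poly_map_of_real: "poly (map_poly of_int p) (of_real z :: complex) = of_real (poly (map_poly of_int p) z)"
  by (induction p) (simp_all add: map_poly_pCons)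

lemma map_poly_of_int_mult:
  "map_poly of_int (p * q) = (map_poly of_int p * map_poly of_int q :: 'r::comm_ring_1 poly)"
  by (rule poly_eqI) (simp add: coeff_map_poly coeff_mult)

lemma map_poly_of_int_power: "map_poly of_int (p ^ m) = (map_poly of_int p ^ m :: 'r::comm_ring_1 poly)"
  by (induction m) (simp_all add: map_poly_of_int_mult)

text \<open>The terms of even index alone, read as a series in x^2, already dominate 1 / (1 -
  x^2)^\<mu>.\<close>

lemma eval_geo_square_le:
  fixes B :: "nat \<Rightarrow> real"
  assumes le: "\<And>p. geo \<mu> $ p \<le> B (2 * p)" and B: "\<And>i. 0 \<le> B i"
    and s: "summable (\<lambda>i. B i * x ^ i)" and x: "0 < x" "x < 1"
  shows "1 / (1 - x ^ 2) ^ \<mu> \<le> suminf (\<lambda>i. B i * x ^ i)"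
proof -
  have x2: "0 < x ^ 2" "x ^ 2 < 1" using x by (simp_all add: power_less_one_iff)
  have "eval_fps (geo \<mu>) (x ^ 2) \<le> suminf (\<lambda>i. B i * x ^ i)"
    unfolding eval_fps_def
  proof (rule suminf_le_const)
    show "summable (\<lambda>p. geo \<mu> $ p * (x ^ 2) ^ p)"
      using x2 conv_radius_geo[of \<mu>] by (intro summable_fps) (simp add: less_le_trans[of _ 1])
    fix R
    have "(\<Sum>p<R. geo \<mu> $ p * (x ^ 2) ^ p) \<le> (\<Sum>p<R. B (2 * p) * x ^ (2 * p))"
      using le x by (intro sum_mono) (simp add: power_mult mult_right_mono)
    also have "\<dots> = (\<Sum>i\<in>(*) 2 ` {..<R}. B i * x ^ i)"
      by (subst sum.reindex) (auto simp: inj_on_def)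
    also have "\<dots> \<le> suminf (\<lambda>i. B i * x ^ i)"
      using s B x by (intro sum_le_suminf) auto
    finally show "(\<Sum>p<R. geo \<mu> $ p * (x ^ 2) ^ p) \<le> suminf (\<lambda>i. B i * x ^ i)" .
  qed
  then show ?thesis unfolding eval_geo[OF x2] .
qed

lemma numerator_at_one_ge:
  fixes N :: "int poly" and H :: "int fps" and B :: "nat \<Rightarrow> nat"
  assumes HN: "H * (1 - fps_X) ^ d = fps_of_poly N"
    and HB: "H * Abs_fps (\<lambda>i. (- 1) ^ i * int (B i)) = 1"
    and N0: "poly N 0 = 1" and N1: "0 < poly N 1" and kron: "kronecker_poly N"
    and le: "\<And>p. geo \<mu> $ p \<le> B (2 * p)"
  shows "2 ^ \<mu> \<le> poly N 1"
proof -
  define Q where "Q = Abs_fps (\<lambda>i. (- 1) ^ i * int (B i))"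
  define Nc :: "complex poly" where "Nc = map_poly of_int N"
  define Nr :: "real poly" where "Nr = map_poly of_int N"
  define Qc :: "complex fps" where "Qc = fps_of_int_fps Q"
  define Xd :: "complex poly" where "Xd = (1 - monom 1 1) ^ d"
  have Xd: "fps_of_poly Xd = (1 - fps_X) ^ d"
    by (simp add: Xd_def fps_of_poly_power fps_of_poly_diff fps_of_poly_monom')
  have "fps_of_poly N * Q = (H * Q) * (1 - fps_X) ^ d" unfolding HN[symmetric] by (simp only: mult_ac)
  then have "fps_of_poly N * Q = (1 - fps_X) ^ d" using HB by (simp add: Q_def)
  from arg_cong[OF this, of "fps_of_int_fps :: int fps \<Rightarrow> complex fps"]
  have NQ: "fps_of_poly Nc * Qc = fps_of_poly Xd"
    by (simp add: fps_of_int_fps_mult fps_of_int_fps_power fps_of_int_fps_poly Nc_def Qc_def Xd)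
  have Nc0: "coeff Nc 0 = 1" using N0 by (simp add: Nc_def coeff_map_poly poly_0_coeff_0)
  \<comment> \<open>Roots on the unit circle leave none in the open disc, so the inverse of
    \<open>N\<close>, and with it \<open>Q\<close>, converges there.\<close>
  have nz: "eval_fps (fps_of_poly Nc) z \<noteq> 0" if "ereal (norm z) < 1" for z
    using kron that unfolding kronecker_poly_def Nc_def by (auto simp: one_ereal_def)
  have "1 \<le> fps_conv_radius (inverse (fps_of_poly Nc))"
    using fps_conv_radius_inverse[of 1 "fps_of_poly Nc"] nz by (simp add: one_ereal_def[symmetric])
  moreover have "Qc = fps_of_poly Xd * inverse (fps_of_poly Nc)"
    unfolding NQ[symmetric] using inverse_mult_eq_1'[of "fps_of_poly Nc"] Nc0 by (simp add: mult_ac)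
  ultimately have Qrad: "1 \<le> fps_conv_radius Qc"
    using fps_conv_radius_mult[of "fps_of_poly Xd" "inverse (fps_of_poly Nc)"] by (simp add: min_def split: if_splits)
  \<comment> \<open>At \<open>- x\<close> the signs in \<open>Q\<close> disappear: N(-x) times the
    Poincare series at \<open>x\<close> is \<open>(1 + x) ^ d\<close>. The lower bound for that
    series gives the estimate, where \<open>1 + x \<le> 2\<close> produces the constant.\<close>
  have main: "0 < poly Nr (- x) \<and> poly Nr (- x) \<le> 2 ^ (d + \<mu>) * (1 - x) ^ \<mu>" if x: "0 < x" "x < 1" for x
  proof -
    define S where "S = suminf (\<lambda>i. real (B i) * x ^ i)"
    have r: "ereal (norm (- of_real x :: complex)) < fps_conv_radius Qc"
      using Qrad x by (simp add: less_le_trans[of _ 1])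
    have t: "Qc $ i * (- of_real x) ^ i = of_real (real (B i) * x ^ i)" for i
      by (cases "even i") (simp_all add: Qc_def Q_def)
    have s: "summable (\<lambda>i. real (B i) * x ^ i)"
      using summable_fps[OF r] unfolding t summable_complex_of_real .
    have "eval_fps Qc (- of_real x) = of_real S"
      unfolding eval_fps_def t S_def by (rule suminf_of_real[OF s, symmetric])
    moreover have "eval_fps (fps_of_poly Nc * Qc) (- of_real x) = poly Nc (- of_real x) * eval_fps Qc (- of_real x)"
      using eval_fps_mult[of "- of_real x" "fps_of_poly Nc" Qc] r by simp
    moreover have "poly Nc (- of_real x) = of_real (poly Nr (- x))"
      using poly_map_of_real[of N "- x"] by (simp add: Nc_def Nr_def)
    moreover have "eval_fps (fps_of_poly Nc * Qc) (- of_real x) = of_real ((1 + x) ^ d)"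
      unfolding NQ by (simp add: Xd_def poly_monom)
    ultimately have "of_real (poly Nr (- x) * S) = (of_real ((1 + x) ^ d) :: complex)" by simp
    then have NS: "poly Nr (- x) * S = (1 + x) ^ d" unfolding of_real_eq_iff .
    have S: "1 / (1 - x ^ 2) ^ \<mu> \<le> S"
      unfolding S_def by (rule eval_geo_square_le[OF le _ s x]) simp
    have x2: "0 < 1 - x ^ 2" using x by (simp add: power_less_one_iff)
    then have "0 < S" using S by (smt (verit) divide_pos_pos zero_less_power)
    then have N: "0 < poly Nr (- x)" using NS x by (metis add_pos_pos zero_less_mult_pos2 zero_less_one zero_less_power)
    have "poly Nr (- x) * (1 / (1 - x ^ 2) ^ \<mu>) \<le> (1 + x) ^ d"
      using mult_left_mono[OF S less_imp_le[OF N]] NS by simp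
    then have "poly Nr (- x) \<le> (1 + x) ^ d * (1 - x ^ 2) ^ \<mu>" using x2 by (simp add: field_simps)
    also have "\<dots> = (1 + x) ^ (d + \<mu>) * (1 - x) ^ \<mu>"
      by (simp add: power_add power_mult_distrib[symmetric] power2_eq_square algebra_simps)
    also have "\<dots> \<le> 2 ^ (d + \<mu>) * (1 - x) ^ \<mu>"
      using x by (intro mult_right_mono power_mono) auto
    finally show ?thesis using N by simp
  qed
  have "N \<noteq> 0" using N0 by auto
  \<comment> \<open>The exact power of 1 + X is split off over the integers, so that the cofactor
    still takes integer values.\<close>
  then obtain U where U: "N = [:1, 1:] ^ order (- 1) N * U" "\<not> [:1, 1:] dvd U"
    using order_decomp[of N "- 1"] by auto
  define m where "m = order (- 1) N"
  define Ur :: "real poly" where "Ur = map_poly of_int U"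
  have Nr: "poly Nr x = (1 + x) ^ m * poly Ur x" for x
    unfolding Nr_def Ur_def by (subst U(1)) (simp add: map_poly_of_int_mult map_poly_of_int_power m_def map_poly_pCons)
  have "\<mu> \<le> m"
  proof (rule ccontr)
    assume "\<not> \<mu> \<le> m"
    then have m: "\<mu> = m + (\<mu> - m)" "0 < \<mu> - m" by simp_all
    \<comment> \<open>If \<open>m < \<mu>\<close>, this squeezes the cofactor to 0 at -1, although 1
      + X does not divide it.\<close>
    have bd: "0 \<le> poly Ur (- x) \<and> poly Ur (- x) \<le> 2 ^ (d + \<mu>) * (1 - x) ^ (\<mu> - m)" if x: "0 < x" "x < 1" for x
    proof -
      have 1: "0 < (1 - x) ^ m * poly Ur (- x)" using main[OF x] unfolding Nr by simp
      have "(1 - x) ^ m * poly Ur (- x) \<le> 2 ^ (d + \<mu>) * (1 - x) ^ (m + (\<mu> - m))"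
        using main[OF x] m(1) unfolding Nr by simp
      then have "(1 - x) ^ m * poly Ur (- x) \<le> (1 - x) ^ m * (2 ^ (d + \<mu>) * (1 - x) ^ (\<mu> - m))"
        by (simp only: power_add mult_ac)
      then show ?thesis using 1 x by (simp add: zero_less_mult_iff)
    qed
    have l1: "((\<lambda>x. poly Ur (- x)) \<longlongrightarrow> poly Ur (- 1)) (at_left 1)"
      and l2: "((\<lambda>x. 2 ^ (d + \<mu>) * (1 - x) ^ (\<mu> - m)) \<longlongrightarrow> 2 ^ (d + \<mu>) * (1 - 1 :: real) ^ (\<mu> - m)) (at_left 1)"
      by (intro tendsto_intros | simp)+
    have ev: "eventually (\<lambda>x. poly Ur (- x) \<le> 2 ^ (d + \<mu>) * (1 - x) ^ (\<mu> - m)) (at_left 1)"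
      "eventually (\<lambda>x. 0 \<le> poly Ur (- x)) (at_left 1)"
      unfolding eventually_at_left_field using bd by (auto intro!: exI[of _ 0])
    have "poly Ur (- 1) \<le> 0" using tendsto_le[OF _ l2 l1 ev(1)] m(2) by (simp add: zero_power)
    moreover have "0 \<le> poly Ur (- 1)" using tendsto_lowerbound[OF l1 ev(2)] by simp
    ultimately have "poly U (- 1) = 0" using poly_map_of_int[of U "- 1", where ?'r = real] by (simp add: Ur_def)
    then show False using U(2) poly_eq_0_iff_dvd[of U "- 1"] by simp
  qed
  \<comment> \<open>Positivity of N(1) makes the integer U(1) at least 1.\<close>
  have "poly N 1 = 2 ^ m * poly U 1" by (subst U(1)) (simp add: m_def)
  moreover from this have "1 \<le> poly U 1" using N1 by (simp add: zero_less_mult_iff)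
  ultimately have "(2 :: int) ^ m \<le> poly N 1" by simp
  moreover have "(2 :: int) ^ \<mu> \<le> 2 ^ m" using \<open>\<mu> \<le> m\<close> by (intro power_increasing) auto
  ultimately show ?thesis by linarith
qed

lemma (in wpoly) coset_eq_iff:
  assumes J: "hideal J"
  shows "coset J p = coset J q \<longleftrightarrow> p - q \<in> J"
proof
  assume "coset J p = coset J q"
  moreover have "p \<in> coset J p"
    using hidealD(2)[OF J] unfolding coset_def by (intro image_eqI[of _ _ 0]) simp_all
  ultimately obtain a where "p = q + a" "a \<in> J" unfolding coset_def by auto
  then show "p - q \<in> J" by simp
next
  have sub: "coset J p \<subseteq> coset J q" if pq: "p - q \<in> J" for p q
  proof
    fix x assume "x \<in> coset J p"
    then obtain a where "x = p + a" "a \<in> J" unfolding coset_def by blast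
    then show "x \<in> coset J q"
      unfolding coset_def using hidealD(3)[OF J pq] by (intro image_eqI[of _ _ "(p - q) + a"]) simp_all
  qed
  assume pq: "p - q \<in> J"
  moreover from this have "q - p \<in> J" using hidealD(8)[OF J] by force
  ultimately show "coset J p = coset J q" using sub by blast
qed

text \<open>1 - X is irreducible over the integers: a divisor of degree 0 is a unit because of the
  constant term 1, and one of degree 1 is associated to 1 - X, which would make \<open>N\<close>
  vanish at 1.\<close>

lemma coprime_one_minus_X:
  fixes N :: "int poly"
  assumes "poly N 1 \<noteq> 0"
  shows "coprime N [:1, - 1:]"
proof (rule coprimeI)
  fix c :: "int poly" assume c: "c dvd N" "c dvd [:1, - 1:]"
  then obtain e where e: "[:1, - 1:] = c * e" by (auto elim: dvdE)
  then have nz: "c \<noteq> 0" "e \<noteq> 0" by auto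
  have "degree [:1, - 1 :: int:] = 1" by simp
  then have deg: "degree c + degree e = 1" unfolding e degree_mult_eq[OF nz] .
  have unit: "is_unit x" if x: "degree x = 0" "x dvd [:1, - 1:]" for x :: "int poly"
  proof -
    obtain x0 where x0: "x = [:x0:]" using x(1) by (auto elim: degree_eq_zeroE)
    obtain y where "[:1, - 1:] = [:x0:] * y" using x(2) unfolding x0 by (auto elim: dvdE)
    from arg_cong[OF this, of "\<lambda>p. coeff p 0"] have "x0 dvd 1" by (auto simp: dvd_def)
    then show ?thesis unfolding x0 by (simp add: is_unit_const_poly_iff)
  qed
  show "is_unit c"
  proof (cases "degree c = 0")
    case True
    then show ?thesis using unit c(2) by blast
  next
    case False
    then have "is_unit e" using deg e unit[of e] by simp
    then have "[:1, - 1:] dvd c" using e by (metis dvd_refl dvd_mult_unit_iff)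
    then have "[:1, - 1:] dvd N" using c(1) by (rule dvd_trans)
    then have "poly N 1 = 0" by (auto elim: dvdE)
    then show ?thesis using assms by simp
  qed
qed

lemma dvd_dvd_poly_0_eq:
  fixes p q :: "int poly"
  assumes "p dvd q" "q dvd p" "poly p 0 = 1" "poly q 0 = 1"
  shows "p = q"
proof -
  obtain u where u: "q = p * u" using assms(1) by (auto elim: dvdE)
  obtain v where v: "p = q * v" using assms(2) by (auto elim: dvdE)
  have "p * (u * v) = p * 1" using u v by (metis mult.assoc mult.right_neutral)
  moreover have "p \<noteq> 0" using assms(3) by auto
  ultimately have "u dvd 1" by (metis dvd_triv_left mult_cancel_left)
  then obtain c where c: "u = [:c:]" by (auto simp: is_unit_poly_iff)
  then have "c = 1" using arg_cong[OF u, of "\<lambda>x. poly x 0"] assms by simp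
  then show ?thesis using u c by simp
qed

lemma kronecker_dvd:
  fixes \<delta> :: "nat \<Rightarrow> nat"
  assumes "N dvd (\<Prod>i<l. 1 - monom 1 (\<delta> i))" "\<And>i. i < l \<Longrightarrow> 0 < \<delta> i"
  shows "kronecker_poly N"
  unfolding kronecker_poly_def
proof (intro allI impI)
  fix z :: complex assume z: "poly (map_poly of_int N) z = 0"
  obtain K where K: "(\<Prod>i<l. 1 - monom 1 (\<delta> i)) = N * K" using assms(1) by (auto elim: dvdE)
  have "poly (map_poly of_int (\<Prod>i<k. 1 - monom 1 (\<delta> i))) z = (\<Prod>i<k. 1 - z ^ \<delta> i)" for k
  proof (induction k)
    case (Suc k)
    have "map_poly of_int (1 - monom 1 (\<delta> k)) = (1 - monom 1 (\<delta> k) :: complex poly)"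
      by (rule poly_eqI) (simp add: coeff_map_poly)
    then show ?case unfolding prod.lessThan_Suc map_poly_of_int_mult poly_mult Suc by (simp add: poly_monom)
  qed simp
  from this[of l] have "(\<Prod>i<l. 1 - z ^ \<delta> i) = 0" unfolding K map_poly_of_int_mult poly_mult z by simp
  then obtain i where i: "i < l" "z ^ \<delta> i = 1" by auto
  then show "norm z = 1" using power_eq_1_iff[of z "\<delta> i"] assms(2)[OF i(1)] by simp
qed

lemma fps_fraction_cross_mult:
  fixes H :: "int fps"
  assumes "H * fps_of_poly D = fps_of_poly N" "H * fps_of_poly D' = fps_of_poly N'"
  shows "N * D' = N' * D"
proof -
  have "fps_of_poly (N * D') = fps_of_poly (N' * D)"
    unfolding fps_of_poly_mult assms[symmetric] by (simp only: mult_ac)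
  then show ?thesis by (simp add: fps_of_poly_eq_iff)
qed

lemma (in graded_algebra) hilbert_numerator_eq:
  assumes "hilbert_fraction N D"
  shows "hilbert_numerator = N"
  unfolding hilbert_numerator_def
proof (rule the_equality)
  show "\<exists>D. hilbert_fraction N D" using assms by blast
  fix N' assume "\<exists>D. hilbert_fraction N' D"
  then obtain D' where D': "hilbert_fraction N' D'" by blast
  have eq: "N * D' = N' * D"
    using assms D' unfolding hilbert_fraction_def by (intro fps_fraction_cross_mult) auto
  have "N dvd N' * D" "N' dvd N * D'" using eq dvd_triv_left[of N D'] dvd_triv_left[of N' D] by simp_all
  then have "N dvd N'" "N' dvd N"
    using assms D' unfolding hilbert_fraction_def by (simp_all add: coprime_dvd_mult_left_iff)
  then show "N' = N" using assms D' unfolding hilbert_fraction_def by (intro dvd_dvd_poly_0_eq) auto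
qed

section \<open>The reduced Hilbert fraction, and the Hilbert series of complete
  intersections\<close>

context standard_presentation
begin

lemma hs_ker: "hs ker = (fps_of_int_fps hilbert_series :: 'r::comm_ring_1 fps)"
  by (rule fps_ext) (simp add: hilbert_series_ker hs_def)

text \<open>For the least \<open>d\<close> such that H (1 - x)^d is a polynomial \<open>N\<close>, a
  zero of \<open>N\<close> at 1 would allow a smaller \<open>d\<close>, so the fraction is reduced.
  The sign of N(1) comes from H dominating 1 coefficientwise, which gives N(x) \<ge> (1 - x)^d on
  (0, 1).\<close>

lemma hilbert_numerator:
  "\<exists>d. hilbert_fraction hilbert_numerator ([:1, - 1:] ^ d)
    \<and> hilbert_series * (1 - fps_X) ^ d = fps_of_poly hilbert_numerator \<and> 0 < poly hilbert_numerator 1"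
proof -
  define ok where "ok d \<longleftrightarrow> (\<exists>N. hilbert_series * (1 - fps_X) ^ d = fps_of_poly N)" for d
  have "ok n"
    using hilbert_serre[OF hideal_ker, where ?'r = int]
    by (simp add: ok_def hilbert_series_ker unit_weight_def)
  define d where "d = (LEAST d. ok d)"
  have "ok d" unfolding d_def using \<open>ok n\<close> by (rule LeastI)
  then obtain N where N: "hilbert_series * (1 - fps_X) ^ d = fps_of_poly N" by (auto simp: ok_def)
  have H0: "hf ker 0 = 1" using hf_0[OF hideal_ker] by (simp add: ker_def)
  have "poly N 0 = fps_of_poly N $ 0" by (simp add: poly_0_coeff_0)
  also have "\<dots> = 1" unfolding N[symmetric] hilbert_series_ker using H0 by (simp add: hs_def fps_nth_power_0)
  finally have N0: "poly N 0 = 1" .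
  have nz: "poly N 1 \<noteq> 0" if "0 < d"
  proof
    assume "poly N 1 = 0"
    then obtain M where M: "N = [:- 1, 1:] * M" by (auto simp: poly_eq_0_iff_dvd elim: dvdE)
    have X: "[:- 1, 1:] = - (1 - monom 1 1 :: int poly)" by (simp add: monom_altdef one_pCons)
    have "N = (1 - monom 1 1) * - M" unfolding M X by (rule minus_mult_commute)
    then have "fps_of_poly N = (1 - fps_X) * fps_of_poly (- M)"
      by (simp only: fps_of_poly_mult fps_of_poly_diff fps_of_poly_1 fps_of_poly_monom') simp
    moreover have d1: "(1 - fps_X :: int fps) ^ d = (1 - fps_X) * (1 - fps_X) ^ (d - 1)"
      using that by (metis Suc_diff_1 power_Suc)
    ultimately have "(1 - fps_X) * (hilbert_series * (1 - fps_X) ^ (d - 1)) = (1 - fps_X) * fps_of_poly (- M)"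
      using N unfolding d1 by (simp only: mult.left_commute)
    moreover have "(1 - fps_X :: int fps) \<noteq> 0" using fps_nonzeroI[of "1 - fps_X :: int fps" 0] by simp
    ultimately have "ok (d - 1)" unfolding ok_def by (metis mult_cancel_left)
    then have "d \<le> d - 1" unfolding d_def by (rule Least_le)
    then show False using that by simp
  qed
  define Nr :: "real poly" where "Nr = map_poly of_int N"
  have "fps_of_poly Nr = hs ker * (1 - fps_X) ^ d"
    unfolding hs_ker Nr_def fps_of_int_fps_poly[symmetric] N[symmetric]
    by (simp add: fps_of_int_fps_mult fps_of_int_fps_power)
  then have hsN: "(hs ker :: real fps) = fps_of_poly Nr * geo d" by (intro eq_mult_geo) simp
  have lower: "(1 - x) ^ d \<le> poly Nr x" if x: "0 < x" "x < 1" for x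
  proof -
    have "eval_fps 1 x \<le> eval_fps (fps_of_poly Nr * geo d) x"
    proof (rule eval_fps_le[OF _ _ conv_radius_poly_geo x])
      show "1 $ m \<le> (fps_of_poly Nr * geo d) $ m" for m
        unfolding hsN[symmetric] using H0 by (simp add: hs_def)
    qed simp
    then show ?thesis unfolding eval_poly_geo[OF x] using x by (simp add: field_simps)
  qed
  have "((\<lambda>x. (1 - x) ^ d) \<longlongrightarrow> (1 - 1 :: real) ^ d) (at_left 1)" "((\<lambda>x. poly Nr x) \<longlongrightarrow> poly Nr 1) (at_left 1)"
    by (intro tendsto_intros | simp)+
  moreover have "eventually (\<lambda>x. (1 - x) ^ d \<le> poly Nr x) (at_left 1)"
    unfolding eventually_at_left_field using lower by (intro exI[of _ 0]) auto
  \<comment> \<open>For \<open>d = 0\<close> the left side is 1 and positivity is immediate; for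
    \<open>d > 0\<close> it is 0, and \<open>nz\<close> excludes equality.\<close>
  ultimately have "(1 - 1) ^ d \<le> poly Nr 1" by (intro tendsto_le[of "at_left (1 :: real)"]) auto
  moreover have "poly Nr 1 = of_int (poly N 1)" using poly_map_of_int[of N 1, where ?'r = real] by (simp add: Nr_def)
  ultimately have N1: "0 < poly N 1" using nz by (cases "d = 0") (auto simp: zero_power)
  have D: "fps_of_poly ([:1, - 1:] ^ d) = (1 - fps_X :: int fps) ^ d"
    by (simp add: fps_of_poly_power fps_of_poly_pCons)
  have frac: "hilbert_fraction N ([:1, - 1:] ^ d)"
    using N N0 N1 coprime_one_minus_X[of N] unfolding hilbert_fraction_def D by simp
  then show ?thesis using N N1 hilbert_numerator_eq[OF frac] by blast
qed

lemma complete_intersection_imp_cyclotomic: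
  assumes "complete_intersection"
  shows "hilbert_cyclotomic"
proof -
  obtain n' w fs \<psi> where w: "\<forall>i<n'. 0 < w i" and hom: "\<forall>f\<in>set fs. \<exists>j. f \<in> poly_comp n' w j"
    and reg: "regular_sequence n' fs" and iso: "quotient_iso n' w (gen_ideal n' fs) \<psi>"
    using assms unfolding complete_intersection_def by blast
  interpret W: wpoly n' w using w by unfold_locales simp
  define I where "I = gen_ideal n' fs"
  have "\<forall>i. \<exists>j. i < length fs \<longrightarrow> fs ! i \<in> W.C j" using hom by simp
  then obtain \<delta> where \<delta>: "\<And>i. i < length fs \<Longrightarrow> fs ! i \<in> W.C (\<delta> i)" by metis
  have I: "W.hideal I" unfolding I_def using hom by (intro W.hideal_gen_ideal) auto
  have one: "1 \<notin> I" using reg by (simp add: regular_sequence_def I_def)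
  note iso = iso[folded I_def, unfolded quotient_iso_def, folded smul_def]
  have bij: "bij_betw \<psi> (coset I ` W.P) UNIV" using iso by blast
  have add: "\<psi> (coset I (p + q)) = \<psi> (coset I p) + \<psi> (coset I q)" if "p \<in> W.P" "q \<in> W.P" for p q
    using iso that by blast
  have sc: "\<psi> (coset I (smul c p)) = scale c (\<psi> (coset I p))" if "p \<in> W.P" for c p
    using iso that by blast
  have img: "\<psi> ` coset I ` W.C j = A j" for j using iso by blast
  \<comment> \<open>\<open>restr S\<close> projects onto the polynomial ring, so that
    \<open>f\<close> is linear on the whole type and rank and nullity apply to it.\<close>
  define S where "S = {m :: nat \<Rightarrow>\<^sub>0 nat. supp m \<subseteq> {..<n'}}"
  define f where "f p = \<psi> (coset I (restr S p))" for p
  have SP: "restr S p \<in> W.P" for p :: "'k mpoly" by (auto simp: poly_ring_def S_def)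
  have Sid: "restr S p = p" if "p \<in> W.P" for p :: "'k mpoly"
    using that by (intro restr_id) (auto simp: poly_ring_def S_def)
  have lin: "Vector_Spaces.linear smul scale f"
    by unfold_locales (simp_all add: f_def restr_add restr_smul add[OF SP SP] sc[OF SP])
  have f0: "f 0 = 0" using add[of 0 0] by (simp add: f_def)
  have "dim (A j) = W.hf I j" for j
  proof -
    have "{v \<in> W.C j. f v = 0} = I \<inter> W.C j"
    proof -
      have "f v = 0 \<longleftrightarrow> v \<in> I" if v: "v \<in> W.P" for v
      proof -
        have "f v = 0 \<longleftrightarrow> \<psi> (coset I v) = \<psi> (coset I 0)" using f0 v by (simp add: f_def Sid)
        also have "\<dots> \<longleftrightarrow> coset I v = coset I 0"
          using bij v inj_on_eq_iff[of \<psi> "coset I ` W.P" "coset I v" "coset I 0"] by (simp add: bij_betw_def)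
        also have "\<dots> \<longleftrightarrow> v \<in> I" using W.coset_eq_iff[OF I, of v 0] by simp
        finally show ?thesis .
      qed
      then show ?thesis using W.C_P by blast
    qed
    moreover have "f ` W.C j = A j"
    proof -
      have "f ` W.C j = \<psi> ` coset I ` W.C j"
        unfolding image_image f_def using Sid[OF W.C_P] by (intro image_cong) simp_all
      then show ?thesis using img by simp
    qed
    ultimately show ?thesis
      using evp.dim_kernel_image(1)[OF lin W.C_dim[of j]] by (simp add: W.hf_def)
  qed
  then have H: "hilbert_series = W.hs I" by (intro fps_ext) (simp add: hilbert_series_def W.hs_def)
  have hs: "hilbert_series = (\<Prod>i<length fs. 1 - fps_X ^ \<delta> i) * W.hs ({0} :: 'k mpoly set)"
    unfolding H I_def by (rule W.hs_regular_sequence[OF reg \<delta>])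
  \<comment> \<open>A generator of degree 0 would make the product, hence the Hilbert series, zero,
    whereas 1 is not in the ideal.\<close>
  have pos: "0 < \<delta> i" if "i < length fs" for i
  proof (rule ccontr)
    assume "\<not> 0 < \<delta> i"
    then have "(\<Prod>i<length fs. 1 - fps_X ^ \<delta> i :: int fps) = 0" using that by (intro prod_zero bexI[of _ i]) simp_all
    then have "hilbert_series = 0" using hs by simp
    then have "int (W.hf I 0) = 0" unfolding H by (metis W.hs_def fps_nth_Abs_fps fps_zero_nth)
    then show False using W.hf_0[OF I one] by simp
  qed
  define V where "V = (\<Prod>i<length fs. 1 - monom 1 (\<delta> i) :: int poly)"
  define U where "U = (\<Prod>i<n'. 1 - monom 1 (w i) :: int poly)"
  have fp: "fps_of_poly (\<Prod>i<k. 1 - monom 1 (a i) :: int poly) = (\<Prod>i<k. 1 - fps_X ^ a i)" for a k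
    by (simp add: fps_of_poly_prod fps_of_poly_diff fps_of_poly_monom')
  have HU: "hilbert_series * fps_of_poly U = fps_of_poly V"
    unfolding hs U_def V_def fp mult.assoc using W.hs_zero_ideal[where ?'k = 'k and ?'r = int] by simp
  obtain d where d: "hilbert_fraction hilbert_numerator ([:1, - 1:] ^ d)" using hilbert_numerator by blast
  define N D where "N = hilbert_numerator" and "D = [:1, - 1 :: int:] ^ d"
  \<comment> \<open>Two fractions for the same series; as \<open>N\<close> is coprime to
    \<open>D\<close>, it divides \<open>V\<close>, whose roots are roots of unity.\<close>
  have "N * U = V * D"
    using d unfolding hilbert_fraction_def N_def[symmetric] D_def[symmetric]
    by (intro fps_fraction_cross_mult[OF _ HU]) simp
  then have "N dvd V * D" using dvd_triv_left[of N U] by simp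
  then have "N dvd V" using d by (simp add: hilbert_fraction_def N_def D_def coprime_dvd_mult_left_iff)
  then show ?thesis
    unfolding hilbert_cyclotomic_def N_def[symmetric] V_def using pos by (rule kronecker_dvd)
qed

lemma quotient_iso_ker: "\<exists>\<psi>. quotient_iso n unit_weight ker \<psi>"
proof -
  define \<psi> where "\<psi> X = ev b (SOME p. p \<in> P \<and> X = coset ker p)" for X
  have \<psi>: "\<psi> (coset ker p) = ev b p" if p: "p \<in> P" for p
  proof -
    let ?p = "SOME p'. p' \<in> P \<and> coset ker p = coset ker p'"
    have "?p \<in> P \<and> coset ker p = coset ker ?p"
      by (rule someI[of "\<lambda>p'. p' \<in> P \<and> coset ker p = coset ker p'" p]) (simp add: p)
    then have "p - ?p \<in> ker" using coset_eq_iff[OF hideal_ker, of p ?p] by simp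
    then show ?thesis unfolding \<psi>_def by (simp add: ker_def ev_diff)
  qed
  have "bij_betw \<psi> (coset ker ` P) UNIV"
    unfolding bij_betw_def inj_on_def
  proof (intro conjI ballI impI)
    fix X Y assume "X \<in> coset ker ` P" "Y \<in> coset ker ` P" and eq: "\<psi> X = \<psi> Y"
    then obtain p p' where p: "p \<in> P" "p' \<in> P" "X = coset ker p" "Y = coset ker p'" by blast
    then have "p - p' \<in> ker" using eq \<psi> by (simp add: ker_def ev_diff poly_ring_diff)
    then show "X = Y" using p coset_eq_iff[OF hideal_ker] by blast
  next
    have "\<psi> ` coset ker ` P = ev b ` P" unfolding image_image using \<psi> by (rule image_cong[OF refl])
    then show "\<psi> ` coset ker ` P = UNIV" using ev_surj by simp
  qed
  moreover have "\<psi> ` coset ker ` C j = A j" for j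
  proof -
    have "\<psi> ` coset ker ` C j = ev b ` C j" unfolding image_image using \<psi>[OF C_P] by (rule image_cong[OF refl])
    then show ?thesis using ev_C_image by simp
  qed
  ultimately have "quotient_iso n unit_weight ker \<psi>"
    unfolding quotient_iso_def smul_def[symmetric]
    by (simp add: \<psi> ev_add ev_mult ev_smul poly_ring_add poly_ring_mult poly_ring_smul)
  then show ?thesis by blast
qed

end

section \<open>Cyclotomic Koszul algebras are complete intersections\<close>

context linear_resolution
begin

lemma cyclotomic_imp_complete_intersection:
  assumes cyc: "hilbert_cyclotomic"
  shows "complete_intersection"
proof -
  obtain B where B: "finite B" "mp.independent B" "mp.span B = ker \<inter> C 2"
    using hideal_dim(1)[OF hideal_ker, of 2] unfolding mp.has_dim_def by (elim exE conjE)
  obtain fs where fs: "set fs = B" "distinct fs" using finite_distinct_list[OF B(1)] by blast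
  have fB: "fs ! l \<in> ker \<inter> C 2" if "l < length fs" for l
    using mp.span_base[of "fs ! l" B] nth_mem[OF that] unfolding B(3) fs(1) by blast
  have fsC: "set fs \<subseteq> C 2" using mp.span_superset[of B] unfolding B(3) fs(1) by blast
  have K: "gen_ideal n fs = ker"
  proof
    have "set fs \<subseteq> ker" using mp.span_superset[of B] unfolding B(3) fs(1) by blast
    then show "gen_ideal n fs \<subseteq> ker" by (rule gen_ideal_subset[OF hideal_ker])
    have hJ: "hideal (gen_ideal n fs)" using fsC by (intro hideal_gen_ideal) auto
    have "B \<subseteq> gen_ideal n fs" using gen_ideal_superset[of fs] fsC fs(1) C_P by blast
    then have "ker \<inter> C 2 \<subseteq> gen_ideal n fs"
      unfolding B(3)[symmetric] by (rule mp.span_minimal[OF _ hideal_subspace[OF hJ]])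
    then show "ker \<subseteq> gen_ideal n fs" by (rule hideal_quadrics[OF hJ])
  qed
  \<comment> \<open>The coefficients of any expansion will do; making them symmetric would require
    division by 2.\<close>
  have "\<exists>\<beta>. fs ! l = (\<Sum>j<n. \<Sum>k<n. smul (\<beta> j k) (var j * var k))" if l: "l < length fs" for l
  proof -
    obtain h where h: "\<And>i. h i \<in> C 1" "fs ! l = (\<Sum>i<n. var i * h i)"
      using var_expansion[of "fs ! l" 2] fB[OF l] by auto
    have "\<exists>c. \<forall>i. h i = (\<Sum>k<n. smul (c i k) (var k))"
      by (rule choice) (use C1_linear_combination[OF h(1)] in blast)
    then obtain c where "\<And>i. h i = (\<Sum>k<n. smul (c i k) (var k))" by blast
    then show ?thesis using h(2) by (intro exI[of _ c]) (simp add: sum_distrib_left smul_mult_right)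
  qed
  then have "\<forall>l. \<exists>\<beta>. l < length fs \<longrightarrow> fs ! l = (\<Sum>j<n. \<Sum>k<n. smul (\<beta> j k) (var j * var k))" by blast
  from choice[OF this] obtain \<beta> where
    \<beta>: "\<And>l. l < length fs \<Longrightarrow> fs ! l = (\<Sum>j<n. \<Sum>k<n. smul (\<beta> l j k) (var j * var k))"
    by blast
  interpret cl: clifford_resolution scale A n b r e d \<epsilon> Z q \<Gamma> "length fs" \<beta>
  proof unfold_locales
    fix l assume l: "l < length fs"
    have "ev b (fs ! l) = 0" using fB[OF l] by (simp add: ker_def)
    then show "(\<Sum>j<n. \<Sum>k<n. scale (\<beta> l j k) (b j * b k)) = 0"
      unfolding \<beta>[OF l] by (simp add: ev_sum ev_smul ev_mult ev_var)
  next
    fix c :: "nat \<Rightarrow> 'k" and l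
    assume sq: "\<And>j. j < n \<Longrightarrow> (\<Sum>l<length fs. \<beta> l j j * c l) = 0"
      and alt: "\<And>j k. j < n \<Longrightarrow> k < n \<Longrightarrow>
        (\<Sum>l<length fs. \<beta> l j k * c l) + (\<Sum>l<length fs. \<beta> l k j * c l) = 0"
      and l: "l < length fs"
    \<comment> \<open>The hypotheses on \<open>c\<close> say that \<open>\<gamma>\<close> is
      alternating, so the combination of the quadrics with coefficients \<open>c\<close> is zero,
      and independence of \<open>B\<close> forces \<open>c\<close> to vanish.\<close>
    define \<gamma> where "\<gamma> j k = (\<Sum>l<length fs. \<beta> l j k * c l)" for j k
    have "(\<Sum>l<length fs. smul (c l) (fs ! l))
        = (\<Sum>l<length fs. \<Sum>j<n. \<Sum>k<n. smul (\<beta> l j k * c l) (var j * var k))"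
      by (intro sum.cong refl) (simp add: \<beta> mp.scale_sum_right mult.commute)
    also have "\<dots> = (\<Sum>j<n. \<Sum>l<length fs. \<Sum>k<n. smul (\<beta> l j k * c l) (var j * var k))"
      by (rule sum.swap)
    also have "\<dots> = (\<Sum>j<n. \<Sum>k<n. \<Sum>l<length fs. smul (\<beta> l j k * c l) (var j * var k))"
      by (rule sum.cong[OF refl]) (rule sum.swap)
    also have "\<dots> = (\<Sum>j<n. \<Sum>k<n. smul (\<gamma> j k) (var j * var k))"
      by (simp add: \<gamma>_def mp.scale_sum_left)
    also have "\<dots> = 0"
    proof (rule alternating_sum_zero)
      fix j k assume jk: "j < n" "k < n"
      have "smul (\<gamma> j k) (var j * var k) + smul (\<gamma> k j) (var k * var j)
          = smul (\<gamma> j k + \<gamma> k j) (var j * var k)"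
        by (simp add: mp.scale_left_distrib mult.commute)
      then show "smul (\<gamma> j k) (var j * var k) + smul (\<gamma> k j) (var k * var j) = 0"
        using alt[OF jk] by (simp add: \<gamma>_def)
    qed (simp add: \<gamma>_def sq)
    finally have "(\<Sum>l<length fs. smul (c l) (fs ! l)) = 0" .
    moreover have "inj_on ((!) fs) {..<length fs}" "(!) fs ` {..<length fs} = B"
      using fs by (auto simp: inj_on_def nth_eq_iff_index_eq in_set_conv_nth)
    ultimately show "c l = 0"
      using mp.family_independentD[of "(!) fs" "{..<length fs}" c l] B(2) l by simp
  qed
  obtain d' where d': "hilbert_fraction hilbert_numerator ([:1, - 1:] ^ d')"
      "hilbert_series * (1 - fps_X) ^ d' = fps_of_poly hilbert_numerator" "0 < poly hilbert_numerator 1"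
    using hilbert_numerator by blast
  have N: "2 ^ length fs \<le> poly hilbert_numerator 1"
    using numerator_at_one_ge[OF d'(2) poincare_hilbert _ d'(3) _ cl.geo_le_betti] d'(1) cyc
    by (simp add: hilbert_fraction_def hilbert_cyclotomic_def)
  have "regular_sequence n fs"
  proof (rule regular_sequence_quadrics[OF fsC])
    show "hs (gen_ideal n fs) * (1 - fps_X) ^ d' = (fps_of_poly (map_poly of_int hilbert_numerator) :: real fps)"
      unfolding K hs_ker fps_of_int_fps_poly[symmetric] d'(2)[symmetric]
      by (simp add: fps_of_int_fps_mult fps_of_int_fps_power)
    have "(2 :: real) ^ length fs = of_int (2 ^ length fs)" by simp
    also have "\<dots> \<le> of_int (poly hilbert_numerator 1)" using N unfolding of_int_le_iff .
    also have "\<dots> = poly (map_poly of_int hilbert_numerator) 1"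
      using poly_map_of_int[of hilbert_numerator 1, where ?'r = real] by simp
    finally show "(2 :: real) ^ length fs \<le> poly (map_poly of_int hilbert_numerator) 1" .
  qed
  moreover obtain \<psi> where "quotient_iso n unit_weight (gen_ideal n fs) \<psi>"
    using quotient_iso_ker unfolding K by blast
  ultimately show ?thesis
    unfolding complete_intersection_def using fsC w_pos
    by (intro exI[of _ n] exI[of _ unit_weight] exI[of _ fs] exI[of _ \<psi>]) auto
qed

end

theorem theoremA:
  fixes scale :: "'k::field \<Rightarrow> 'a::comm_ring_1 \<Rightarrow> 'a"
    and A :: "nat \<Rightarrow> 'a set"
  assumes "graded_algebra scale A"
    and "graded_algebra.koszul scale A"
  shows "graded_algebra.hilbert_cyclotomic scale A \<longleftrightarrow>
         graded_algebra.complete_intersection scale A"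
proof -
  interpret graded_algebra scale A by (rule assms(1))
  obtain r e d \<epsilon> where std: "standard_graded" and F: "free_resolution r e d \<epsilon>"
      "\<And>i j. i \<noteq> j \<Longrightarrow> tor_cycles r e d i j = tor_boundaries r e d i j"
    using assms(2) unfolding koszul_def by blast
  obtain n b where "standard_presentation scale A n b" using standard_presentation_exists[OF std] by blast
  then interpret standard_presentation scale A n b .
  interpret koszul_resolution scale A n b r e d \<epsilon> using F by unfold_locales
  obtain Z q \<Gamma> where "Z 0 = irr" "\<And>i. linear_basis (Z i) (q i) (\<Gamma> i)"
      "\<And>i. Z (Suc i) = syzygies (q i) (\<Gamma> i)" "\<And>i. \<exists>p. linear_syzygy (Z i) p"
    using linear_resolution_exists by blast
  then interpret linear_resolution scale A n b r e d \<epsilon> Z q \<Gamma> by unfold_locales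
  show ?thesis
    using complete_intersection_imp_cyclotomic cyclotomic_imp_complete_intersection by blast
qed

end
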